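(* Assume that the linear equation $du(t)=A(t)u(t)\,dt+G(t)u(t)\,d\omega(t)$ in $\mathbb{R}^n$ admits a nonuniform mean-square exponential contraction, i.e. there are constants $K,\alpha>0$ and $\beta\in[0,\alpha)$ with $$\mathbb{E}\|\Phi(t)\Phi^{-1}(s)\|^2\le Ke^{-\alpha(t-s)+\beta|s|}\quad\text{for all } t\ge s \text{ in } I.$$ Let $f,h:[0,\infty)\times L^2(\Omega,\mathbb{R}^n)\to L^2(\Omega,\mathbb{R}^n)$ be continuous with $f(t,0)=h(t,0)=0$ for all $t\ge0$, and suppose that there are constants $c>0$ and $q>1$ such that for all $t\ge0$ and $u,v\in L^2(\Omega,\mathbb{R}^n)$ $$\max\{\mathbb{E}\|f(t,u)-f(t,v)\|^2,\ \mathbb{E}\|h(t,u)-h(t,v)\|^2\}\le c\,\mathbb{E}\|u-v\|^2\,(\mathbb{E}\|u\|^2+\mathbb{E}\|v\|^2)^q .$$ Assume that $-q\alpha+\beta<0$. Then there exists a sufficiently small $\delta>0$ such that for every $\xi_0\in\mathbb{R}^n$ with $\|\xi_0\|\le\delta$, the solution $u(t)$ of the perturbed equation $$du(t)=\big(A(t)u(t)+f(t,u(t))\big)dt+\big(G(t)u(t)+h(t,u(t))\big)d\omega(t)$$ starting at $u(0)=\xi_0$ is mean-square exponentially stable, satisfying $$\mathbb{E}\|u(t)\|^2\le\tilde K e^{-\alpha t},\qquad t\ge0,$$ where $\tilde K>0$ is a constant.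
   Context: $(\Omega,\mathscr{F},\mathbb{P})$ is a probability space, $\omega(t)$ is a scalar Brownian motion on it, $I$ is either $\mathbb{R}^+$ or $\mathbb{R}$, $\|\cdot\|$ is the Euclidean vector norm or the matrix norm, and $L^2(\Omega,\mathbb{R}^n)$ is the space of $\mathbb{R}^n$-valued random variables $x$ with $\mathbb{E}\|x\|^2<\infty$. The coefficients $A(t),G(t)$, $t\in I$, are continuous real $n\times n$ matrix functions with $\limsup_{t\to+\infty}\frac1t\log^+\|A(t)\|=0$ and $\limsup_{t\to+\infty}\frac1t\log^+\|G(t)\|=0$, where $\log^+x=\max\{0,\log x\}$. $\Phi(t)$ is a fundamental matrix solution of the linear equation. Mean-square exponential stability of the solution refers to the displayed exponential decay of $\mathbb{E}\|u(t)\|^2$.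
   Formalization: Existence of the solution is asserted only when f and h are nonanticipating (they map adapted L² variables to adapted ones), since otherwise the Itô equation need not have a solution; the decay bound and uniqueness are asserted for every adapted solution without this assumption. *)

theory Defs
  imports "HOL-Probability.Probability"
begin

section \<open>Square integrable random variables\<close>

text \<open>
  Elements of \<open>L2 M\<close> are functions, not classes modulo null sets.  All notions below are
  invariant under almost sure equality; in particular membership in \<open>L2_adapted M F t\<close>, the
  space \<open>L\<^sup>2\<close> of the sub-sigma-algebra \<open>F t\<close>, only asks for an almost surely equal
  \<open>F t\<close>-measurable version (so \<open>F\<close> need not be completed).
\<close>

definition L2 :: "'w measure \<Rightarrow> ('w \<Rightarrow> 'b::euclidean_space) set" where
  "L2 M = {X. X \<in> borel_measurable M \<and> integrable M (\<lambda>w. (norm (X w))\<^sup>2)}"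

definition L2_adapted ::
  "'w measure \<Rightarrow> (real \<Rightarrow> 'w measure) \<Rightarrow> real \<Rightarrow> ('w \<Rightarrow> 'b::euclidean_space) set" where
  "L2_adapted M F t =
     {X \<in> L2 M. \<exists>Y. Y \<in> borel_measurable (F t) \<and> (AE w in M. X w = Y w)}"

definition L2_dist :: "'w measure \<Rightarrow> ('w \<Rightarrow> 'b::euclidean_space) \<Rightarrow> ('w \<Rightarrow> 'b) \<Rightarrow> real" where
  "L2_dist M X Y = sqrt (\<integral>w. (norm (X w - Y w))\<^sup>2 \<partial>M)"

definition L2_continuous_coeff ::
  "'w measure \<Rightarrow> (real \<Rightarrow> ('w \<Rightarrow> 'b::euclidean_space) \<Rightarrow> ('w \<Rightarrow> 'b)) \<Rightarrow> bool" where
  "L2_continuous_coeff M f \<longleftrightarrow>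
     (\<forall>t\<ge>0. \<forall>u\<in>L2 M. f t u \<in> L2 M) \<and>
     (\<forall>t\<ge>0. \<forall>u\<in>L2 M. \<forall>\<epsilon>>0. \<exists>d>0. \<forall>s\<ge>0. \<forall>v\<in>L2 M.
        \<bar>s - t\<bar> < d \<and> L2_dist M v u < d \<longrightarrow> L2_dist M (f s v) (f t u) < \<epsilon>)"

definition nonanticipating ::
  "'w measure \<Rightarrow> (real \<Rightarrow> 'w measure) \<Rightarrow>
     (real \<Rightarrow> ('w \<Rightarrow> 'b::euclidean_space) \<Rightarrow> ('w \<Rightarrow> 'b)) \<Rightarrow> bool" where
  "nonanticipating M F f \<longleftrightarrow> (\<forall>t\<ge>0. \<forall>u\<in>L2_adapted M F t. f t u \<in> L2_adapted M F t)"


section \<open>Brownian motion\<close>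

definition filtration_on :: "'w measure \<Rightarrow> real set \<Rightarrow> (real \<Rightarrow> 'w measure) \<Rightarrow> bool" where
  "filtration_on M I F \<longleftrightarrow>
     (\<forall>t\<in>I. subalgebra M (F t)) \<and>
     (\<forall>s\<in>I. \<forall>t\<in>I. s \<le> t \<longrightarrow> sets (F s) \<subseteq> sets (F t))"

text \<open>
  Only the increments up to time \<open>t\<close> have to be \<open>F t\<close>-measurable.  On \<open>{0..}\<close> this is the usual
  adaptedness because \<open>W 0 = 0\<close>; for a two-sided Brownian motion \<open>W t\<close> with \<open>t < 0\<close> is minus
  an increment lying after \<open>t\<close> and cannot itself be \<open>F t\<close>-measurable.
\<close>

definition brownian_motion_on ::
  "'w measure \<Rightarrow> real set \<Rightarrow> (real \<Rightarrow> 'w measure) \<Rightarrow> (real \<Rightarrow> 'w \<Rightarrow> real) \<Rightarrow> bool" where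
  "brownian_motion_on M I F W \<longleftrightarrow>
     (\<forall>t\<in>I. W t \<in> borel_measurable M) \<and>
     (AE w in M. W 0 w = 0) \<and>
     (AE w in M. continuous_on I (\<lambda>t. W t w)) \<and>
     (\<forall>s\<in>I. \<forall>t\<in>I. s \<le> t \<longrightarrow> (\<lambda>w. W t w - W s w) \<in> borel_measurable (F t)) \<and>
     (\<forall>s\<in>I. \<forall>t\<in>I. s < t \<longrightarrow>
        distributed M lborel (\<lambda>w. W t w - W s w) (normal_density 0 (sqrt (t - s))) \<and>
        prob_space.indep_set M (sets (F s))
          {(\<lambda>w. W t w - W s w) -` B \<inter> space M | B. B \<in> sets borel})"


section \<open>Integrals of step processes and their extension\<close>

text \<open>
  A step process on \<open>[a, b]\<close> takes the (random) value \<open>\<xi> i\<close> on \<open>[p i, p (i + 1))\<close>, where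
  \<open>a = p 0 \<le> \<dots> \<le> p m = b\<close>.
\<close>

definition is_partition :: "real \<Rightarrow> real \<Rightarrow> (nat \<Rightarrow> real) \<Rightarrow> nat \<Rightarrow> bool" where
  "is_partition a b p m \<longleftrightarrow> p 0 = a \<and> p m = b \<and> (\<forall>i<m. p i \<le> p (Suc i))"

definition step_process ::
  "(nat \<Rightarrow> real) \<Rightarrow> nat \<Rightarrow> (nat \<Rightarrow> 'w \<Rightarrow> 'b::euclidean_space) \<Rightarrow> real \<Rightarrow> 'w \<Rightarrow> 'b" where
  "step_process p m \<xi> s w = (\<Sum>i<m. indicator {p i..<p (Suc i)} s *\<^sub>R \<xi> i w)"

definition step_integral ::
  "(real \<Rightarrow> 'w \<Rightarrow> real) \<Rightarrow> (nat \<Rightarrow> real) \<Rightarrow> nat \<Rightarrow> (nat \<Rightarrow> 'w \<Rightarrow> 'b::euclidean_space) \<Rightarrow> 'w \<Rightarrow> 'b" where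
  "step_integral Z p m \<xi> w = (\<Sum>i<m. (Z (p (Suc i)) w - Z (p i) w) *\<^sub>R \<xi> i w)"

text \<open>
  The time integral of an \<open>L\<^sup>2\<close>-valued function is its Bochner integral: the limit of the
  integrals of step functions converging to it in \<open>L\<^sup>1\<close> of time with values in \<open>L\<^sup>2\<close>.
\<close>

definition has_L2_integral ::
  "'w measure \<Rightarrow> (real \<Rightarrow> 'w \<Rightarrow> 'b::euclidean_space) \<Rightarrow> real \<Rightarrow> real \<Rightarrow> ('w \<Rightarrow> 'b) \<Rightarrow> bool" where
  "has_L2_integral M g a b Y \<longleftrightarrow>
     (\<forall>s\<in>{a..b}. g s \<in> L2 M) \<and> Y \<in> L2 M \<and>
     (\<exists>p m \<xi>.
        (\<forall>k. is_partition a b (p k) (m k)) \<and>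
        (\<forall>k. \<forall>i<m k. \<xi> k i \<in> L2 M) \<and>
        (\<forall>k. (\<lambda>s. L2_dist M (g s) (step_process (p k) (m k) (\<xi> k) s)) integrable_on {a..b}) \<and>
        (\<lambda>k. integral {a..b} (\<lambda>s. L2_dist M (g s) (step_process (p k) (m k) (\<xi> k) s)))
          \<longlonglongrightarrow> 0 \<and>
        (\<lambda>k. L2_dist M (step_integral (\<lambda>t w. t) (p k) (m k) (\<xi> k)) Y) \<longlonglongrightarrow> 0)"

text \<open>
  The Ito integral: the values of the approximating step processes are known at the left end
  points, and convergence is in \<open>L\<^sup>2\<close> of time and probability, so that the limit \<open>Y\<close> is
  almost surely unique by the Ito isometry.
\<close>

definition has_ito_integral ::
  "'w measure \<Rightarrow> (real \<Rightarrow> 'w measure) \<Rightarrow> (real \<Rightarrow> 'w \<Rightarrow> real) \<Rightarrow>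
     (real \<Rightarrow> 'w \<Rightarrow> 'b::euclidean_space) \<Rightarrow> real \<Rightarrow> real \<Rightarrow> ('w \<Rightarrow> 'b) \<Rightarrow> bool" where
  "has_ito_integral M F W g a b Y \<longleftrightarrow>
     (\<forall>s\<in>{a..b}. g s \<in> L2 M) \<and> Y \<in> L2 M \<and>
     (\<exists>p m \<xi>.
        (\<forall>k. is_partition a b (p k) (m k)) \<and>
        (\<forall>k. \<forall>i<m k. \<xi> k i \<in> L2_adapted M F (p k i)) \<and>
        (\<forall>k. (\<lambda>s. (L2_dist M (g s) (step_process (p k) (m k) (\<xi> k) s))\<^sup>2) integrable_on {a..b}) \<and>
        (\<lambda>k. integral {a..b} (\<lambda>s. (L2_dist M (g s) (step_process (p k) (m k) (\<xi> k) s))\<^sup>2))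
          \<longlonglongrightarrow> 0 \<and>
        (\<lambda>k. L2_dist M (step_integral W (p k) (m k) (\<xi> k)) Y) \<longlonglongrightarrow> 0)"


section \<open>Stochastic differential equations\<close>

text \<open>
  \<open>X\<close> is a solution on \<open>[t0, \<infinity>)\<close> of \<open>dX = B(t, X) dt + S(t, X) dW\<close>, \<open>X t0 = x0\<close>.  The
  coefficients act on random variables, hence the equation is one in \<open>L\<^sup>2\<close> for every \<open>t\<close>.
\<close>

definition sde_solution ::
  "'w measure \<Rightarrow> (real \<Rightarrow> 'w measure) \<Rightarrow> (real \<Rightarrow> 'w \<Rightarrow> real) \<Rightarrow>
     (real \<Rightarrow> ('w \<Rightarrow> 'b::euclidean_space) \<Rightarrow> ('w \<Rightarrow> 'b)) \<Rightarrow>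
     (real \<Rightarrow> ('w \<Rightarrow> 'b) \<Rightarrow> ('w \<Rightarrow> 'b)) \<Rightarrow>
     real \<Rightarrow> 'b \<Rightarrow> (real \<Rightarrow> 'w \<Rightarrow> 'b) \<Rightarrow> bool" where
  "sde_solution M F W B S t0 x0 X \<longleftrightarrow>
     (\<forall>t\<ge>t0. X t \<in> L2_adapted M F t) \<and>
     (\<forall>t\<ge>t0. ((\<lambda>s. L2_dist M (X s) (X t)) \<longlongrightarrow> 0) (at t within {t0..})) \<and>
     (\<forall>t\<ge>t0. \<exists>Y Z.
        has_L2_integral M (\<lambda>s. B s (X s)) t0 t Y \<and>
        has_ito_integral M F W (\<lambda>s. S s (X s)) t0 t Z \<and>
        (AE w in M. X t w = x0 + Y w + Z w))"

text \<open>
  A fundamental matrix solution of \<open>du = A(t) u dt + G(t) u dW\<close> on \<open>I\<close>: for every initial time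
  \<open>s\<close> in \<open>I\<close>, \<open>\<Phi>(t) \<Phi>(s)\<^sup>-\<^sup>1\<close> is the matrix solution on \<open>[s, \<infinity>)\<close> which is the identity at time
  \<open>s\<close>.  On \<open>{0..}\<close> this holds for every adapted invertible matrix solution.  On \<open>UNIV\<close> the
  equation cannot be imposed on \<open>\<Phi>\<close> directly, since \<open>\<Phi>(t)\<close> normalized at time \<open>0\<close> depends for
  \<open>t < 0\<close> on increments of \<open>W\<close> after \<open>t\<close>.
\<close>

definition fundamental_matrix ::
  "'w measure \<Rightarrow> real set \<Rightarrow> (real \<Rightarrow> 'w measure) \<Rightarrow> (real \<Rightarrow> 'w \<Rightarrow> real) \<Rightarrow>
     (real \<Rightarrow> real^'n^'n) \<Rightarrow> (real \<Rightarrow> real^'n^'n) \<Rightarrow> (real \<Rightarrow> 'w \<Rightarrow> real^'n^'n) \<Rightarrow> bool" where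
  "fundamental_matrix M I F W A G \<Phi> \<longleftrightarrow>
     (\<forall>t\<in>I. \<Phi> t \<in> borel_measurable M \<and> (AE w in M. invertible (\<Phi> t w))) \<and>
     (\<forall>s\<in>I. sde_solution M F W (\<lambda>t U w. A t ** U w) (\<lambda>t U w. G t ** U w) s (mat 1)
               (\<lambda>t w. \<Phi> t w ** matrix_inv (\<Phi> s w)))"

text \<open>Operator norm (\<open>norm\<close> on \<^typ>\<open>real^'n^'n\<close> is the Frobenius norm).\<close>

definition matrix_norm :: "real^'n^'n \<Rightarrow> real" where
  "matrix_norm A = onorm (\<lambda>x. A *v x)"

text \<open>Correct also at \<open>0\<close>, because \<open>ln 0 = 0\<close> here.\<close>

definition log_plus :: "real \<Rightarrow> real" where
  "log_plus x = max 0 (ln x)"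

definition nonuniform_ms_exp_contraction ::
  "'w measure \<Rightarrow> real set \<Rightarrow> (real \<Rightarrow> 'w \<Rightarrow> real^'n^'n) \<Rightarrow> real \<Rightarrow> real \<Rightarrow> real \<Rightarrow> bool" where
  "nonuniform_ms_exp_contraction M I \<Phi> K \<alpha> \<beta> \<longleftrightarrow>
     K > 0 \<and> \<alpha> > 0 \<and> 0 \<le> \<beta> \<and> \<beta> < \<alpha> \<and>
     (\<forall>s\<in>I. \<forall>t\<in>I. s \<le> t \<longrightarrow>
        (\<integral>w. (matrix_norm (\<Phi> t w ** matrix_inv (\<Phi> s w)))\<^sup>2 \<partial>M)
          \<le> K * exp (- \<alpha> * (t - s) + \<beta> * \<bar>s\<bar>))"

definition perturbed_solution ::
  "'w measure \<Rightarrow> (real \<Rightarrow> 'w measure) \<Rightarrow> (real \<Rightarrow> 'w \<Rightarrow> real) \<Rightarrow>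
     (real \<Rightarrow> real^'n^'n) \<Rightarrow> (real \<Rightarrow> real^'n^'n) \<Rightarrow>
     (real \<Rightarrow> ('w \<Rightarrow> real^'n) \<Rightarrow> ('w \<Rightarrow> real^'n)) \<Rightarrow>
     (real \<Rightarrow> ('w \<Rightarrow> real^'n) \<Rightarrow> ('w \<Rightarrow> real^'n)) \<Rightarrow>
     real^'n \<Rightarrow> (real \<Rightarrow> 'w \<Rightarrow> real^'n) \<Rightarrow> bool" where
  "perturbed_solution M F W A G f h \<xi>0 u \<longleftrightarrow>
     sde_solution M F W (\<lambda>t U w. A t *v U w + f t U w) (\<lambda>t U w. G t *v U w + h t U w) 0 \<xi>0 u"

end

(*
  A solution u of the perturbed equation is compared with solutions of the linear equation that are
  restarted from u at the points of a grid so fine that the linear coefficients are harmless on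
  each grid interval.  The defect produced on one interval is controlled by the perturbation alone
  and is propagated by the linear flow; adding the propagated defects in the L^2 norm, and not in
  mean square, gives E|u(t)|^2 = O(exp(-alpha t)) under the sole condition beta < q alpha, as long
  as u stays small.  A continuity argument shows that small solutions stay small.  This replaces
  the variation of constants formula, whose stochastic integrand Phi(t) Phi(s)^-1 h(s) is not
  adapted.  The contraction estimate applies to random initial values because the second moment
  matrix of a linear solution obeys a linear differential equation.  For existence, the
  perturbation is composed with the radial retraction of L^2 onto a ball, which makes it globally
  Lipschitz; the a priori bound then removes the truncation.
*)
theory Submission
  imports Defs
begin

section \<open>Square integrable random variables\<close>

text \<open>The rates balance as follows. Norm decay at rate \<alpha>/2 makes the perturbation decay
  at rate \<alpha>(1 + q)/2. A defect created near time s is propagated to time t with factor about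
  exp(-\<alpha> t/2) exp((\<alpha> + \<beta>)s/2), which leaves exp(-(q \<alpha> - \<beta>)s/2) =
  exp(-4 \<epsilon> s) when 8 \<epsilon> = q \<alpha> - \<beta>. Since A and G may grow, their norms
  are only bounded by C exp(\<epsilon> s), and noise over a cell of length l contributes sqrt l;
  harmless cells must therefore have length about exp(-2 \<epsilon> s), that is, about exp(2
  \<epsilon> s) of them per unit of time. The defects remain summable, with a margin exp(-2
  \<epsilon> s). Truncation and the continuity argument both act on L^2 norms, and the calculus is
  done with inner products: drift integrals are tested against fixed random variables, and Ito
  integrals enter the estimates through their pairing and their orthogonality to the past.\<close>

definition L2_inner :: "'w measure \<Rightarrow> ('w \<Rightarrow> 'b::euclidean_space) \<Rightarrow> ('w \<Rightarrow> 'b) \<Rightarrow> real" where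
  "L2_inner M X Y = (\<integral>w. X w \<bullet> Y w \<partial>M)"

definition L2_norm :: "'w measure \<Rightarrow> ('w \<Rightarrow> 'b::euclidean_space) \<Rightarrow> real" where
  "L2_norm M X = sqrt (\<integral>w. (norm (X w))\<^sup>2 \<partial>M)"

lemma L2_measurable: "X \<in> L2 M \<Longrightarrow> X \<in> borel_measurable M"
  by (simp add: L2_def)

lemma L2_square_integrable: "X \<in> L2 M \<Longrightarrow> integrable M (\<lambda>w. (norm (X w))\<^sup>2)"
  by (simp add: L2_def)

lemma L2_cong_AE:
  assumes "AE w in M. X w = Y w" "Y \<in> L2 M" "X \<in> borel_measurable M"
  shows "X \<in> L2 M"
proof -
  have "integrable M (\<lambda>w. (norm (X w))\<^sup>2) = integrable M (\<lambda>w. (norm (Y w))\<^sup>2)"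
    by (rule integrable_cong_AE) (use assms L2_measurable[OF assms(2)] in auto)
  then show ?thesis using assms L2_square_integrable by (auto simp: L2_def)
qed

lemma L2_bound:
  assumes "Y \<in> borel_measurable M" "integrable M g" "\<And>w. (norm (Y w))\<^sup>2 \<le> g w"
  shows "Y \<in> L2 M"
proof -
  have "integrable M (\<lambda>w. (norm (Y w))\<^sup>2)"
    using assms(1) by (intro Bochner_Integration.integrable_bound[OF assms(2)])
      (auto intro: order_trans[OF assms(3) abs_ge_self])
  then show ?thesis using assms(1) by (simp add: L2_def)
qed

lemma L2_inner_integrable:
  assumes "X \<in> L2 M" "Y \<in> L2 M"
  shows "integrable M (\<lambda>w. X w \<bullet> Y w)"
proof (rule Bochner_Integration.integrable_bound)
  show "integrable M (\<lambda>w. (norm (X w))\<^sup>2 + (norm (Y w))\<^sup>2)"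
    using assms by (intro Bochner_Integration.integrable_add L2_square_integrable)
  show "(\<lambda>w. X w \<bullet> Y w) \<in> borel_measurable M"
    using assms[THEN L2_measurable] by measurable
  have "\<bar>x \<bullet> y\<bar> \<le> (norm x)\<^sup>2 + (norm y)\<^sup>2" for x y :: 'b
  proof -
    have "\<bar>x \<bullet> y\<bar> \<le> norm x * norm y" by (rule Cauchy_Schwarz_ineq2)
    also have "\<dots> \<le> (norm x)\<^sup>2 + (norm y)\<^sup>2"
      using sum_squares_bound[of "norm x" "norm y"]
        mult_nonneg_nonneg[OF norm_ge_zero norm_ge_zero, of x y] by linarith
    finally show ?thesis .
  qed
  then show "AE w in M. norm (X w \<bullet> Y w) \<le> norm ((norm (X w))\<^sup>2 + (norm (Y w))\<^sup>2)"
    by simp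
qed

lemma L2_zero [simp]: "(\<lambda>w. 0) \<in> L2 M"
  by (simp add: L2_def)

lemma L2_linear:
  assumes "bounded_linear T" "X \<in> L2 M"
  shows "(\<lambda>w. T (X w)) \<in> L2 M"
proof -
  interpret T: bounded_linear T by fact
  obtain C where C: "\<And>x. norm (T x) \<le> norm x * C" using T.bounded by blast
  show ?thesis
  proof (rule L2_bound)
    show "(\<lambda>w. T (X w)) \<in> borel_measurable M"
      using L2_measurable[OF assms(2)]
        borel_measurable_continuous_onI[OF linear_continuous_on[OF assms(1)]] by measurable
    show "integrable M (\<lambda>w. (norm (X w))\<^sup>2 * C\<^sup>2)"
      using assms(2) by (intro integrable_mult_left) (rule L2_square_integrable)
    show "(norm (T (X w)))\<^sup>2 \<le> (norm (X w))\<^sup>2 * C\<^sup>2" for w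
      using power_mono[OF C norm_ge_zero, of "X w" 2] by (simp add: power_mult_distrib)
  qed
qed

lemma L2_scaleR: "X \<in> L2 M \<Longrightarrow> (\<lambda>w. a *\<^sub>R X w) \<in> L2 M"
  by (rule L2_linear[OF bounded_linear_scaleR_right])

lemma L2_add:
  assumes "X \<in> L2 M" "Y \<in> L2 M"
  shows "(\<lambda>w. X w + Y w) \<in> L2 M"
proof (rule L2_bound)
  show "(\<lambda>w. X w + Y w) \<in> borel_measurable M"
    using assms[THEN L2_measurable] by measurable
  show "integrable M (\<lambda>w. 2 * (norm (X w))\<^sup>2 + 2 * (norm (Y w))\<^sup>2)"
    using assms by (intro Bochner_Integration.integrable_add integrable_mult_right L2_square_integrable)
  show "(norm (X w + Y w))\<^sup>2 \<le> 2 * (norm (X w))\<^sup>2 + 2 * (norm (Y w))\<^sup>2" for w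
    using power_mono[OF norm_triangle_ineq norm_ge_zero, of "X w" "Y w" 2]
      sum_squares_bound[of "norm (X w)" "norm (Y w)"] by (simp add: power2_sum)
qed

lemma L2_diff:
  assumes "X \<in> L2 M" "Y \<in> L2 M"
  shows "(\<lambda>w. X w - Y w) \<in> L2 M"
  using L2_add[OF assms(1) L2_scaleR[OF assms(2), of "-1"]] by simp

lemma L2_sum:
  assumes "\<And>i. i \<in> S \<Longrightarrow> X i \<in> L2 M"
  shows "(\<lambda>w. \<Sum>i\<in>S. X i w) \<in> L2 M"
  using assms by (induction S rule: infinite_finite_induct) (auto intro: L2_add)

lemma L2_inner_add_left:
  "X \<in> L2 M \<Longrightarrow> Y \<in> L2 M \<Longrightarrow> Z \<in> L2 M \<Longrightarrow>
    L2_inner M (\<lambda>w. X w + Y w) Z = L2_inner M X Z + L2_inner M Y Z"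
  by (simp add: L2_inner_def inner_add_left L2_inner_integrable)

lemma L2_inner_diff_left:
  "X \<in> L2 M \<Longrightarrow> Y \<in> L2 M \<Longrightarrow> Z \<in> L2 M \<Longrightarrow>
    L2_inner M (\<lambda>w. X w - Y w) Z = L2_inner M X Z - L2_inner M Y Z"
  by (simp add: L2_inner_def inner_diff_left L2_inner_integrable)

lemma L2_inner_scale_left: "L2_inner M (\<lambda>w. a *\<^sub>R X w) Y = a * L2_inner M X Y"
  by (simp add: L2_inner_def)

lemma L2_inner_commute: "L2_inner M X Y = L2_inner M Y X"
  by (simp add: L2_inner_def inner_commute)

lemma L2_inner_add_right:
  "X \<in> L2 M \<Longrightarrow> Y \<in> L2 M \<Longrightarrow> Z \<in> L2 M \<Longrightarrow>
    L2_inner M Z (\<lambda>w. X w + Y w) = L2_inner M Z X + L2_inner M Z Y"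
  by (simp add: L2_inner_commute[of M Z] L2_inner_add_left)

lemma L2_inner_diff_right:
  "X \<in> L2 M \<Longrightarrow> Y \<in> L2 M \<Longrightarrow> Z \<in> L2 M \<Longrightarrow>
    L2_inner M Z (\<lambda>w. X w - Y w) = L2_inner M Z X - L2_inner M Z Y"
  by (simp add: L2_inner_commute[of M Z] L2_inner_diff_left)

lemma L2_inner_scale_right: "L2_inner M X (\<lambda>w. a *\<^sub>R Y w) = a * L2_inner M X Y"
  by (simp add: L2_inner_def)

lemma L2_inner_zero [simp]: "L2_inner M (\<lambda>w. 0) Y = 0" "L2_inner M Y (\<lambda>w. 0) = 0"
  by (simp_all add: L2_inner_def)

lemma L2_inner_sum_left:
  assumes "\<And>i. i \<in> S \<Longrightarrow> X i \<in> L2 M" "Y \<in> L2 M"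
  shows "L2_inner M (\<lambda>w. \<Sum>i\<in>S. X i w) Y = (\<Sum>i\<in>S. L2_inner M (X i) Y)"
  using assms(1)
  by (induction S rule: infinite_finite_induct) (auto simp: L2_inner_add_left L2_sum assms(2))

lemma L2_inner_sum_right:
  assumes "\<And>i. i \<in> S \<Longrightarrow> X i \<in> L2 M" "Y \<in> L2 M"
  shows "L2_inner M Y (\<lambda>w. \<Sum>i\<in>S. X i w) = (\<Sum>i\<in>S. L2_inner M Y (X i))"
  using assms by (simp add: L2_inner_commute[of M Y] L2_inner_sum_left)

lemma L2_inner_cong_AE:
  assumes "AE w in M. X w = X' w" "AE w in M. Y w = Y' w"
    "X \<in> L2 M" "X' \<in> L2 M" "Y \<in> L2 M" "Y' \<in> L2 M"
  shows "L2_inner M X Y = L2_inner M X' Y'"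
proof -
  note [measurable] = assms(3-6)[THEN L2_measurable]
  show ?thesis unfolding L2_inner_def
    by (rule integral_cong_AE) (use assms(1,2) in auto)
qed

lemma L2_norm_nonneg [simp]: "0 \<le> L2_norm M X"
  by (simp add: L2_norm_def)

lemma L2_norm_square: "(L2_norm M X)\<^sup>2 = L2_inner M X X"
  by (simp add: L2_norm_def L2_inner_def power2_norm_eq_inner)

lemma L2_norm_square_integral: "(L2_norm M X)\<^sup>2 = (\<integral>w. (norm (X w))\<^sup>2 \<partial>M)"
  by (simp add: L2_norm_def)

lemma L2_inner_self_nonneg: "0 \<le> L2_inner M X X"
  by (simp flip: L2_norm_square)

lemma L2_norm_zero [simp]: "L2_norm M (\<lambda>w. 0) = 0"
  by (simp add: L2_norm_def)

lemma L2_norm_scaleR: "L2_norm M (\<lambda>w. a *\<^sub>R X w) = \<bar>a\<bar> * L2_norm M X"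
  by (simp add: L2_norm_def power_mult_distrib real_sqrt_mult)

lemma L2_dist_norm: "L2_dist M X Y = L2_norm M (\<lambda>w. X w - Y w)"
  by (simp add: L2_dist_def L2_norm_def)

lemma L2_dist_commute: "L2_dist M X Y = L2_dist M Y X"
  by (simp add: L2_dist_def norm_minus_commute)

lemma L2_dist_nonneg [simp]: "0 \<le> L2_dist M X Y"
  by (simp add: L2_dist_norm)

lemma L2_dist_self [simp]: "L2_dist M X X = 0"
  by (simp add: L2_dist_def)

lemma L2_norm_eq_0_iff:
  assumes "X \<in> L2 M"
  shows "L2_norm M X = 0 \<longleftrightarrow> (AE w in M. X w = 0)"
  using integral_nonneg_eq_0_iff_AE[OF L2_square_integrable[OF assms]]
  by (simp add: L2_norm_def)

lemma L2_norm_cong_AE: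
  assumes "AE w in M. X w = X' w" "X \<in> L2 M" "X' \<in> L2 M"
  shows "L2_norm M X = L2_norm M X'"
  using L2_inner_cong_AE[OF assms(1) assms(1) assms(2,3,2,3)]
  by (metis L2_norm_square L2_norm_nonneg power2_eq_imp_eq)

text \<open>Elements of \<open>L2 M\<close> are functions, so the form is only positive
  semidefinite; a \<open>Y\<close> that vanishes almost surely has to be treated apart from the
  usual quadratic in t.\<close>

lemma L2_Cauchy_Schwarz:
  assumes "X \<in> L2 M" "Y \<in> L2 M"
  shows "\<bar>L2_inner M X Y\<bar> \<le> L2_norm M X * L2_norm M Y"
proof -
  have pos: "0 \<le> L2_inner M X X - 2 * t * L2_inner M X Y + t\<^sup>2 * L2_inner M Y Y" for t
  proof -
    have "0 \<le> L2_inner M (\<lambda>w. X w - t *\<^sub>R Y w) (\<lambda>w. X w - t *\<^sub>R Y w)"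
      by (rule L2_inner_self_nonneg)
    also have "\<dots> = L2_inner M X X - 2 * t * L2_inner M X Y + t\<^sup>2 * L2_inner M Y Y"
      using assms
      by (simp add: L2_inner_diff_left L2_inner_diff_right L2_diff L2_scaleR L2_inner_scale_left
          L2_inner_scale_right L2_inner_commute[of M Y X] power2_eq_square algebra_simps)
    finally show ?thesis .
  qed
  have "(L2_inner M X Y)\<^sup>2 \<le> L2_inner M X X * L2_inner M Y Y"
  proof (cases "L2_inner M Y Y = 0")
    case True
    have "L2_inner M X Y = 0"
    proof (rule ccontr)
      assume "L2_inner M X Y \<noteq> 0"
      \<comment> \<open>With \<open>L2_inner M Y Y = 0\<close> the quadratic is affine in t, and at
        this t it equals -1.\<close>
      then show False
        using pos[of "(L2_inner M X X + 1) / (2 * L2_inner M X Y)"] True by simp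
    qed
    then show ?thesis using True by simp
  next
    case False
    then have p: "L2_inner M Y Y > 0" using L2_inner_self_nonneg[of M Y] by simp
    \<comment> \<open>This t minimises the quadratic.\<close>
    show ?thesis
      using pos[of "L2_inner M X Y / L2_inner M Y Y"] p
      by (simp add: field_simps power2_eq_square)
  qed
  then have "\<bar>L2_inner M X Y\<bar>\<^sup>2 \<le> (L2_norm M X * L2_norm M Y)\<^sup>2"
    by (simp add: power_mult_distrib L2_norm_square)
  then show ?thesis by (rule power2_le_imp_le) simp
qed

lemma L2_norm_triangle:
  assumes "X \<in> L2 M" "Y \<in> L2 M"
  shows "L2_norm M (\<lambda>w. X w + Y w) \<le> L2_norm M X + L2_norm M Y"
proof (rule power2_le_imp_le)
  have "(L2_norm M (\<lambda>w. X w + Y w))\<^sup>2 = (L2_norm M X)\<^sup>2 + (L2_norm M Y)\<^sup>2 + 2 * L2_inner M X Y"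
    using assms
    by (simp add: L2_norm_square L2_inner_add_left L2_inner_add_right L2_add L2_inner_commute[of M Y X])
  also have "\<dots> \<le> (L2_norm M X + L2_norm M Y)\<^sup>2"
    using L2_Cauchy_Schwarz[OF assms] by (simp add: power2_sum)
  finally show "(L2_norm M (\<lambda>w. X w + Y w))\<^sup>2 \<le> (L2_norm M X + L2_norm M Y)\<^sup>2" .
qed simp

lemma L2_dist_triangle:
  assumes "X \<in> L2 M" "Y \<in> L2 M" "Z \<in> L2 M"
  shows "L2_dist M X Z \<le> L2_dist M X Y + L2_dist M Y Z"
  using L2_norm_triangle[OF L2_diff[OF assms(1,2)] L2_diff[OF assms(2,3)]]
  by (simp add: L2_dist_norm)

lemma L2_norm_diff_le:
  assumes "X \<in> L2 M" "Y \<in> L2 M"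
  shows "\<bar>L2_norm M X - L2_norm M Y\<bar> \<le> L2_dist M X Y"
  using L2_norm_triangle[OF L2_diff[OF assms] assms(2)]
    L2_norm_triangle[OF L2_diff[OF assms(2,1)] assms(1)]
  by (simp add: L2_dist_norm[symmetric] L2_dist_commute[of M Y X])

lemma L2_norm_linear:
  assumes "bounded_linear T" "\<And>x. norm (T x) \<le> C * norm x" "0 \<le> C" "X \<in> L2 M"
  shows "L2_norm M (\<lambda>w. T (X w)) \<le> C * L2_norm M X"
proof -
  have "(\<integral>w. (norm (T (X w)))\<^sup>2 \<partial>M) \<le> (\<integral>w. C\<^sup>2 * (norm (X w))\<^sup>2 \<partial>M)"
  proof (rule integral_mono)
    show "integrable M (\<lambda>w. (norm (T (X w)))\<^sup>2)"
      by (rule L2_square_integrable[OF L2_linear[OF assms(1,4)]])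
    show "integrable M (\<lambda>w. C\<^sup>2 * (norm (X w))\<^sup>2)"
      using L2_square_integrable[OF assms(4)] by simp
    show "(norm (T (X w)))\<^sup>2 \<le> C\<^sup>2 * (norm (X w))\<^sup>2" for w
      using power_mono[OF assms(2) norm_ge_zero, of "X w" 2] by (simp add: power_mult_distrib)
  qed
  then have "(L2_norm M (\<lambda>w. T (X w)))\<^sup>2 \<le> (C * L2_norm M X)\<^sup>2"
    by (simp add: L2_norm_square_integral power_mult_distrib)
  then show ?thesis by (rule power2_le_imp_le) (simp add: assms(3))
qed

text \<open>Expanding both arguments around \<open>X\<close> and \<open>Y\<close> leaves only norms
  of these two, so passing to the limit under the inner product needs no uniform bound on the
  approximants.\<close>

lemma L2_dist_inner_le:
  assumes "X \<in> L2 M" "X' \<in> L2 M" "Y \<in> L2 M" "Y' \<in> L2 M"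
  shows "\<bar>L2_inner M X' Y' - L2_inner M X Y\<bar>
    \<le> L2_dist M X' X * L2_norm M Y + L2_norm M X * L2_dist M Y' Y + L2_dist M X' X * L2_dist M Y' Y"
proof -
  have "L2_inner M X' Y' - L2_inner M X Y = L2_inner M (\<lambda>w. X' w - X w) Y
      + L2_inner M X (\<lambda>w. Y' w - Y w) + L2_inner M (\<lambda>w. X' w - X w) (\<lambda>w. Y' w - Y w)"
    using assms by (simp add: L2_inner_diff_left L2_inner_diff_right L2_diff)
  then show ?thesis
    using L2_Cauchy_Schwarz[OF L2_diff[OF assms(2,1)] assms(3)]
      L2_Cauchy_Schwarz[OF assms(1) L2_diff[OF assms(4,3)]]
      L2_Cauchy_Schwarz[OF L2_diff[OF assms(2,1)] L2_diff[OF assms(4,3)]]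
    unfolding L2_dist_norm by linarith
qed

lemma L2_inner_tendsto:
  assumes "X \<in> L2 M" "Y \<in> L2 M" "\<forall>\<^sub>F k in G. X' k \<in> L2 M" "\<forall>\<^sub>F k in G. Y' k \<in> L2 M"
    "((\<lambda>k. L2_dist M (X' k) X) \<longlongrightarrow> 0) G" "((\<lambda>k. L2_dist M (Y' k) Y) \<longlongrightarrow> 0) G"
  shows "((\<lambda>k. L2_inner M (X' k) (Y' k)) \<longlongrightarrow> L2_inner M X Y) G"
proof (rule metric_tendsto_imp_tendsto)
  show "((\<lambda>k. L2_dist M (X' k) X * L2_norm M Y + L2_norm M X * L2_dist M (Y' k) Y
      + L2_dist M (X' k) X * L2_dist M (Y' k) Y) \<longlongrightarrow> 0) G"
    using assms(5,6) by (auto intro!: tendsto_eq_intros)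
  show "\<forall>\<^sub>F k in G. dist (L2_inner M (X' k) (Y' k)) (L2_inner M X Y)
    \<le> dist (L2_dist M (X' k) X * L2_norm M Y + L2_norm M X * L2_dist M (Y' k) Y
      + L2_dist M (X' k) X * L2_dist M (Y' k) Y) 0"
    using assms(3,4)
  proof eventually_elim
    case (elim k)
    show ?case using L2_dist_inner_le[OF assms(1) elim(1) assms(2) elim(2)] by (simp add: dist_real_def)
  qed
qed

section \<open>Filtrations and completeness\<close>

text \<open>Only times t >= 0 are recorded, so both admissible index sets yield an instance and the
  stochastic calculus need not distinguish them.\<close>

locale brownian_basis = prob_space M for M :: "'w measure" +
  fixes F :: "real \<Rightarrow> 'w measure" and W :: "real \<Rightarrow> 'w \<Rightarrow> real"
  assumes sub: "0 \<le> t \<Longrightarrow> subalgebra M (F t)"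
    and F_mono: "0 \<le> s \<Longrightarrow> s \<le> t \<Longrightarrow> sets (F s) \<subseteq> sets (F t)"
    and W_measurable: "0 \<le> t \<Longrightarrow> W t \<in> borel_measurable M"
    and W_increment_measurable:
      "0 \<le> s \<Longrightarrow> s \<le> t \<Longrightarrow> (\<lambda>w. W t w - W s w) \<in> borel_measurable (F t)"
    and W_increment_distributed: "0 \<le> s \<Longrightarrow> s < t \<Longrightarrow>
      distributed M lborel (\<lambda>w. W t w - W s w) (normal_density 0 (sqrt (t - s)))"
    and W_increment_indep: "0 \<le> s \<Longrightarrow> s < t \<Longrightarrow>
      indep_set (sets (F s)) {(\<lambda>w. W t w - W s w) -` B \<inter> space M | B. B \<in> sets borel}"
begin

lemma L2_const [simp]: "(\<lambda>w. c) \<in> L2 M"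
  by (simp add: L2_def)

lemma L2_norm_const [simp]: "L2_norm M (\<lambda>w. c) = norm c"
  by (simp add: L2_norm_def prob_space)

lemma adapted_L2: "X \<in> L2_adapted M F t \<Longrightarrow> X \<in> L2 M"
  by (simp add: L2_adapted_def)

lemma adaptedI:
  "X \<in> L2 M \<Longrightarrow> Y \<in> borel_measurable (F t) \<Longrightarrow> AE w in M. X w = Y w \<Longrightarrow> X \<in> L2_adapted M F t"
  by (auto simp: L2_adapted_def)

lemma F_measurable: "0 \<le> t \<Longrightarrow> Y \<in> borel_measurable (F t) \<Longrightarrow> Y \<in> borel_measurable M"
  using measurable_from_subalg[OF sub] .

lemma adapted_version:
  assumes "X \<in> L2_adapted M F t" "0 \<le> t"
  obtains Y where "Y \<in> borel_measurable (F t)" "AE w in M. X w = Y w" "Y \<in> L2 M"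
proof -
  obtain Y where Y: "Y \<in> borel_measurable (F t)" "AE w in M. X w = Y w"
    using assms by (auto simp: L2_adapted_def)
  have "AE w in M. Y w = X w" using Y(2) by auto
  from L2_cong_AE[OF this adapted_L2[OF assms(1)] F_measurable[OF assms(2) Y(1)]]
  show ?thesis using that Y by blast
qed

lemma adapted_mono:
  assumes "X \<in> L2_adapted M F s" "0 \<le> s" "s \<le> t"
  shows "X \<in> L2_adapted M F t"
proof -
  have "subalgebra (F t) (F s)"
    using sub[of s] sub[of t] F_mono[of s t] assms by (auto simp: subalgebra_def)
  from measurable_from_subalg[OF this] show ?thesis
    using assms(1) by (auto simp: L2_adapted_def)
qed

lemma adapted_const [simp]: "(\<lambda>w. c) \<in> L2_adapted M F t"
  by (rule adaptedI[of _ "\<lambda>w. c"]) auto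

lemma adapted_linear:
  assumes "bounded_linear T" "X \<in> L2_adapted M F t"
  shows "(\<lambda>w. T (X w)) \<in> L2_adapted M F t"
proof -
  obtain Y where Y: "Y \<in> borel_measurable (F t)" "AE w in M. X w = Y w"
    using assms(2) by (auto simp: L2_adapted_def)
  show ?thesis
  proof (rule adaptedI)
    show "(\<lambda>w. T (X w)) \<in> L2 M" by (rule L2_linear[OF assms(1) adapted_L2[OF assms(2)]])
    show "(\<lambda>w. T (Y w)) \<in> borel_measurable (F t)"
      using Y(1) borel_measurable_continuous_onI[OF linear_continuous_on[OF assms(1)]] by measurable
  qed (use Y(2) in auto)
qed

lemma adapted_scaleR: "X \<in> L2_adapted M F t \<Longrightarrow> (\<lambda>w. a *\<^sub>R X w) \<in> L2_adapted M F t"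
  by (rule adapted_linear[OF bounded_linear_scaleR_right])

lemma adapted_add:
  assumes "X \<in> L2_adapted M F t" "Y \<in> L2_adapted M F t"
  shows "(\<lambda>w. X w + Y w) \<in> L2_adapted M F t"
proof -
  obtain X' where X': "X' \<in> borel_measurable (F t)" "AE w in M. X w = X' w"
    using assms(1) by (auto simp: L2_adapted_def)
  obtain Y' where Y': "Y' \<in> borel_measurable (F t)" "AE w in M. Y w = Y' w"
    using assms(2) by (auto simp: L2_adapted_def)
  show ?thesis
  proof (rule adaptedI)
    show "(\<lambda>w. X w + Y w) \<in> L2 M" using assms by (intro L2_add adapted_L2)
    show "(\<lambda>w. X' w + Y' w) \<in> borel_measurable (F t)" using X'(1) Y'(1) by measurable
  qed (use X'(2) Y'(2) in auto)
qed

lemma adapted_diff: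
  assumes "X \<in> L2_adapted M F t" "Y \<in> L2_adapted M F t"
  shows "(\<lambda>w. X w - Y w) \<in> L2_adapted M F t"
  using adapted_add[OF assms(1) adapted_scaleR[OF assms(2), of "-1"]] by simp

lemma adapted_sum:
  assumes "\<And>i. i \<in> S \<Longrightarrow> X i \<in> L2_adapted M F t"
  shows "(\<lambda>w. \<Sum>i\<in>S. X i w) \<in> L2_adapted M F t"
  using assms by (induction S rule: infinite_finite_induct) (auto intro: adapted_add)

text \<open>Cauchy-Schwarz against the constant 1 on a probability space. It turns L^2 Cauchy
  sequences into L^1 Cauchy sequences, from which almost surely convergent subsequences are
  extracted.\<close>

lemma expectation_norm_le_L2_norm:
  assumes "X \<in> L2 M"
  shows "integrable M X" "(\<integral>w. norm (X w) \<partial>M) \<le> L2_norm M X"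
proof -
  have n: "(\<lambda>w. norm (X w)) \<in> L2 M"
    using assms by (auto simp: L2_def)
  then have "integrable M (\<lambda>w. norm (X w) \<bullet> 1)"
    by (rule L2_inner_integrable) simp
  then show "integrable M X"
    using L2_measurable[OF assms] integrable_norm_iff[of X M] by simp
  have "L2_inner M (\<lambda>w. norm (X w)) (\<lambda>w. 1) \<le> L2_norm M (\<lambda>w. norm (X w)) * L2_norm M (\<lambda>w. 1::real)"
    using L2_Cauchy_Schwarz[OF n, of "\<lambda>w. 1"] by simp
  then show "(\<integral>w. norm (X w) \<partial>M) \<le> L2_norm M X"
    unfolding L2_norm_const by (simp add: L2_inner_def) (simp add: L2_norm_def)
qed

text \<open>The Riesz-Fischer argument, run on \<open>F t\<close>-measurable versions because a
  limit of the \<open>X k\<close> themselves would only be known to be measurable for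
  \<open>M\<close>. An almost surely convergent subsequence supplies the candidate, and Fatou's
  lemma gives convergence of the whole sequence in L^2.\<close>

lemma L2_adapted_complete:
  fixes X :: "nat \<Rightarrow> 'w \<Rightarrow> 'b::euclidean_space"
  assumes t: "0 \<le> t" and X: "\<And>k. X k \<in> L2_adapted M F t"
    and Cau: "\<And>e. 0 < e \<Longrightarrow> \<exists>N. \<forall>i\<ge>N. \<forall>j\<ge>N. L2_dist M (X i) (X j) < e"
  shows "\<exists>Y\<in>L2_adapted M F t. (\<lambda>k. L2_dist M (X k) Y) \<longlonglongrightarrow> 0"
proof -
  have "\<exists>V. V \<in> borel_measurable (F t) \<and> (AE w in M. X k w = V w) \<and> V \<in> L2 M" for k
    using adapted_version[OF X[of k] t] by metis
  then obtain V where V: "\<And>k. V k \<in> borel_measurable (F t)" "\<And>k. AE w in M. X k w = V k w"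
    "\<And>k. V k \<in> L2 M" by metis
  note XL = adapted_L2[OF X]
  have dist_eq: "L2_dist M (X i) (X j) = L2_dist M (V i) (V j)" for i j
    unfolding L2_dist_norm
    by (rule L2_norm_cong_AE[OF _ L2_diff[OF XL XL] L2_diff[OF V(3) V(3)]])
      (use V(2)[of i] V(2)[of j] in auto)
  obtain r where r: "strict_mono r" "AE w in M. Cauchy (\<lambda>i. V (r i) w)"
  proof (rule cauchy_L1_AE_cauchy_subseq[of M V])
    show "integrable M (V n)" for n by (rule expectation_norm_le_L2_norm[OF V(3)])
    fix e :: real assume "0 < e"
    from Cau[OF this] obtain N where N: "\<And>i j. i \<ge> N \<Longrightarrow> j \<ge> N \<Longrightarrow> L2_dist M (X i) (X j) < e" by blast
    have "(\<integral>w. norm (V i w - V j w) \<partial>M) < e" if "i \<ge> N" "j \<ge> N" for i j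
      using expectation_norm_le_L2_norm(2)[OF L2_diff[OF V(3) V(3)], of i j] N[OF that, unfolded dist_eq]
      by (simp add: L2_dist_norm)
    then show "\<exists>N. \<forall>i\<ge>N. \<forall>j\<ge>N. (\<integral>w. norm (V i w - V j w) \<partial>M) < e" by blast
  qed
  \<comment> \<open>\<open>lim\<close> is measurable even where the sequence diverges, so
    \<open>Y\<close> is exactly \<open>F t\<close>-measurable and no completion of
    \<open>F t\<close> enters.\<close>
  define Y where "Y = (\<lambda>w. lim (\<lambda>i. V (r i) w))"
  have YF: "Y \<in> borel_measurable (F t)"
    unfolding Y_def by (rule borel_measurable_lim_metric) (rule V(1))
  have [measurable]: "Y \<in> borel_measurable M" "\<And>k. V k \<in> borel_measurable M"
    using YF V(1) F_measurable[OF t] by auto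
  have lim: "AE w in M. (\<lambda>i. V (r i) w) \<longlonglongrightarrow> Y w"
    using r(2) by eventually_elim (auto simp: Y_def Cauchy_convergent_iff convergent_LIMSEQ_iff)
  \<comment> \<open>Fatou's lemma along the subsequence with \<open>k\<close> fixed; the Cauchy
    bound survives as a non-strict one.\<close>
  have key: "(\<integral>\<^sup>+ w. ennreal ((norm (V k w - Y w))\<^sup>2) \<partial>M) \<le> ennreal (e\<^sup>2)"
    if N: "\<And>i j. i \<ge> N \<Longrightarrow> j \<ge> N \<Longrightarrow> L2_dist M (X i) (X j) < e" and "k \<ge> N" for k N e
  proof -
    have "(\<integral>\<^sup>+ w. ennreal ((norm (V k w - Y w))\<^sup>2) \<partial>M)
        = (\<integral>\<^sup>+ w. liminf (\<lambda>i. ennreal ((norm (V k w - V (r i) w))\<^sup>2)) \<partial>M)"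
    proof (rule nn_integral_cong_AE, use lim in eventually_elim)
      case (elim w)
      then have "(\<lambda>i. ennreal ((norm (V k w - V (r i) w))\<^sup>2)) \<longlonglongrightarrow> ennreal ((norm (V k w - Y w))\<^sup>2)"
        by (intro tendsto_intros)
      from lim_imp_Liminf[OF trivial_limit_sequentially this] show ?case by simp
    qed
    also have "\<dots> \<le> liminf (\<lambda>i. \<integral>\<^sup>+ w. ennreal ((norm (V k w - V (r i) w))\<^sup>2) \<partial>M)"
      by (rule nn_integral_liminf) measurable
    also have "\<dots> \<le> ennreal (e\<^sup>2)"
    proof (rule Liminf_le)
      show "\<forall>\<^sub>F i in sequentially. (\<integral>\<^sup>+ w. ennreal ((norm (V k w - V (r i) w))\<^sup>2) \<partial>M) \<le> ennreal (e\<^sup>2)"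
        using eventually_ge_at_top[of N]
      proof eventually_elim
        case (elim i)
        then have "r i \<ge> N" using seq_suble[OF r(1), of i] by simp
        then have "L2_dist M (V k) (V (r i)) < e" using N[OF \<open>k \<ge> N\<close>] by (simp add: dist_eq)
        then have "(L2_dist M (V k) (V (r i)))\<^sup>2 \<le> e\<^sup>2" by (intro power_mono) auto
        moreover have "(\<integral>\<^sup>+ w. ennreal ((norm (V k w - V (r i) w))\<^sup>2) \<partial>M)
            = ennreal (\<integral>w. (norm (V k w - V (r i) w))\<^sup>2 \<partial>M)"
          by (rule nn_integral_eq_integral[OF L2_square_integrable[OF L2_diff[OF V(3) V(3)]]]) simp
        ultimately show ?case
          by (simp add: L2_dist_norm L2_norm_square_integral ennreal_leI)
      qed
    qed simp
    finally show ?thesis .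
  qed
  have L2d: "(\<lambda>w. V k w - Y w) \<in> L2 M \<and> L2_dist M (V k) Y \<le> e"
    if N: "\<And>i j. i \<ge> N \<Longrightarrow> j \<ge> N \<Longrightarrow> L2_dist M (X i) (X j) < e" and k: "k \<ge> N" for k N e
  proof -
    have e: "0 < e" using N[OF k k] by simp
    have "integrable M (\<lambda>w. (norm (V k w - Y w))\<^sup>2)"
      using key[OF N k] by (intro integrableI_bounded) (auto simp: le_less_trans)
    then have 1: "(\<lambda>w. V k w - Y w) \<in> L2 M" by (simp add: L2_def)
    have "ennreal (\<integral>w. (norm (V k w - Y w))\<^sup>2 \<partial>M) \<le> ennreal (e\<^sup>2)"
      using key[OF N k] nn_integral_eq_integral[OF L2_square_integrable[OF 1]] by simp
    then have "(L2_dist M (V k) Y)\<^sup>2 \<le> e\<^sup>2"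
      by (simp add: L2_dist_norm L2_norm_square_integral)
    then have "L2_dist M (V k) Y \<le> e" using e by (auto dest: power2_le_imp_le)
    with 1 show ?thesis by simp
  qed
  have YL: "Y \<in> L2 M"
  proof -
    obtain N where "\<And>i j. i \<ge> N \<Longrightarrow> j \<ge> N \<Longrightarrow> L2_dist M (X i) (X j) < 1"
      using Cau[of 1] by auto
    from L2d[OF this order_refl] have "(\<lambda>w. V N w - Y w) \<in> L2 M" by simp
    from L2_diff[OF V(3)[of N] this] show ?thesis by simp
  qed
  have "(\<lambda>k. L2_dist M (X k) Y) \<longlonglongrightarrow> 0"
  proof (rule LIMSEQ_I)
    fix e :: real assume "0 < e"
    then obtain N where N: "\<And>i j. i \<ge> N \<Longrightarrow> j \<ge> N \<Longrightarrow> L2_dist M (X i) (X j) < e / 2"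
      using Cau[of "e / 2"] by auto
    have "L2_dist M (X k) Y = L2_dist M (V k) Y" for k
      unfolding L2_dist_norm
      by (rule L2_norm_cong_AE[OF _ L2_diff[OF XL YL] L2_diff[OF V(3) YL]]) (use V(2)[of k] in auto)
    then have "norm (L2_dist M (X k) Y - 0) < e" if "k \<ge> N" for k
      using L2d[OF N that] \<open>0 < e\<close> by auto
    then show "\<exists>N. \<forall>k\<ge>N. norm (L2_dist M (X k) Y - 0) < e" by blast
  qed
  moreover have "Y \<in> L2_adapted M F t" by (rule adaptedI[OF YL YF]) simp
  ultimately show ?thesis by blast
qed

lemma L2_dist_limit_unique:
  assumes "\<And>k. X k \<in> L2 M" "Y \<in> L2 M" "Z \<in> L2 M"
    "(\<lambda>k. L2_dist M (X k) Y) \<longlonglongrightarrow> 0" "(\<lambda>k. L2_dist M (X k) Z) \<longlonglongrightarrow> 0"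
  shows "AE w in M. Y w = Z w"
proof -
  have "(\<lambda>k. L2_dist M (X k) Y + L2_dist M (X k) Z) \<longlonglongrightarrow> 0 + 0"
    using assms(4,5) by (rule tendsto_add)
  moreover have "L2_dist M Y Z \<le> L2_dist M (X k) Y + L2_dist M (X k) Z" for k
    using L2_dist_triangle[OF assms(2) assms(1)[of k] assms(3)] by (simp add: L2_dist_commute)
  ultimately have "L2_dist M Y Z \<le> 0"
    by (intro tendsto_lowerbound) (auto intro!: always_eventually)
  then have "L2_norm M (\<lambda>w. Y w - Z w) = 0" by (simp add: L2_dist_norm antisym)
  then show ?thesis using L2_norm_eq_0_iff[OF L2_diff[OF assms(2,3)]] by simp
qed

end

section \<open>Step processes\<close>

lemma partition_mono:
  assumes "is_partition a b p m" "i \<le> j" "j \<le> m"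
  shows "p i \<le> p j"
  using assms(2,3)
proof (induction j rule: dec_induct)
  case (step n)
  then have "p n \<le> p (Suc n)" using assms(1) by (auto simp: is_partition_def)
  with step show ?case by auto
qed simp

lemma partition_bounds:
  assumes "is_partition a b p m" "i \<le> m"
  shows "a \<le> p i" "p i \<le> b"
  using partition_mono[OF assms(1), of 0 i] partition_mono[OF assms(1), of i m] assms
  by (auto simp: is_partition_def)

lemma partition_step: "is_partition a b p m \<Longrightarrow> i < m \<Longrightarrow> p i \<le> p (Suc i)"
  by (simp add: is_partition_def)

lemma step_process_eq:
  "step_process p m \<xi> s = (\<lambda>w. \<Sum>i<m. (indicator {p i..<p (Suc i)} s :: real) *\<^sub>R \<xi> i w)"
  by (simp add: step_process_def fun_eq_iff)

lemma step_integral_eq: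
  "step_integral Z p m \<xi> = (\<lambda>w. \<Sum>i<m. (Z (p (Suc i)) w - Z (p i) w) *\<^sub>R \<xi> i w)"
  by (simp add: step_integral_def fun_eq_iff)

text \<open>The maximum with 0 covers d < c, which occurs when disjoint cells of two partitions are
  intersected.\<close>

lemma has_integral_indicator_ico:
  fixes c d :: real
  assumes "a \<le> c" "d \<le> b"
  shows "((\<lambda>s. indicator {c..<d} s * v) has_integral (max 0 (d - c) * v)) {a..b}"
proof -
  have "((\<lambda>s. v) has_integral (max 0 (d - c) * v)) {c..d}"
    using has_integral_const_real[of v c d] by (auto simp: max_def)
  then have "((\<lambda>s. indicator {c..<d} s * v) has_integral (max 0 (d - c) * v)) {c..d}"
    by (rule has_integral_spike_finite[of "{d}", rotated 2]) (auto simp: indicator_def)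
  moreover have "indicator {c..<d} s * v = (if s \<in> {c..d} then indicator {c..<d} s * v else 0)" for s
    by (auto simp: indicator_def)
  ultimately show ?thesis
    using has_integral_restrict[of "{c..d}" "{a..b}" "\<lambda>s. indicator {c..<d} s * v"] assms by auto
qed

lemma L2_step_process:
  "\<forall>i<m. \<xi> i \<in> L2 M \<Longrightarrow> step_process p m \<xi> s \<in> L2 M"
  unfolding step_process_eq by (intro L2_sum L2_scaleR) auto

text \<open>The weights are the lengths of the overlaps of cells. The same weights appear as
  covariances of Brownian increments in \<open>increment_inner\<close>, so the isometry becomes a
  comparison of two double sums.\<close>

lemma step_process_inner_integral:
  assumes p: "is_partition a b p m" and r: "is_partition a b r l"
    and \<xi>: "\<And>i. i < m \<Longrightarrow> \<xi> i \<in> L2 M" and \<eta>: "\<And>j. j < l \<Longrightarrow> \<eta> j \<in> L2 M"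
  shows "((\<lambda>s. L2_inner M (step_process p m \<xi> s) (step_process r l \<eta> s)) has_integral
    (\<Sum>i<m. \<Sum>j<l. max 0 (min (p (Suc i)) (r (Suc j)) - max (p i) (r j)) * L2_inner M (\<xi> i) (\<eta> j))) {a..b}"
proof -
  have "L2_inner M (step_process p m \<xi> s) (step_process r l \<eta> s) =
      (\<Sum>i<m. \<Sum>j<l. indicator {max (p i) (r j)..<min (p (Suc i)) (r (Suc j))} s * L2_inner M (\<xi> i) (\<eta> j))" for s
  proof -
    have "L2_inner M (step_process p m \<xi> s) (step_process r l \<eta> s) =
      (\<Sum>i<m. L2_inner M (\<lambda>w. (indicator {p i..<p (Suc i)} s :: real) *\<^sub>R \<xi> i w)
        (\<lambda>w. \<Sum>j<l. (indicator {r j..<r (Suc j)} s :: real) *\<^sub>R \<eta> j w))"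
      unfolding step_process_eq by (rule L2_inner_sum_left) (auto intro!: L2_sum L2_scaleR \<xi> \<eta>)
    also have "\<dots> = (\<Sum>i<m. \<Sum>j<l. L2_inner M (\<lambda>w. (indicator {p i..<p (Suc i)} s :: real) *\<^sub>R \<xi> i w)
        (\<lambda>w. (indicator {r j..<r (Suc j)} s :: real) *\<^sub>R \<eta> j w))"
      by (intro sum.cong refl L2_inner_sum_right) (auto intro!: L2_sum L2_scaleR \<xi> \<eta>)
    also have "\<dots> = (\<Sum>i<m. \<Sum>j<l. indicator {max (p i) (r j)..<min (p (Suc i)) (r (Suc j))} s * L2_inner M (\<xi> i) (\<eta> j))"
      unfolding L2_inner_scale_left L2_inner_scale_right
      by (intro sum.cong refl) (auto simp: indicator_def)
    finally show ?thesis .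
  qed
  moreover have "((\<lambda>s. indicator {max (p i) (r j)..<min (p (Suc i)) (r (Suc j))} s * L2_inner M (\<xi> i) (\<eta> j))
      has_integral max 0 (min (p (Suc i)) (r (Suc j)) - max (p i) (r j)) * L2_inner M (\<xi> i) (\<eta> j)) {a..b}"
    if "i < m" "j < l" for i j
    using partition_bounds[OF p, of i] partition_bounds[OF p, of "Suc i"]
      partition_bounds[OF r, of j] partition_bounds[OF r, of "Suc j"] that
    by (intro has_integral_indicator_ico) auto
  ultimately show ?thesis by (simp only:) (intro has_integral_sum; simp)
qed

lemma step_time_integral_inner:
  assumes p: "is_partition a b p m" and \<xi>: "\<forall>i<m. \<xi> i \<in> L2 M" and z: "z \<in> L2 M"
  shows "((\<lambda>s. L2_inner M (step_process p m \<xi> s) z) has_integral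
    L2_inner M (step_integral (\<lambda>t w. t) p m \<xi>) z) {a..b}"
proof -
  note \<xi> = \<xi>[rule_format]
  have "L2_inner M (step_process p m \<xi> s) z =
      (\<Sum>i<m. indicator {p i..<p (Suc i)} s * L2_inner M (\<xi> i) z)" for s
    unfolding step_process_eq
    using \<xi> z by (subst L2_inner_sum_left) (auto intro!: L2_scaleR simp: L2_inner_scale_left)
  moreover have "L2_inner M (step_integral (\<lambda>t w. t) p m \<xi>) z =
      (\<Sum>i<m. max 0 (p (Suc i) - p i) * L2_inner M (\<xi> i) z)"
    unfolding step_integral_eq using \<xi> z partition_step[OF p]
    by (subst L2_inner_sum_left) (auto intro!: L2_scaleR sum.cong simp: L2_inner_scale_left)
  moreover have "((\<lambda>s. indicator {p i..<p (Suc i)} s * L2_inner M (\<xi> i) z) has_integral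
      max 0 (p (Suc i) - p i) * L2_inner M (\<xi> i) z) {a..b}" if "i < m" for i
    using partition_bounds[OF p, of i] partition_bounds[OF p, of "Suc i"] that
    by (intro has_integral_indicator_ico) auto
  ultimately show ?thesis by (simp only:) (rule has_integral_sum; simp)
qed

section \<open>Brownian increments: moments, independence of the past, covariances\<close>

context brownian_basis
begin

lemma increment_moments:
  assumes "0 \<le> s" "s < t"
  shows "integrable M (\<lambda>w. W t w - W s w)" "(\<integral>w. W t w - W s w \<partial>M) = 0"
    "integrable M (\<lambda>w. (W t w - W s w)\<^sup>2)" "(\<integral>w. (W t w - W s w)\<^sup>2 \<partial>M) = t - s"
proof -
  note D = W_increment_distributed[OF assms]
  have \<sigma>: "0 < sqrt (t - s)" using assms by simp
  have i: "integrable M (\<lambda>w. (W t w - W s w) ^ k)" for k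
    using distributed_integrable[OF D, of "\<lambda>x. x ^ k"] integrable_normal_moment[OF \<sigma>, of 0 k] by simp
  show "integrable M (\<lambda>w. W t w - W s w)" "integrable M (\<lambda>w. (W t w - W s w)\<^sup>2)"
    using i[of 1] i[of 2] by simp_all
  show e: "(\<integral>w. W t w - W s w \<partial>M) = 0"
    using normal_distributed_expectation[OF \<sigma> D] by simp
  show "(\<integral>w. (W t w - W s w)\<^sup>2 \<partial>M) = t - s"
    using normal_distributed_variance[OF \<sigma> D] assms by (simp add: e)
qed

text \<open>The events generated by \<open>X\<close> and by \<open>g\<close> of the increment lie in
  the two independent families. The function \<open>g\<close> will be the identity for orthogonality
  to the past and the square for the isometry.\<close>

lemma increment_indep_expectation:
  fixes X :: "'w \<Rightarrow> real"
  assumes st: "0 \<le> s" "s < t" and X: "X \<in> borel_measurable (F s)" "integrable M X"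
    and g: "g \<in> borel_measurable borel" "integrable M (\<lambda>w. g (W t w - W s w))"
  shows "integrable M (\<lambda>w. X w * g (W t w - W s w))"
    "(\<integral>w. X w * g (W t w - W s w) \<partial>M) = (\<integral>w. X w \<partial>M) * (\<integral>w. g (W t w - W s w) \<partial>M)"
proof -
  have [measurable]: "W t \<in> borel_measurable M" "W s \<in> borel_measurable M" "X \<in> borel_measurable M"
    using W_measurable st F_measurable[OF st(1) X(1)] by auto
  note [measurable] = g(1)
  have sp: "space (F s) = space M" using sub[OF st(1)] by (simp add: subalgebra_def)
  have ind: "indep_sets (case_bool (sets (F s))
      {(\<lambda>w. W t w - W s w) -` B \<inter> space M | B. B \<in> sets borel}) UNIV"
    using W_increment_indep[OF st] by (simp add: indep_set_def)
  have "indep_var borel X borel (\<lambda>w. g (W t w - W s w))"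
    unfolding indep_var_def indep_vars_def2
  proof (intro conjI ballI)
    fix i :: bool
    show "random_variable (case i of True \<Rightarrow> borel | False \<Rightarrow> borel)
        (case i of True \<Rightarrow> X | False \<Rightarrow> \<lambda>w. g (W t w - W s w))"
      by (cases i) auto
  next
    show "indep_sets (\<lambda>i. {(case i of True \<Rightarrow> X | False \<Rightarrow> \<lambda>w. g (W t w - W s w)) -` A \<inter> space M |A.
        A \<in> sets (case i of True \<Rightarrow> borel | False \<Rightarrow> borel)}) UNIV"
    proof (rule indep_sets_mono_sets[OF ind])
      fix i :: bool
      show "{(case i of True \<Rightarrow> X | False \<Rightarrow> \<lambda>w. g (W t w - W s w)) -` A \<inter> space M |A.
          A \<in> sets (case i of True \<Rightarrow> borel | False \<Rightarrow> borel)} \<subseteq>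
        (case i of True \<Rightarrow> sets (F s) | False \<Rightarrow> {(\<lambda>w. W t w - W s w) -` B \<inter> space M | B. B \<in> sets borel})"
      proof (cases i)
        case True
        then show ?thesis using measurable_sets[OF X(1)] by (auto simp: sp)
      next
        case False
        have "(\<lambda>w. g (W t w - W s w)) -` A = (\<lambda>w. W t w - W s w) -` (g -` A)" for A by auto
        then show ?thesis using False measurable_sets[OF g(1)] by auto
      qed
    qed
  qed
  from indep_var_integrable[OF this X(2) g(2)] indep_var_lebesgue_integral[OF this X(2) g(2)]
  show "integrable M (\<lambda>w. X w * g (W t w - W s w))"
    "(\<integral>w. X w * g (W t w - W s w) \<partial>M) = (\<integral>w. X w \<partial>M) * (\<integral>w. g (W t w - W s w) \<partial>M)" .
qed

text \<open>A product of square integrable variables need not be square integrable; here the second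
  moment factors because the increment is independent of an \<open>F s\<close>-measurable version of
  \<open>\<xi>\<close>.\<close>

lemma increment_scale_L2_adapted:
  fixes \<xi> :: "'w \<Rightarrow> 'b::euclidean_space"
  assumes "0 \<le> s" "s \<le> t" "\<xi> \<in> L2_adapted M F s"
  shows "(\<lambda>w. (W t w - W s w) *\<^sub>R \<xi> w) \<in> L2_adapted M F t"
proof (cases "s = t")
  case False
  then have st: "0 \<le> s" "s < t" using assms by auto
  obtain Y where Y: "Y \<in> borel_measurable (F s)" "AE w in M. \<xi> w = Y w" "Y \<in> L2 M"
    using adapted_version[OF assms(3,1)] .
  have [measurable]: "Y \<in> borel_measurable (F s)" by fact
  have "subalgebra (F t) (F s)"
    using sub[of s] sub[of t] F_mono[of s t] st by (auto simp: subalgebra_def)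
  then have YF: "Y \<in> borel_measurable (F t)"
    using Y(1) by (rule measurable_from_subalg)
  have m: "(\<lambda>w. (W t w - W s w) *\<^sub>R Y w) \<in> borel_measurable (F t)"
    by (intro borel_measurable_scaleR W_increment_measurable YF assms)
  have "integrable M (\<lambda>w. (norm (Y w))\<^sup>2 * (W t w - W s w)\<^sup>2)"
    by (rule increment_indep_expectation[OF st]) (auto intro: L2_square_integrable Y increment_moments[OF st])
  then have "integrable M (\<lambda>w. (norm ((W t w - W s w) *\<^sub>R Y w))\<^sup>2)"
    by (simp add: power_mult_distrib mult.commute)
  then have L: "(\<lambda>w. (W t w - W s w) *\<^sub>R Y w) \<in> L2 M"
    using F_measurable[OF _ m] assms by (simp add: L2_def)
  have "(\<lambda>w. (W t w - W s w) *\<^sub>R \<xi> w) \<in> borel_measurable M"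
    using L2_measurable[OF adapted_L2[OF assms(3)]] W_measurable st by (auto intro!: borel_measurable_scaleR)
  moreover have ae: "AE w in M. (W t w - W s w) *\<^sub>R \<xi> w = (W t w - W s w) *\<^sub>R Y w"
    using Y(2) by auto
  ultimately have "(\<lambda>w. (W t w - W s w) *\<^sub>R \<xi> w) \<in> L2 M"
    using L2_cong_AE[OF ae L] by blast
  then show ?thesis using adaptedI[OF _ m ae] by simp
qed simp

text \<open>The martingale property in inner product form: everything except the increment is known
  at time s, and the increment is independent of it with mean 0.\<close>

lemma increment_inner_past:
  assumes st: "0 \<le> s" "s \<le> t" and \<xi>: "\<xi> \<in> L2_adapted M F s" and \<zeta>: "\<zeta> \<in> L2_adapted M F s"
  shows "L2_inner M (\<lambda>w. (W t w - W s w) *\<^sub>R \<xi> w) \<zeta> = 0"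
proof (cases "s = t")
  case False
  then have st': "0 \<le> s" "s < t" using st by auto
  obtain Y where Y: "Y \<in> borel_measurable (F s)" "AE w in M. \<xi> w = Y w" "Y \<in> L2 M"
    using adapted_version[OF \<xi> st(1)] .
  obtain Z where Z: "Z \<in> borel_measurable (F s)" "AE w in M. \<zeta> w = Z w" "Z \<in> L2 M"
    using adapted_version[OF \<zeta> st(1)] .
  have "(\<integral>w. (Y w \<bullet> Z w) * (W t w - W s w) \<partial>M) = (\<integral>w. Y w \<bullet> Z w \<partial>M) * (\<integral>w. W t w - W s w \<partial>M)"
    using Y(1) Z(1) by (intro increment_indep_expectation[OF st', where g = "\<lambda>x. x"])
      (auto intro: L2_inner_integrable Y Z increment_moments[OF st'])
  then have "(\<integral>w. (Y w \<bullet> Z w) * (W t w - W s w) \<partial>M) = 0"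
    using increment_moments(2)[OF st'] by simp
  moreover have "L2_inner M (\<lambda>w. (W t w - W s w) *\<^sub>R \<xi> w) \<zeta> = (\<integral>w. (Y w \<bullet> Z w) * (W t w - W s w) \<partial>M)"
    unfolding L2_inner_def
  proof (rule integral_cong_AE)
    show "(\<lambda>w. ((W t w - W s w) *\<^sub>R \<xi> w) \<bullet> \<zeta> w) \<in> borel_measurable M"
      using L2_measurable[OF adapted_L2[OF \<xi>]] L2_measurable[OF adapted_L2[OF \<zeta>]] W_measurable st
      by (auto intro!: borel_measurable_scaleR borel_measurable_inner)
    show "(\<lambda>w. (Y w \<bullet> Z w) * (W t w - W s w)) \<in> borel_measurable M"
      using L2_measurable[OF Y(3)] L2_measurable[OF Z(3)] W_measurable st
      by (auto intro!: borel_measurable_inner borel_measurable_times)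
    show "AE w in M. ((W t w - W s w) *\<^sub>R \<xi> w) \<bullet> \<zeta> w = (Y w \<bullet> Z w) * (W t w - W s w)"
      using Y(2) Z(2) by eventually_elim simp
  qed
  ultimately show ?thesis by simp
qed simp

lemma increment_inner_same:
  assumes st: "0 \<le> s" "s \<le> t" and \<xi>: "\<xi> \<in> L2_adapted M F s" and \<zeta>: "\<zeta> \<in> L2_adapted M F s"
  shows "L2_inner M (\<lambda>w. (W t w - W s w) *\<^sub>R \<xi> w) (\<lambda>w. (W t w - W s w) *\<^sub>R \<zeta> w)
    = (t - s) * L2_inner M \<xi> \<zeta>"
proof (cases "s = t")
  case False
  then have st': "0 \<le> s" "s < t" using st by auto
  obtain Y where Y: "Y \<in> borel_measurable (F s)" "AE w in M. \<xi> w = Y w" "Y \<in> L2 M"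
    using adapted_version[OF \<xi> st(1)] .
  obtain Z where Z: "Z \<in> borel_measurable (F s)" "AE w in M. \<zeta> w = Z w" "Z \<in> L2 M"
    using adapted_version[OF \<zeta> st(1)] .
  have "(\<integral>w. (Y w \<bullet> Z w) * (W t w - W s w)\<^sup>2 \<partial>M) = (\<integral>w. Y w \<bullet> Z w \<partial>M) * (\<integral>w. (W t w - W s w)\<^sup>2 \<partial>M)"
    using Y(1) Z(1) by (intro increment_indep_expectation[OF st', where g = "\<lambda>x. x\<^sup>2"])
      (auto intro: L2_inner_integrable Y Z increment_moments[OF st'])
  then have "(\<integral>w. (Y w \<bullet> Z w) * (W t w - W s w)\<^sup>2 \<partial>M) = (t - s) * L2_inner M Y Z"
    using increment_moments(4)[OF st'] by (simp add: L2_inner_def)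
  moreover have "L2_inner M Y Z = L2_inner M \<xi> \<zeta>"
    by (rule L2_inner_cong_AE) (use Y Z \<xi> \<zeta> in \<open>auto intro: adapted_L2\<close>)
  moreover have "L2_inner M (\<lambda>w. (W t w - W s w) *\<^sub>R \<xi> w) (\<lambda>w. (W t w - W s w) *\<^sub>R \<zeta> w)
      = (\<integral>w. (Y w \<bullet> Z w) * (W t w - W s w)\<^sup>2 \<partial>M)"
    unfolding L2_inner_def
  proof (rule integral_cong_AE)
    show "(\<lambda>w. ((W t w - W s w) *\<^sub>R \<xi> w) \<bullet> ((W t w - W s w) *\<^sub>R \<zeta> w)) \<in> borel_measurable M"
      using L2_measurable[OF adapted_L2[OF \<xi>]] L2_measurable[OF adapted_L2[OF \<zeta>]] W_measurable st
      by (auto intro!: borel_measurable_scaleR borel_measurable_inner)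
    show "(\<lambda>w. (Y w \<bullet> Z w) * (W t w - W s w)\<^sup>2) \<in> borel_measurable M"
      using L2_measurable[OF Y(3)] L2_measurable[OF Z(3)] W_measurable st
      by (auto intro!: borel_measurable_inner borel_measurable_times borel_measurable_power)
    show "AE w in M. ((W t w - W s w) *\<^sub>R \<xi> w) \<bullet> ((W t w - W s w) *\<^sub>R \<zeta> w)
        = (Y w \<bullet> Z w) * (W t w - W s w)\<^sup>2"
      using Y(2) Z(2) by eventually_elim (simp add: power2_eq_square)
  qed
  ultimately show ?thesis by simp
qed simp

lemma increment_split:
  assumes "0 \<le> a" "a \<le> c" "c \<le> b" "\<xi> \<in> L2_adapted M F a" "Z \<in> L2 M"
  shows "L2_inner M (\<lambda>w. (W b w - W a w) *\<^sub>R \<xi> w) Z =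
    L2_inner M (\<lambda>w. (W c w - W a w) *\<^sub>R \<xi> w) Z + L2_inner M (\<lambda>w. (W b w - W c w) *\<^sub>R \<xi> w) Z"
proof -
  have "L2_inner M (\<lambda>w. (W b w - W a w) *\<^sub>R \<xi> w) Z =
    L2_inner M (\<lambda>w. (W c w - W a w) *\<^sub>R \<xi> w + (W b w - W c w) *\<^sub>R \<xi> w) Z"
    by (simp add: scaleR_left_distrib[symmetric])
  then show ?thesis
    using assms adapted_mono[OF assms(4), of c]
    by (simp add: L2_inner_add_left adapted_L2 increment_scale_L2_adapted[THEN adapted_L2])
qed

lemma increment_inner_same_start:
  assumes "0 \<le> c" "c \<le> b" "b \<le> d" and \<xi>: "\<xi> \<in> L2_adapted M F c" and \<eta>: "\<eta> \<in> L2_adapted M F c"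
  shows "L2_inner M (\<lambda>w. (W b w - W c w) *\<^sub>R \<xi> w) (\<lambda>w. (W d w - W c w) *\<^sub>R \<eta> w)
    = (b - c) * L2_inner M \<xi> \<eta>"
proof -
  have L: "(\<lambda>w. (W b w - W c w) *\<^sub>R \<xi> w) \<in> L2_adapted M F b"
    by (rule increment_scale_L2_adapted) (use assms in auto)
  have "L2_inner M (\<lambda>w. (W d w - W c w) *\<^sub>R \<eta> w) (\<lambda>w. (W b w - W c w) *\<^sub>R \<xi> w) =
      L2_inner M (\<lambda>w. (W b w - W c w) *\<^sub>R \<eta> w) (\<lambda>w. (W b w - W c w) *\<^sub>R \<xi> w) +
      L2_inner M (\<lambda>w. (W d w - W b w) *\<^sub>R \<eta> w) (\<lambda>w. (W b w - W c w) *\<^sub>R \<xi> w)"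
    by (rule increment_split) (use assms adapted_L2[OF L] in auto)
  also have "\<dots> = (b - c) * L2_inner M \<eta> \<xi>"
    using increment_inner_same[OF assms(1,2) \<eta> \<xi>]
      increment_inner_past[of b d \<eta>, OF _ _ adapted_mono[OF \<eta>] L] assms by auto
  finally show ?thesis by (simp add: L2_inner_commute)
qed

text \<open>A cut at the later starting point separates a piece known at that time, which is
  orthogonal to the other increment, from a piece with the same start; a second cut at the earlier
  end isolates the overlap, whose variance is its length.\<close>

lemma increment_inner:
  assumes "0 \<le> a" "a \<le> b" "0 \<le> c" "c \<le> d" "\<xi> \<in> L2_adapted M F a" "\<eta> \<in> L2_adapted M F c"
  shows "L2_inner M (\<lambda>w. (W b w - W a w) *\<^sub>R \<xi> w) (\<lambda>w. (W d w - W c w) *\<^sub>R \<eta> w)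
    = max 0 (min b d - max a c) * L2_inner M \<xi> \<eta>"
proof -
  \<comment> \<open>By symmetry the interval that starts first may stand on the left.\<close>
  have *: "L2_inner M (\<lambda>w. (W b w - W a w) *\<^sub>R \<xi> w) (\<lambda>w. (W d w - W c w) *\<^sub>R \<eta> w)
    = max 0 (min b d - max a c) * L2_inner M \<xi> \<eta>"
    if h: "0 \<le> a" "a \<le> b" "a \<le> c" "c \<le> d" and \<xi>: "\<xi> \<in> L2_adapted M F a" and \<eta>: "\<eta> \<in> L2_adapted M F c"
    for a b c d \<xi> \<eta>
  proof -
    have L: "(\<lambda>w. (W y w - W x w) *\<^sub>R \<zeta> w) \<in> L2_adapted M F y"
      if "0 \<le> x" "x \<le> y" "\<zeta> \<in> L2_adapted M F x" for x y \<zeta>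
      by (rule increment_scale_L2_adapted) (use that in auto)
    have past: "L2_inner M \<zeta> (\<lambda>w. (W d w - W c w) *\<^sub>R \<eta> w) = 0" if "\<zeta> \<in> L2_adapted M F c" for \<zeta>
      using increment_inner_past[OF _ h(4) \<eta> that] h by (simp add: L2_inner_commute)
    have \<xi>c: "\<xi> \<in> L2_adapted M F c" using adapted_mono[OF \<xi> h(1,3)] .
    show ?thesis
    proof (cases "b \<le> c")
      case True
      have "(\<lambda>w. (W b w - W a w) *\<^sub>R \<xi> w) \<in> L2_adapted M F c"
        using adapted_mono[OF L[OF h(1,2) \<xi>]] h True by auto
      then show ?thesis using past True h by (simp add: max_def)
    next
      case False
      have dL: "(\<lambda>w. (W d w - W c w) *\<^sub>R \<eta> w) \<in> L2 M" using L[of c d \<eta>] h \<eta> by (auto intro: adapted_L2)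
      have "L2_inner M (\<lambda>w. (W b w - W a w) *\<^sub>R \<xi> w) (\<lambda>w. (W d w - W c w) *\<^sub>R \<eta> w)
          = L2_inner M (\<lambda>w. (W b w - W c w) *\<^sub>R \<xi> w) (\<lambda>w. (W d w - W c w) *\<^sub>R \<eta> w)"
        using increment_split[OF h(1,3) _ \<xi> dL, of b] past[OF L[OF h(1,3) \<xi>]] False by simp
      also have "\<dots> = (min b d - c) * L2_inner M \<xi> \<eta>"
      proof (cases "b \<le> d")
        case True
        then show ?thesis using increment_inner_same_start[of c b d \<xi> \<eta>] \<xi>c \<eta> h False by simp
      next
        case F2: False
        then show ?thesis
          using increment_inner_same_start[of c d b \<eta> \<xi>] \<xi>c \<eta> h by (simp add: L2_inner_commute)
      qed
      finally show ?thesis using False h by (simp add: max_def)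
    qed
  qed
  show ?thesis
  proof (cases "a \<le> c")
    case True
    then show ?thesis using *[OF assms(1,2) True assms(4-6)] by simp
  next
    case False
    then show ?thesis using *[OF assms(3,4) _ assms(2,6,5)]
      by (simp add: L2_inner_commute max.commute min.commute)
  qed
qed

section \<open>Step integrals against Brownian motion: adaptedness, isometry, orthogonality to the
  past\<close>

lemma step_integral_adapted:
  assumes p: "is_partition a b p m" "0 \<le> a" and \<xi>: "\<forall>i<m. \<xi> i \<in> L2_adapted M F (p i)"
  shows "step_integral W p m \<xi> \<in> L2_adapted M F b"
  unfolding step_integral_eq
proof (rule adapted_sum)
  fix i assume "i \<in> {..<m}"
  then have i: "i < m" by simp
  then have "0 \<le> p i" "p i \<le> p (Suc i)" "p (Suc i) \<le> b"
    using partition_bounds[OF p(1), of i] partition_bounds[OF p(1), of "Suc i"]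
      partition_step[OF p(1)] p(2) by auto
  then show "(\<lambda>w. (W (p (Suc i)) w - W (p i) w) *\<^sub>R \<xi> i w) \<in> L2_adapted M F b"
    using adapted_mono[OF increment_scale_L2_adapted[OF _ _ \<xi>[rule_format, OF i]]] by auto
qed

text \<open>The isometry is stated for two different partitions, so that limits of step integrals can be
  compared without a common refinement.\<close>

lemma step_ito_pairing:
  assumes p: "is_partition a b p m" and r: "is_partition a b r l" and a: "0 \<le> a"
    and \<xi>: "\<forall>i<m. \<xi> i \<in> L2_adapted M F (p i)"
    and \<eta>: "\<forall>j<l. \<eta> j \<in> L2_adapted M F (r j)"
  shows "((\<lambda>s. L2_inner M (step_process p m \<xi> s) (step_process r l \<eta> s)) has_integral
    L2_inner M (step_integral W p m \<xi>) (step_integral W r l \<eta>)) {a..b}"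
proof -
  note \<xi> = \<xi>[rule_format] and \<eta> = \<eta>[rule_format]
  have pos: "0 \<le> p i" "p i \<le> p (Suc i)" if "i < m" for i
    using partition_bounds[OF p, of i] partition_step[OF p that] a that by auto
  have pos': "0 \<le> r i" "r i \<le> r (Suc i)" if "i < l" for i
    using partition_bounds[OF r, of i] partition_step[OF r that] a that by auto
  have L: "(\<lambda>w. (W (p (Suc i)) w - W (p i) w) *\<^sub>R \<xi> i w) \<in> L2 M" if "i < m" for i
    by (rule adapted_L2[OF increment_scale_L2_adapted[OF pos[OF that] \<xi>[OF that]]])
  have L': "(\<lambda>w. (W (r (Suc i)) w - W (r i) w) *\<^sub>R \<eta> i w) \<in> L2 M" if "i < l" for i
    by (rule adapted_L2[OF increment_scale_L2_adapted[OF pos'[OF that] \<eta>[OF that]]])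
  have "L2_inner M (step_integral W p m \<xi>) (step_integral W r l \<eta>) =
    (\<Sum>i<m. L2_inner M (\<lambda>w. (W (p (Suc i)) w - W (p i) w) *\<^sub>R \<xi> i w)
       (\<lambda>w. \<Sum>j<l. (W (r (Suc j)) w - W (r j) w) *\<^sub>R \<eta> j w))"
    unfolding step_integral_eq by (rule L2_inner_sum_left) (auto intro!: L L' L2_sum)
  also have "\<dots> = (\<Sum>i<m. \<Sum>j<l. L2_inner M (\<lambda>w. (W (p (Suc i)) w - W (p i) w) *\<^sub>R \<xi> i w)
      (\<lambda>w. (W (r (Suc j)) w - W (r j) w) *\<^sub>R \<eta> j w))"
    by (intro sum.cong L2_inner_sum_right refl) (auto intro!: L L')
  also have "\<dots> = (\<Sum>i<m. \<Sum>j<l. max 0 (min (p (Suc i)) (r (Suc j)) - max (p i) (r j)) * L2_inner M (\<xi> i) (\<eta> j))"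
    by (intro sum.cong increment_inner refl) (auto intro!: pos pos' \<xi> \<eta>)
  finally show ?thesis
    using step_process_inner_integral[OF p r, of \<xi> M \<eta>] \<xi> \<eta> by (auto intro: adapted_L2)
qed

lemma step_ito_past:
  assumes p: "is_partition a b p m" and a: "0 \<le> a"
    and \<xi>: "\<forall>i<m. \<xi> i \<in> L2_adapted M F (p i)" and z: "\<zeta> \<in> L2_adapted M F a"
  shows "L2_inner M (step_integral W p m \<xi>) \<zeta> = 0"
proof -
  note \<xi> = \<xi>[rule_format]
  have pos: "0 \<le> p i" "p i \<le> p (Suc i)" "a \<le> p i" if "i < m" for i
    using partition_bounds[OF p, of i] partition_step[OF p that] a that by auto
  have L: "(\<lambda>w. (W (p (Suc i)) w - W (p i) w) *\<^sub>R \<xi> i w) \<in> L2 M" if "i < m" for i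
    by (rule adapted_L2[OF increment_scale_L2_adapted[OF pos(1,2)[OF that] \<xi>[OF that]]])
  have "L2_inner M (step_integral W p m \<xi>) \<zeta> =
      (\<Sum>i<m. L2_inner M (\<lambda>w. (W (p (Suc i)) w - W (p i) w) *\<^sub>R \<xi> i w) \<zeta>)"
    unfolding step_integral_eq by (rule L2_inner_sum_left) (auto intro!: L adapted_L2[OF z])
  also have "\<dots> = 0"
  proof (rule sum.neutral, rule ballI)
    fix i assume "i \<in> {..<m}"
    then have i: "i < m" by simp
    show "L2_inner M (\<lambda>w. (W (p (Suc i)) w - W (p i) w) *\<^sub>R \<xi> i w) \<zeta> = 0"
      by (rule increment_inner_past[OF pos(1,2)[OF i] \<xi>[OF i] adapted_mono[OF z a pos(3)[OF i]]])
  qed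
  finally show ?thesis .
qed

end

section \<open>Continuity in mean square\<close>

definition L2_continuous_on :: "'w measure \<Rightarrow> real set \<Rightarrow> (real \<Rightarrow> 'w \<Rightarrow> 'b::euclidean_space) \<Rightarrow> bool" where
  "L2_continuous_on M S g \<longleftrightarrow> (\<forall>s\<in>S. g s \<in> L2 M) \<and>
     (\<forall>s\<in>S. ((\<lambda>r. L2_dist M (g r) (g s)) \<longlongrightarrow> 0) (at s within S))"

lemma L2_continuous_onD: "L2_continuous_on M S g \<Longrightarrow> s \<in> S \<Longrightarrow> g s \<in> L2 M"
  by (simp add: L2_continuous_on_def)

lemma L2_continuous_on_subset: "L2_continuous_on M S g \<Longrightarrow> T \<subseteq> S \<Longrightarrow> L2_continuous_on M T g"
  unfolding L2_continuous_on_def by (meson subsetD tendsto_within_subset)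

lemma eventually_in_within: "\<forall>\<^sub>F r in at s within S. r \<in> S"
  by (simp add: eventually_at_filter)

lemma L2_continuous_on_const: "X \<in> L2 M \<Longrightarrow> L2_continuous_on M S (\<lambda>s. X)"
  by (simp add: L2_continuous_on_def)

lemma L2_continuous_on_inner:
  assumes "L2_continuous_on M S g" "L2_continuous_on M S g'"
  shows "continuous_on S (\<lambda>s. L2_inner M (g s) (g' s))"
  unfolding continuous_on_def
proof
  fix s assume "s \<in> S"
  then show "((\<lambda>s. L2_inner M (g s) (g' s)) \<longlongrightarrow> L2_inner M (g s) (g' s)) (at s within S)"
    using assms eventually_mono[OF eventually_in_within[of S s]]
    by (intro L2_inner_tendsto) (auto simp: L2_continuous_on_def)
qed

lemma L2_continuous_on_norm_square:
  "L2_continuous_on M S g \<Longrightarrow> continuous_on S (\<lambda>s. (L2_norm M (g s))\<^sup>2)"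
  unfolding L2_norm_square by (rule L2_continuous_on_inner)

lemma L2_continuous_on_norm:
  assumes "L2_continuous_on M S g"
  shows "continuous_on S (\<lambda>s. L2_norm M (g s))"
  using continuous_on_real_sqrt[OF L2_continuous_on_norm_square[OF assms]] by simp

lemma L2_continuous_onI_le:
  assumes "\<And>s. s \<in> S \<Longrightarrow> g s \<in> L2 M"
    "\<And>s. s \<in> S \<Longrightarrow> ((\<lambda>r. \<phi> s r) \<longlongrightarrow> 0) (at s within S)"
    "\<And>r s. r \<in> S \<Longrightarrow> s \<in> S \<Longrightarrow> L2_dist M (g r) (g s) \<le> \<phi> s r"
  shows "L2_continuous_on M S g"
  unfolding L2_continuous_on_def
proof (intro conjI ballI assms(1))
  fix s assume s: "s \<in> S"
  show "((\<lambda>r. L2_dist M (g r) (g s)) \<longlongrightarrow> 0) (at s within S)"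
  proof (rule metric_tendsto_imp_tendsto[OF assms(2)[OF s]])
    show "\<forall>\<^sub>F r in at s within S. dist (L2_dist M (g r) (g s)) 0 \<le> dist (\<phi> s r) 0"
      using eventually_in_within
      by eventually_elim (use s in \<open>simp add: dist_real_def order_trans[OF assms(3) abs_ge_self]\<close>)
  qed
qed

lemma L2_continuous_on_add:
  assumes "L2_continuous_on M S g" "L2_continuous_on M S g'"
  shows "L2_continuous_on M S (\<lambda>s w. g s w + g' s w)"
proof (rule L2_continuous_onI_le)
  show "((\<lambda>r. L2_dist M (g r) (g s) + L2_dist M (g' r) (g' s)) \<longlongrightarrow> 0) (at s within S)" if "s \<in> S" for s
    using assms that by (auto simp: L2_continuous_on_def intro!: tendsto_eq_intros)
  show "L2_dist M (\<lambda>w. g r w + g' r w) (\<lambda>w. g s w + g' s w) \<le> L2_dist M (g r) (g s) + L2_dist M (g' r) (g' s)"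
    if "r \<in> S" "s \<in> S" for r s
    using L2_norm_triangle[OF L2_diff[OF assms(1)[THEN L2_continuous_onD, OF that(1)] assms(1)[THEN L2_continuous_onD, OF that(2)]]
      L2_diff[OF assms(2)[THEN L2_continuous_onD, OF that(1)] assms(2)[THEN L2_continuous_onD, OF that(2)]]]
    by (simp add: L2_dist_norm algebra_simps)
qed (use assms in \<open>auto intro: L2_add L2_continuous_onD\<close>)

lemma L2_continuous_on_linear:
  assumes "bounded_linear T" "L2_continuous_on M S g"
  shows "L2_continuous_on M S (\<lambda>s w. T (g s w))"
proof -
  interpret T: bounded_linear T by fact
  obtain C where C: "0 \<le> C" "\<And>x. norm (T x) \<le> C * norm x"
    using T.nonneg_bounded by (metis mult.commute)
  show ?thesis
  proof (rule L2_continuous_onI_le)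
    show "((\<lambda>r. C * L2_dist M (g r) (g s)) \<longlongrightarrow> 0) (at s within S)" if "s \<in> S" for s
      using assms that by (auto simp: L2_continuous_on_def intro!: tendsto_eq_intros)
    show "L2_dist M (\<lambda>w. T (g r w)) (\<lambda>w. T (g s w)) \<le> C * L2_dist M (g r) (g s)"
      if "r \<in> S" "s \<in> S" for r s
      using L2_norm_linear[OF assms(1) C(2,1) L2_diff[OF assms(2)[THEN L2_continuous_onD, OF that(1)] assms(2)[THEN L2_continuous_onD, OF that(2)]]]
      by (simp add: L2_dist_norm T.diff)
  qed (use assms in \<open>auto intro: L2_linear L2_continuous_onD\<close>)
qed

lemma L2_continuous_on_diff:
  assumes "L2_continuous_on M S g" "L2_continuous_on M S g'"
  shows "L2_continuous_on M S (\<lambda>s w. g s w - g' s w)"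
  using L2_continuous_on_add[OF assms(1) L2_continuous_on_linear[OF bounded_linear_minus[OF bounded_linear_ident] assms(2)]]
  by simp

text \<open>A general bilinear product serves both the vector equation and the matrix equation of
  the fundamental solution. The difference is split by changing first the process, then the
  coefficient.\<close>

lemma L2_continuous_on_bilinear:
  fixes prod :: "'a::real_normed_vector \<Rightarrow> 'b::euclidean_space \<Rightarrow> 'c::euclidean_space"
  assumes bilin: "bounded_bilinear prod"
    and A: "continuous_on S A" and g: "L2_continuous_on M S g"
  shows "L2_continuous_on M S (\<lambda>s w. prod (A s) (g s w))"
proof -
  interpret bounded_bilinear prod by fact
  obtain C where C: "0 \<le> C" "\<And>x y. norm (prod x y) \<le> norm x * norm y * C"
    using nonneg_bounded by blast
  have n: "L2_norm M (\<lambda>w. prod x (X w)) \<le> norm x * C * L2_norm M X" if "X \<in> L2 M" for x X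
    by (rule L2_norm_linear[OF bounded_linear_right]) (use C that in \<open>auto simp: algebra_simps\<close>)
  have l: "(\<lambda>w. prod x (X w)) \<in> L2 M" if "X \<in> L2 M" for x X
    by (rule L2_linear[OF bounded_linear_right that])
  show ?thesis
  proof (rule L2_continuous_onI_le)
    show "((\<lambda>r. norm (A r) * C * L2_dist M (g r) (g s) + norm (A r - A s) * C * L2_norm M (g s)) \<longlongrightarrow> 0)
        (at s within S)" if "s \<in> S" for s
    proof -
      have "(A \<longlongrightarrow> A s) (at s within S)" "((\<lambda>r. L2_dist M (g r) (g s)) \<longlongrightarrow> 0) (at s within S)"
        using A g that by (auto simp: continuous_on_def L2_continuous_on_def)
      then show ?thesis by (auto intro!: tendsto_eq_intros)
    qed
    show "L2_dist M (\<lambda>w. prod (A r) (g r w)) (\<lambda>w. prod (A s) (g s w))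
        \<le> norm (A r) * C * L2_dist M (g r) (g s) + norm (A r - A s) * C * L2_norm M (g s)"
      if "r \<in> S" "s \<in> S" for r s
    proof -
      have L: "g r \<in> L2 M" "g s \<in> L2 M" using g that by (auto intro: L2_continuous_onD)
      have "L2_dist M (\<lambda>w. prod (A r) (g r w)) (\<lambda>w. prod (A s) (g s w)) =
          L2_norm M (\<lambda>w. prod (A r) (g r w - g s w) + prod (A r - A s) (g s w))"
        by (simp add: L2_dist_norm diff_left diff_right)
      also have "\<dots> \<le> L2_norm M (\<lambda>w. prod (A r) (g r w - g s w)) + L2_norm M (\<lambda>w. prod (A r - A s) (g s w))"
        by (intro L2_norm_triangle l L2_diff L)
      also have "\<dots> \<le> norm (A r) * C * L2_dist M (g r) (g s) + norm (A r - A s) * C * L2_norm M (g s)"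
        unfolding L2_dist_norm by (intro add_mono n L2_diff L)
      finally show ?thesis .
    qed
  qed (use g l in \<open>auto intro: L2_continuous_onD\<close>)
qed

lemma L2_continuous_on_dist:
  assumes "L2_continuous_on M S g" "X \<in> L2 M"
  shows "continuous_on S (\<lambda>s. L2_dist M (g s) X)"
  unfolding L2_dist_norm
  by (rule L2_continuous_on_norm[OF L2_continuous_on_diff[OF assms(1) L2_continuous_on_const[OF assms(2)]]])

text \<open>The Heine-Cantor theorem is applied to the real function (r, s) ->
  \<open>L2_dist M (g r) (g s)\<close> on the compact square, because \<open>g\<close> itself takes
  values in functions that carry only a pseudometric.\<close>

lemma L2_uniformly_continuous:
  assumes g: "L2_continuous_on M {a..b} g" and "0 < e"
  obtains d where "0 < d" "\<And>r s. r \<in> {a..b} \<Longrightarrow> s \<in> {a..b} \<Longrightarrow> \<bar>r - s\<bar> < d \<Longrightarrow> L2_dist M (g r) (g s) < e"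
proof -
  let ?S = "{a..b} \<times> {a..b}"
  have 1: "continuous_on ?S (\<lambda>y. L2_dist M (g (fst y)) X)" "continuous_on ?S (\<lambda>y. L2_dist M (g (snd y)) X)"
    if "X \<in> L2 M" for X
    by (rule continuous_on_compose2[OF L2_continuous_on_dist[OF g that]]; auto intro!: continuous_intros)+
  have "continuous_on ?S (\<lambda>y. L2_dist M (g (fst y)) (g (snd y)))"
    unfolding continuous_on_def
  proof
    fix x assume x: "x \<in> ?S"
    have L: "g (fst y) \<in> L2 M" "g (snd y) \<in> L2 M" if "y \<in> ?S" for y
      using g that by (auto intro: L2_continuous_onD)
    have lim: "((\<lambda>y. L2_dist M (g (fst y)) (g (fst x)) + L2_dist M (g (snd y)) (g (snd x))) \<longlongrightarrow> 0) (at x within ?S)"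
      using 1(1)[OF L(1)[OF x]] 1(2)[OF L(2)[OF x]] x
      by (force simp: continuous_on_def intro!: tendsto_eq_intros)
    show "((\<lambda>y. L2_dist M (g (fst y)) (g (snd y))) \<longlongrightarrow> L2_dist M (g (fst x)) (g (snd x))) (at x within ?S)"
    proof (rule metric_tendsto_imp_tendsto[OF lim])
      have "\<forall>\<^sub>F y in at x within ?S. y \<in> ?S" by (simp add: eventually_at_filter)
      then show "\<forall>\<^sub>F y in at x within ?S. dist (L2_dist M (g (fst y)) (g (snd y))) (L2_dist M (g (fst x)) (g (snd x)))
        \<le> dist (L2_dist M (g (fst y)) (g (fst x)) + L2_dist M (g (snd y)) (g (snd x))) 0"
      proof eventually_elim
        case (elim y)
        note T = L2_dist_triangle[of _ M]
        have "L2_dist M (g (fst y)) (g (snd y)) \<le> L2_dist M (g (fst y)) (g (fst x)) + (L2_dist M (g (fst x)) (g (snd x)) + L2_dist M (g (snd x)) (g (snd y)))"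
          using T[OF L(1)[OF elim] L(1)[OF x] L(2)[OF elim]] T[OF L(1)[OF x] L(2)[OF x] L(2)[OF elim]] by linarith
        moreover have "L2_dist M (g (fst x)) (g (snd x)) \<le> L2_dist M (g (fst x)) (g (fst y)) + (L2_dist M (g (fst y)) (g (snd y)) + L2_dist M (g (snd y)) (g (snd x)))"
          using T[OF L(1)[OF x] L(1)[OF elim] L(2)[OF x]] T[OF L(1)[OF elim] L(2)[OF elim] L(2)[OF x]] by linarith
        ultimately show ?case
          using L2_dist_commute[of M "g (fst x)" "g (fst y)"] L2_dist_commute[of M "g (snd x)" "g (snd y)"]
            L2_dist_nonneg[of M "g (fst y)" "g (fst x)"] L2_dist_nonneg[of M "g (snd y)" "g (snd x)"]
          unfolding dist_real_def by linarith
      qed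
    qed
  qed
  then have "uniformly_continuous_on ?S (\<lambda>y. L2_dist M (g (fst y)) (g (snd y)))"
    by (rule compact_uniformly_continuous) (intro compact_Times compact_Icc)
  then obtain d where d: "0 < d" "\<And>x y. x \<in> ?S \<Longrightarrow> y \<in> ?S \<Longrightarrow> dist y x < d \<Longrightarrow>
      dist (L2_dist M (g (fst y)) (g (snd y))) (L2_dist M (g (fst x)) (g (snd x))) < e"
    using \<open>0 < e\<close> unfolding uniformly_continuous_on_def by metis
  \<comment> \<open>Comparison with the diagonal point \<open>(s, s)\<close>, where the distance is
    0.\<close>
  have "L2_dist M (g r) (g s) < e" if "r \<in> {a..b}" "s \<in> {a..b}" "\<bar>r - s\<bar> < d" for r s
    using d(2)[of "(s, s)" "(r, s)"] that by (simp add: dist_Pair_Pair dist_real_def)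
  with d(1) show ?thesis using that by blast
qed

lemma L2_continuous_on_bounded:
  assumes "L2_continuous_on M {a..b} g"
  obtains B where "0 < B" "\<And>s. s \<in> {a..b} \<Longrightarrow> L2_norm M (g s) \<le> B"
proof -
  have "bounded ((\<lambda>s. L2_norm M (g s)) ` {a..b})"
    by (intro compact_imp_bounded compact_continuous_image L2_continuous_on_norm assms compact_Icc)
  then obtain B where "0 < B" "\<forall>s\<in>{a..b}. norm (L2_norm M (g s)) \<le> B"
    unfolding bounded_pos by auto
  then show ?thesis using that by auto
qed

section \<open>Approximation of mean square continuous processes by Riemann step processes\<close>

lemma step_process_at:
  assumes p: "is_partition a b p m" and i: "i < m" and s: "s \<in> {p i..<p (Suc i)}"
  shows "step_process p m \<xi> s = \<xi> i"
proof -
  have "(indicator {p j..<p (Suc j)} s :: real) = (if j = i then 1 else 0)" if "j < m" for j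
  proof (cases j i rule: linorder_cases)
    case less
    then show ?thesis using partition_mono[OF p, of "Suc j" i] s i by auto
  next
    case greater
    then show ?thesis using partition_mono[OF p, of "Suc i" j] s that by auto
  qed (use s in auto)
  then have "step_process p m \<xi> s w = (\<Sum>j<m. if j = i then \<xi> i w else 0)" for w
    unfolding step_process_def by (intro sum.cong) auto
  then show ?thesis using i by (auto simp: fun_eq_iff)
qed

text \<open>Induction over the cells; the right end point of each cell, where the formula may
  switch, is a null set.\<close>

lemma partition_integrable:
  fixes \<phi> :: "real \<Rightarrow> real"
  assumes p: "is_partition a b p m"
    and \<psi>: "\<And>i. i < m \<Longrightarrow> \<psi> i integrable_on {p i..p (Suc i)}"
    and eq: "\<And>i s. i < m \<Longrightarrow> s \<in> {p i..<p (Suc i)} \<Longrightarrow> \<phi> s = \<psi> i s"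
  shows "\<phi> integrable_on {a..b}"
proof -
  have "\<phi> integrable_on {a..p k}" if "k \<le> m" for k
    using that
  proof (induction k)
    case 0
    then show ?case
      using p has_integral_refl(2)[of \<phi> a] by (auto simp: is_partition_def integrable_on_def)
  next
    case (Suc k)
    have "\<phi> integrable_on {p k..p (Suc k)}"
      by (rule integrable_spike_finite[where S = "{p (Suc k)}" and f = "\<psi> k"]) (use Suc.prems eq \<psi> in auto)
    then show ?case
      using Suc partition_bounds[OF p, of k] partition_step[OF p, of k]
      by (intro Henstock_Kurzweil_Integration.integrable_combine[where a = a and c = "p k" and b = "p (Suc k)"]) auto
  qed
  from this[of m] show ?thesis using p by (simp add: is_partition_def)
qed

lemma L2_dist_step_integrable:
  assumes p: "is_partition a b p m" and g: "L2_continuous_on M {a..b} g"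
    and \<xi>: "\<forall>i<m. \<xi> i \<in> L2 M"
  shows "(\<lambda>s. L2_dist M (g s) (step_process p m \<xi> s)) integrable_on {a..b}"
    "(\<lambda>s. (L2_dist M (g s) (step_process p m \<xi> s))\<^sup>2) integrable_on {a..b}"
proof -
  note \<xi> = \<xi>[rule_format]
  have c: "continuous_on {p i..p (Suc i)} (\<lambda>s. L2_dist M (g s) (\<xi> i))" if "i < m" for i
    using partition_bounds[OF p, of i] partition_bounds[OF p, of "Suc i"] that
    by (intro L2_continuous_on_dist[OF L2_continuous_on_subset[OF g]] \<xi>) auto
  have c2: "continuous_on {p i..p (Suc i)} (\<lambda>s. (L2_dist M (g s) (\<xi> i))\<^sup>2)" if "i < m" for i
    by (intro continuous_on_power c that)
  show "(\<lambda>s. L2_dist M (g s) (step_process p m \<xi> s)) integrable_on {a..b}"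
    by (rule partition_integrable[OF p, of "\<lambda>i s. L2_dist M (g s) (\<xi> i)"])
      (auto intro!: integrable_continuous_interval c simp: step_process_at[OF p])
  show "(\<lambda>s. (L2_dist M (g s) (step_process p m \<xi> s))\<^sup>2) integrable_on {a..b}"
    by (rule partition_integrable[OF p, of "\<lambda>i s. (L2_dist M (g s) (\<xi> i))\<^sup>2"])
      (auto intro!: integrable_continuous_interval c2 simp: step_process_at[OF p])
qed

lemma partition_locate:
  assumes p: "is_partition a b p m" and s: "s \<in> {a..<b}"
  obtains i where "i < m" "s \<in> {p i..<p (Suc i)}"
proof -
  have "\<exists>i<k. s \<in> {p i..<p (Suc i)}" if "k \<le> m" "s < p k" for k
    using that
  proof (induction k)
    case 0
    then show ?case using p s by (simp add: is_partition_def)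
  next
    case (Suc k)
    then show ?case by (cases "s < p k") (auto simp: less_Suc_eq)
  qed
  then show ?thesis using that p s by (auto simp: is_partition_def)
qed

text \<open>With \<open>Suc k\<close> cells the denominator is never 0, so \<open>k\<close> can
  index a sequence from 0 on.\<close>

definition uniform_partition :: "real \<Rightarrow> real \<Rightarrow> nat \<Rightarrow> nat \<Rightarrow> real" where
  "uniform_partition a b k i = a + (b - a) * real i / real (Suc k)"

lemma uniform_partition:
  assumes "a \<le> b"
  shows "is_partition a b (uniform_partition a b k) (Suc k)"
proof -
  have "(b - a) * real (Suc k) / real (Suc k) = b - a"
    by (rule nonzero_mult_div_cancel_right) simp
  with assms show ?thesis
    by (auto simp: is_partition_def uniform_partition_def intro!: divide_right_mono mult_left_mono
        simp del: of_nat_Suc mult_eq_0_iff)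
      (simp add: of_nat_Suc)?
qed

lemma uniform_partition_step:
  "uniform_partition a b k (Suc i) - uniform_partition a b k i = (b - a) / real (Suc k)"
  by (simp add: uniform_partition_def distrib_left add_divide_distrib)

text \<open>Uniform continuity applies once the mesh is fine enough. The right end point is left out
  because all cells are half-open, so that every step process vanishes at b.\<close>

lemma riemann_step_close:
  assumes ab: "a \<le> b" and g: "L2_continuous_on M {a..b} g" and e: "0 < e"
  shows "\<exists>N. \<forall>k\<ge>N. \<forall>s\<in>{a..<b}. L2_dist M (g s)
    (step_process (uniform_partition a b k) (Suc k) (\<lambda>i. g (uniform_partition a b k i)) s) \<le> e"
proof -
  obtain d where d: "0 < d" "\<And>r s. r \<in> {a..b} \<Longrightarrow> s \<in> {a..b} \<Longrightarrow> \<bar>r - s\<bar> < d \<Longrightarrow> L2_dist M (g r) (g s) < e"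
    using L2_uniformly_continuous[OF g e] by metis
  obtain N where N: "(b - a) / d < real N" using reals_Archimedean2 by blast
  show ?thesis
  proof (intro exI[of _ N] allI impI ballI)
    fix k s assume k: "N \<le> k" and s: "s \<in> {a..<b}"
    let ?p = "uniform_partition a b k"
    note P = uniform_partition[OF ab, of k]
    obtain i where i: "i < Suc k" "s \<in> {?p i..<?p (Suc i)}" using partition_locate[OF P s] .
    have "(b - a) / d < real (Suc k)" using N k by linarith
    then have "(b - a) / real (Suc k) < d" using d(1) by (simp add: field_simps)
    then have "\<bar>s - ?p i\<bar> < d" using i(2) uniform_partition_step[of a b k i] by auto
    then have "L2_dist M (g s) (g (?p i)) < e"
      using d(2)[of s "?p i"] s partition_bounds[OF P, of i] i(1) by auto
    then show "L2_dist M (g s) (step_process ?p (Suc k) (\<lambda>i. g (?p i)) s) \<le> e"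
      by (simp add: step_process_at[OF P i])
  qed
qed

lemma riemann_step_integral_tendsto:
  assumes ab: "a \<le> b" and g: "L2_continuous_on M {a..b} g"
  defines "e \<equiv> \<lambda>k s. L2_dist M (g s)
    (step_process (uniform_partition a b k) (Suc k) (\<lambda>i. g (uniform_partition a b k i)) s)"
  shows "(\<lambda>k. integral {a..b} (e k)) \<longlonglongrightarrow> 0" "(\<lambda>k. integral {a..b} (\<lambda>s. (e k s)\<^sup>2)) \<longlonglongrightarrow> 0"
proof -
  have bound: "integral {a..b} \<phi> \<le> C * (b - a)"
    if "\<phi> integrable_on {a..b}" "\<And>s. s \<in> {a..<b} \<Longrightarrow> \<phi> s \<le> C" for \<phi> C
  proof -
    \<comment> \<open>The constant bound may fail at b, where the step process is 0; changing it at
      a single point leaves the integral unchanged.\<close>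
    have "((\<lambda>s. if s = b then \<phi> b else C) has_integral C * (b - a)) {a..b}"
      by (rule has_integral_spike_finite[of "{b}" _ _ "\<lambda>s. C"])
        (use has_integral_const_real[of C a b] ab in \<open>auto simp: mult.commute\<close>)
    from has_integral_le[OF integrable_integral[OF that(1)] this] show ?thesis
      using that(2) by auto
  qed
  note P = uniform_partition[OF ab]
  have gL: "\<forall>i<Suc k. g (uniform_partition a b k i) \<in> L2 M" for k
    using partition_bounds[OF P[of k]] by (auto intro!: L2_continuous_onD[OF g])
  have int: "e k integrable_on {a..b}" "(\<lambda>s. (e k s)\<^sup>2) integrable_on {a..b}" for k
    unfolding e_def by (rule L2_dist_step_integrable[OF P g gL])+
  have "\<exists>N. \<forall>k\<ge>N. integral {a..b} (e k) < \<epsilon> \<and> integral {a..b} (\<lambda>s. (e k s)\<^sup>2) < \<epsilon>" if "0 < \<epsilon>" for \<epsilon>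
  proof -
    \<comment> \<open>Since \<eta> <= 1 gives \<eta>^2 <= \<eta>, one threshold serves the error and
      its square; adding 1 to b - a avoids a division by 0 when a = b.\<close>
    define \<eta> where "\<eta> = min 1 (\<epsilon> / (2 * (b - a + 1)))"
    have "\<eta> \<le> \<epsilon> / (2 * (b - a + 1))" by (simp add: \<eta>_def)
    then have "\<eta> * (b - a) \<le> \<epsilon> / (2 * (b - a + 1)) * (b - a)" using ab by (intro mult_right_mono) auto
    also have "\<dots> < \<epsilon>"
      using mult_strict_left_mono[of "b - a" "2 * (b - a + 1)" \<epsilon>] that ab by (simp add: pos_divide_less_eq)
    finally have 1: "\<eta> * (b - a) < \<epsilon>" .
    have "0 < \<eta>" "\<eta> \<le> 1" using that ab by (auto simp: \<eta>_def)
    obtain N where N: "\<And>k s. k \<ge> N \<Longrightarrow> s \<in> {a..<b} \<Longrightarrow> e k s \<le> \<eta>"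
      using riemann_step_close[OF ab g \<open>0 < \<eta>\<close>] unfolding e_def by metis
    have "(e k s)\<^sup>2 \<le> \<eta>" if "k \<ge> N" "s \<in> {a..<b}" for k s
    proof -
      have "(e k s)\<^sup>2 \<le> \<eta>\<^sup>2" using N[OF that] by (intro power_mono) (auto simp: e_def)
      also have "\<dots> \<le> \<eta>" using \<open>0 < \<eta>\<close> \<open>\<eta> \<le> 1\<close> by (simp add: power2_eq_square mult_left_le)
      finally show ?thesis .
    qed
    then have "integral {a..b} (e k) < \<epsilon> \<and> integral {a..b} (\<lambda>s. (e k s)\<^sup>2) < \<epsilon>" if "k \<ge> N" for k
    proof -
      have "integral {a..b} (e k) \<le> \<eta> * (b - a)" "integral {a..b} (\<lambda>s. (e k s)\<^sup>2) \<le> \<eta> * (b - a)"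
        using that N \<open>\<And>s k. k \<ge> N \<Longrightarrow> s \<in> {a..<b} \<Longrightarrow> (e k s)\<^sup>2 \<le> \<eta>\<close>
        by (auto intro!: bound int)
      with 1 show ?thesis by simp
    qed
    then show ?thesis by blast
  qed
  moreover have "0 \<le> integral {a..b} (e k)" "0 \<le> integral {a..b} (\<lambda>s. (e k s)\<^sup>2)" for k
    by (auto intro!: integral_nonneg int) (simp add: e_def)
  ultimately show "(\<lambda>k. integral {a..b} (e k)) \<longlonglongrightarrow> 0" "(\<lambda>k. integral {a..b} (\<lambda>s. (e k s)\<^sup>2)) \<longlonglongrightarrow> 0"
    by (simp_all add: LIMSEQ_iff) meson+
qed

section \<open>Bochner and Ito integrals\<close>

text \<open>Testing against a fixed \<open>z\<close> reduces Bochner integrals to real ones. The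
  bound is linear in the norm of \<open>z\<close>, so a norm estimate is recovered by choosing
  \<open>z\<close> as the difference to be estimated.\<close>

lemma step_time_integral_error:
  assumes p: "is_partition a b p m" and \<xi>: "\<forall>i<m. \<xi> i \<in> L2 M" and z: "z \<in> L2 M"
    and g: "L2_continuous_on M {a..b} g"
    and e: "(\<lambda>s. L2_dist M (g s) (step_process p m \<xi> s)) integrable_on {a..b}"
  shows "\<bar>L2_inner M (step_integral (\<lambda>t w. t) p m \<xi>) z - integral {a..b} (\<lambda>s. L2_inner M (g s) z)\<bar>
    \<le> integral {a..b} (\<lambda>s. L2_dist M (g s) (step_process p m \<xi> s)) * L2_norm M z"
proof -
  have f: "(\<lambda>s. L2_inner M (g s) z) integrable_on {a..b}"
    by (intro integrable_continuous_interval L2_continuous_on_inner g L2_continuous_on_const z)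
  note h = has_integral_diff[OF step_time_integral_inner[OF p \<xi> z] integrable_integral[OF f]]
  have "norm (integral {a..b} (\<lambda>s. L2_inner M (step_process p m \<xi> s) z - L2_inner M (g s) z))
    \<le> integral {a..b} (\<lambda>s. L2_dist M (g s) (step_process p m \<xi> s) * L2_norm M z)"
  proof (rule integral_norm_bound_integral)
    show "(\<lambda>s. L2_inner M (step_process p m \<xi> s) z - L2_inner M (g s) z) integrable_on {a..b}"
      using h by blast
    show "(\<lambda>s. L2_dist M (g s) (step_process p m \<xi> s) * L2_norm M z) integrable_on {a..b}"
      using integrable_on_mult_left[OF e] by simp
    fix s assume s: "s \<in> {a..b}"
    have "L2_inner M (step_process p m \<xi> s) z - L2_inner M (g s) z
        = L2_inner M (\<lambda>w. step_process p m \<xi> s w - g s w) z"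
      using L2_inner_diff_left[OF L2_step_process[OF \<xi>] L2_continuous_onD[OF g s] z] by simp
    then show "norm (L2_inner M (step_process p m \<xi> s) z - L2_inner M (g s) z)
        \<le> L2_dist M (g s) (step_process p m \<xi> s) * L2_norm M z"
      using L2_Cauchy_Schwarz[OF L2_diff[OF L2_step_process[OF \<xi>] L2_continuous_onD[OF g s]] z]
      by (simp add: L2_dist_norm[symmetric] L2_dist_commute[of M "g s"])
  qed
  then show ?thesis using integral_unique[OF h] by simp
qed

lemma L2_step_time_integral:
  "\<forall>i<m. \<xi> i \<in> L2 M \<Longrightarrow> step_integral (\<lambda>t w. t) p m \<xi> \<in> L2 M"
  unfolding step_integral_eq by (intro L2_sum L2_scaleR) auto

text \<open>This trades the approximating sequences in the definition for an identity between inner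
  products, the form in which time integrals are estimated later.\<close>

lemma L2_integral_inner:
  assumes Y: "has_L2_integral M g a b Y" and g: "L2_continuous_on M {a..b} g" and z: "z \<in> L2 M"
  shows "((\<lambda>s. L2_inner M (g s) z) has_integral L2_inner M Y z) {a..b}"
proof -
  obtain p m \<xi> where p: "\<And>k. is_partition a b (p k) (m k)" and \<xi>: "\<And>k. \<forall>i<m k. \<xi> k i \<in> L2 M"
    and e: "\<And>k. (\<lambda>s. L2_dist M (g s) (step_process (p k) (m k) (\<xi> k) s)) integrable_on {a..b}"
    and lim: "(\<lambda>k. integral {a..b} (\<lambda>s. L2_dist M (g s) (step_process (p k) (m k) (\<xi> k) s))) \<longlonglongrightarrow> 0"
    and Ylim: "(\<lambda>k. L2_dist M (step_integral (\<lambda>t w. t) (p k) (m k) (\<xi> k)) Y) \<longlonglongrightarrow> 0"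
    using Y unfolding has_L2_integral_def by blast
  have YL: "Y \<in> L2 M" using Y by (simp add: has_L2_integral_def)
  have f: "(\<lambda>s. L2_inner M (g s) z) integrable_on {a..b}"
    by (intro integrable_continuous_interval L2_continuous_on_inner g L2_continuous_on_const z)
  have "(\<lambda>k. L2_inner M (step_integral (\<lambda>t w. t) (p k) (m k) (\<xi> k)) z) \<longlonglongrightarrow> integral {a..b} (\<lambda>s. L2_inner M (g s) z)"
  proof (rule metric_tendsto_imp_tendsto)
    show "(\<lambda>k. integral {a..b} (\<lambda>s. L2_dist M (g s) (step_process (p k) (m k) (\<xi> k) s)) * L2_norm M z) \<longlonglongrightarrow> 0"
      using lim by (auto intro!: tendsto_eq_intros)
    show "\<forall>\<^sub>F k in sequentially. dist (L2_inner M (step_integral (\<lambda>t w. t) (p k) (m k) (\<xi> k)) z) (integral {a..b} (\<lambda>s. L2_inner M (g s) z))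
       \<le> dist (integral {a..b} (\<lambda>s. L2_dist M (g s) (step_process (p k) (m k) (\<xi> k) s)) * L2_norm M z) 0"
      using step_time_integral_error[OF p \<xi> z g e]
      by (intro always_eventually) (simp add: dist_real_def order_trans[OF _ abs_ge_self])
  qed
  moreover have "(\<lambda>k. L2_inner M (step_integral (\<lambda>t w. t) (p k) (m k) (\<xi> k)) z) \<longlonglongrightarrow> L2_inner M Y z"
    by (rule L2_inner_tendsto[OF YL z]) (use Ylim z L2_step_time_integral[OF \<xi>] in auto)
  ultimately have "integral {a..b} (\<lambda>s. L2_inner M (g s) z) = L2_inner M Y z"
    by (rule LIMSEQ_unique)
  with integrable_integral[OF f] show ?thesis by simp
qed

text \<open>Riemann sums over [a, b] mix values from all times, so the limit is known only at the
  end; this is why adaptedness is asked at b for every \<open>g s\<close>.\<close>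

lemma (in brownian_basis) L2_integral_exists:
  assumes ab: "a \<le> b" "0 \<le> b" and g: "L2_continuous_on M {a..b} g"
    and ad: "\<And>s. s \<in> {a..b} \<Longrightarrow> g s \<in> L2_adapted M F b"
  shows "\<exists>Y\<in>L2_adapted M F b. has_L2_integral M g a b Y"
proof -
  define p where "p = uniform_partition a b"
  define \<xi> where "\<xi> = (\<lambda>k i. g (p k i))"
  define S where "S = (\<lambda>k. step_integral (\<lambda>t w. t) (p k) (Suc k) (\<xi> k))"
  define E where "E = (\<lambda>k. integral {a..b} (\<lambda>s. L2_dist M (g s) (step_process (p k) (Suc k) (\<xi> k) s)))"
  have P: "is_partition a b (p k) (Suc k)" for k unfolding p_def by (rule uniform_partition[OF ab(1)])
  have \<xi>A: "\<xi> k i \<in> L2_adapted M F b" if "i < Suc k" for k i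
    unfolding \<xi>_def using partition_bounds[OF P[of k], of i] that by (intro ad) auto
  have \<xi>L: "\<forall>i<Suc k. \<xi> k i \<in> L2 M" for k using adapted_L2[OF \<xi>A] by blast
  have SA: "S k \<in> L2_adapted M F b" for k
    unfolding S_def step_integral_eq by (intro adapted_sum adapted_scaleR \<xi>A) auto
  note e = L2_dist_step_integrable(1)[OF P g \<xi>L]
  have lim: "E \<longlonglongrightarrow> 0"
    using riemann_step_integral_tendsto(1)[OF ab(1) g] unfolding E_def p_def \<xi>_def .
  \<comment> \<open>The difference of two Riemann sums is tested against itself, and one factor of
    its norm is cancelled.\<close>
  have d: "L2_dist M (S i) (S j) \<le> E i + E j" for i j
  proof -
    let ?z = "\<lambda>w. S i w - S j w"
    have z: "?z \<in> L2 M" by (intro L2_diff adapted_L2[OF SA])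
    have "(L2_norm M ?z)\<^sup>2 = L2_inner M (S i) ?z - L2_inner M (S j) ?z"
      unfolding L2_norm_square using L2_inner_diff_left[OF adapted_L2[OF SA] adapted_L2[OF SA] z] .
    also have "\<dots> \<le> (E i + E j) * L2_norm M ?z"
      using step_time_integral_error[OF P \<xi>L z g e, of i] step_time_integral_error[OF P \<xi>L z g e, of j]
      unfolding S_def E_def by (simp add: distrib_right)
    finally have "L2_norm M ?z * L2_norm M ?z \<le> (E i + E j) * L2_norm M ?z"
      by (simp add: power2_eq_square)
    moreover have "0 \<le> E i" "0 \<le> E j" unfolding E_def by (auto intro!: integral_nonneg e)
    ultimately show ?thesis unfolding L2_dist_norm
      by (cases "L2_norm M ?z = 0") (auto simp: mult_le_cancel_right dest: order.strict_implies_order)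
  qed
  have cau: "\<exists>N. \<forall>i\<ge>N. \<forall>j\<ge>N. L2_dist M (S i) (S j) < \<epsilon>" if "0 < \<epsilon>" for \<epsilon>
  proof -
    obtain N where "\<forall>k\<ge>N. norm (E k - 0) < \<epsilon> / 2"
      using LIMSEQ_D[OF lim, of "\<epsilon> / 2"] \<open>0 < \<epsilon>\<close> by auto
    then have N: "E k < \<epsilon> / 2" if "k \<ge> N" for k using that by (auto simp: abs_less_iff)
    have "L2_dist M (S i) (S j) < \<epsilon>" if "i \<ge> N" "j \<ge> N" for i j
      using d[of i j] N[OF that(1)] N[OF that(2)] by linarith
    then show ?thesis by blast
  qed
  from L2_adapted_complete[OF ab(2) SA cau]
  obtain Y where Y: "Y \<in> L2_adapted M F b" "(\<lambda>k. L2_dist M (S k) Y) \<longlonglongrightarrow> 0" by blast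
  have "has_L2_integral M g a b Y"
    unfolding has_L2_integral_def
  proof (intro conjI exI)
    show "\<forall>s\<in>{a..b}. g s \<in> L2 M" using L2_continuous_onD[OF g] by blast
    show "Y \<in> L2 M" by (rule adapted_L2[OF Y(1)])
    show "\<forall>k. is_partition a b (p k) (Suc k)" using P by blast
    show "\<forall>k. \<forall>i<Suc k. \<xi> k i \<in> L2 M" using \<xi>L by blast
    show "\<forall>k. (\<lambda>s. L2_dist M (g s) (step_process (p k) (Suc k) (\<xi> k) s)) integrable_on {a..b}"
      using e by blast
    show "(\<lambda>k. integral {a..b} (\<lambda>s. L2_dist M (g s) (step_process (p k) (Suc k) (\<xi> k) s))) \<longlonglongrightarrow> 0"
      using lim by (simp add: E_def)
    show "(\<lambda>k. L2_dist M (step_integral (\<lambda>t w. t) (p k) (Suc k) (\<xi> k)) Y) \<longlonglongrightarrow> 0"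
      using Y(2) by (simp add: S_def)
  qed
  with Y(1) show ?thesis by blast
qed

text \<open>The error has terms linear in \<open>e\<close> and \<open>e'\<close>, while only the
  integrals of the squares are known to vanish. A weighted Young inequality trades each linear term
  for a small constant plus a large multiple of the square.\<close>

lemma integral_limit_of_square_errors:
  fixes f :: "real \<Rightarrow> real" and F :: "nat \<Rightarrow> real \<Rightarrow> real"
  assumes f: "f integrable_on {a..b}" and F: "\<And>k. (F k has_integral v k) {a..b}"
    and e: "\<And>k. (\<lambda>s. (e k s)\<^sup>2) integrable_on {a..b}" "(\<lambda>k. integral {a..b} (\<lambda>s. (e k s)\<^sup>2)) \<longlonglongrightarrow> 0"
    and e': "\<And>k. (\<lambda>s. (e' k s)\<^sup>2) integrable_on {a..b}" "(\<lambda>k. integral {a..b} (\<lambda>s. (e' k s)\<^sup>2)) \<longlonglongrightarrow> 0"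
    and nn: "\<And>k s. s \<in> {a..b} \<Longrightarrow> 0 \<le> e k s" "\<And>k s. s \<in> {a..b} \<Longrightarrow> 0 \<le> e' k s" and B: "0 < B" and ab: "a \<le> b"
    and bound: "\<And>k s. s \<in> {a..b} \<Longrightarrow> \<bar>F k s - f s\<bar> \<le> B * e k s + B * e' k s + e k s * e' k s"
  shows "v \<longlonglongrightarrow> integral {a..b} f"
proof (rule LIMSEQ_I)
  fix r :: real assume r: "0 < r"
  define E where "E = (\<lambda>k. integral {a..b} (\<lambda>s. (e k s)\<^sup>2) + integral {a..b} (\<lambda>s. (e' k s)\<^sup>2))"
  \<comment> \<open>The constants integrate to 2 B \<eta> (b - a) = r (b - a) / (2 (b - a + 1)) < r.
    In \<open>C\<close> below, the summand 1 pays for the product of the two errors.\<close>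
  define \<eta> where "\<eta> = r / (4 * B * (b - a + 1))"
  have \<eta>: "0 < \<eta>" using r B ab by (simp add: \<eta>_def)
  define C where "C = B / \<eta> + 1"
  have C: "0 < C" using B \<eta> by (simp add: C_def add_pos_pos)
  have err: "\<bar>v k - integral {a..b} f\<bar> \<le> 2 * B * \<eta> * (b - a) + C * E k" for k
  proof -
    \<comment> \<open>Young's inequality, obtained from (x - \<eta>)^2 + x \<eta> >= 0 multiplied by
      B / \<eta>.\<close>
    have lin: "B * x \<le> B * \<eta> + B / \<eta> * x\<^sup>2" if "0 \<le> x" for x
    proof -
      have "0 \<le> B / \<eta> * ((x - \<eta>)\<^sup>2 + x * \<eta>)"
        using B \<eta> that by simp
      also have "\<dots> = B / \<eta> * x\<^sup>2 - B * x + B * \<eta>"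
        using \<eta> by (simp add: power2_eq_square field_simps)
      finally show ?thesis by simp
    qed
    have pt: "norm (F k s - f s) \<le> 2 * B * \<eta> + C * ((e k s)\<^sup>2 + (e' k s)\<^sup>2)" if s: "s \<in> {a..b}" for s
    proof -
      have "2 * (e k s * e' k s) \<le> (e k s)\<^sup>2 + (e' k s)\<^sup>2"
        using sum_squares_bound[of "e k s" "e' k s"] by (simp add: mult.assoc)
      moreover have "0 \<le> e k s * e' k s" using nn s by simp
      ultimately show ?thesis
        using bound[OF s, of k] lin[OF nn(1)[OF s], of k] lin[OF nn(2)[OF s], of k]
        by (simp add: C_def algebra_simps)
    qed
    have h: "((\<lambda>s. 2 * B * \<eta> + C * ((e k s)\<^sup>2 + (e' k s)\<^sup>2)) has_integral (2 * B * \<eta> * (b - a) + C * E k)) {a..b}"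
      unfolding E_def
      using has_integral_add[OF has_integral_const_real[of "2 * B * \<eta>" a b]
         has_integral_mult_right[OF has_integral_add[OF integrable_integral[OF e(1)[of k]] integrable_integral[OF e'(1)[of k]]], of C]] ab
      by (simp add: mult.commute)
    have d: "((\<lambda>s. F k s - f s) has_integral (v k - integral {a..b} f)) {a..b}"
      by (rule has_integral_diff[OF F integrable_integral[OF f]])
    have "norm (integral {a..b} (\<lambda>s. F k s - f s)) \<le> integral {a..b} (\<lambda>s. 2 * B * \<eta> + C * ((e k s)\<^sup>2 + (e' k s)\<^sup>2))"
      by (rule integral_norm_bound_integral) (use h d pt in auto)
    then show ?thesis using integral_unique[OF h] integral_unique[OF d] by simp
  qed
  have "2 * B * \<eta> * (b - a) < r"
  proof -
    have "B * \<eta> = r / (4 * (b - a + 1))" using B by (simp add: \<eta>_def)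
    moreover have "2 * (r / (4 * D)) * x = r * (x / (2 * D))" for D x :: real
      by (simp add: field_simps)
    ultimately have "2 * B * \<eta> * (b - a) = r * ((b - a) / (2 * (b - a + 1)))"
      by (metis mult.assoc)
    also have "\<dots> < r * 1" using r ab by (intro mult_strict_left_mono) (auto simp: divide_less_eq)
    finally show ?thesis by simp
  qed
  moreover have "(\<lambda>k. C * E k) \<longlonglongrightarrow> 0"
    unfolding E_def using e(2) e'(2) by (auto intro!: tendsto_eq_intros)
  ultimately obtain N where N: "\<And>k. k \<ge> N \<Longrightarrow> \<bar>C * E k\<bar> < r - 2 * B * \<eta> * (b - a)"
    using LIMSEQ_D[of "\<lambda>k. C * E k" 0 "r - 2 * B * \<eta> * (b - a)"] by auto
  have "norm (v k - integral {a..b} f) < r" if "k \<ge> N" for k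
    using err[of k] N[OF that] by simp
  then show "\<exists>N. \<forall>k\<ge>N. norm (v k - integral {a..b} f) < r" by blast
qed

section \<open>The Ito integral: existence, pairing, splitting in time, linear images\<close>

context brownian_basis
begin

text \<open>The data of \<open>has_ito_integral\<close> without the limit \<open>Y\<close>, so that
  convergence of the step integrals can be derived from them instead of being assumed.\<close>

definition ito_approx ::
  "(real \<Rightarrow> 'w \<Rightarrow> 'b::euclidean_space) \<Rightarrow> real \<Rightarrow> real \<Rightarrow> (nat \<Rightarrow> nat \<Rightarrow> real) \<Rightarrow> (nat \<Rightarrow> nat) \<Rightarrow> (nat \<Rightarrow> nat \<Rightarrow> 'w \<Rightarrow> 'b) \<Rightarrow> bool"
  where "ito_approx g a b p m \<xi> \<longleftrightarrow>
    (\<forall>s\<in>{a..b}. g s \<in> L2 M) \<and>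
    (\<forall>k. is_partition a b (p k) (m k)) \<and>
    (\<forall>k. \<forall>i<m k. \<xi> k i \<in> L2_adapted M F (p k i)) \<and>
    (\<forall>k. (\<lambda>s. (L2_dist M (g s) (step_process (p k) (m k) (\<xi> k) s))\<^sup>2) integrable_on {a..b}) \<and>
    (\<lambda>k. integral {a..b} (\<lambda>s. (L2_dist M (g s) (step_process (p k) (m k) (\<xi> k) s))\<^sup>2)) \<longlonglongrightarrow> 0"

lemma has_ito_integral_approx:
  "has_ito_integral M F W g a b Y \<longleftrightarrow> Y \<in> L2 M \<and>
    (\<exists>p m \<xi>. ito_approx g a b p m \<xi> \<and> (\<lambda>k. L2_dist M (step_integral W (p k) (m k) (\<xi> k)) Y) \<longlonglongrightarrow> 0)"
  unfolding has_ito_integral_def ito_approx_def by blast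

lemma ito_approxD:
  assumes "ito_approx g a b p m \<xi>"
  shows "is_partition a b (p k) (m k)" "\<forall>i<m k. \<xi> k i \<in> L2_adapted M F (p k i)"
    "\<forall>i<m k. \<xi> k i \<in> L2 M"
    "(\<lambda>s. (L2_dist M (g s) (step_process (p k) (m k) (\<xi> k) s))\<^sup>2) integrable_on {a..b}"
    "(\<lambda>k. integral {a..b} (\<lambda>s. (L2_dist M (g s) (step_process (p k) (m k) (\<xi> k) s))\<^sup>2)) \<longlonglongrightarrow> 0"
    "s \<in> {a..b} \<Longrightarrow> g s \<in> L2 M"
  using assms adapted_L2[of "\<xi> k i" "p k i" for i] by (auto simp: ito_approx_def)

lemma step_ito_dist:
  assumes p: "is_partition a b p m" and r: "is_partition a b r l" and a: "0 \<le> a"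
    and \<xi>: "\<forall>i<m. \<xi> i \<in> L2_adapted M F (p i)"
    and \<eta>: "\<forall>j<l. \<eta> j \<in> L2_adapted M F (r j)"
  shows "((\<lambda>s. (L2_dist M (step_process p m \<xi> s) (step_process r l \<eta> s))\<^sup>2) has_integral
    (L2_dist M (step_integral W p m \<xi>) (step_integral W r l \<eta>))\<^sup>2) {a..b}"
proof -
  have sq: "(L2_dist M X Y)\<^sup>2 = L2_inner M X X - 2 * L2_inner M X Y + L2_inner M Y Y"
    if "X \<in> L2 M" "Y \<in> L2 M" for X Y
    using that unfolding L2_dist_norm L2_norm_square
    by (simp add: L2_inner_diff_left L2_inner_diff_right L2_diff L2_inner_commute[of M Y X])
  have SL: "step_process p m \<xi> s \<in> L2 M" "step_process r l \<eta> s \<in> L2 M" for s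
    using \<xi> \<eta> adapted_L2 by (auto intro!: L2_step_process)
  have IL: "step_integral W p m \<xi> \<in> L2 M" "step_integral W r l \<eta> \<in> L2 M"
    by (auto intro: adapted_L2[OF step_integral_adapted[OF p a \<xi>]] adapted_L2[OF step_integral_adapted[OF r a \<eta>]])
  show ?thesis
    unfolding sq[OF SL] sq[OF IL]
    by (intro has_integral_add has_integral_diff has_integral_mult_right step_ito_pairing p r a \<xi> \<eta>)
qed

text \<open>By the isometry, step integrals are as far apart as the step processes in L^2 of time
  and probability, and the latter all approach \<open>g\<close>.\<close>

lemma ito_approx_limit:
  assumes A: "ito_approx g a b p m \<xi>" and a: "0 \<le> a" "a \<le> b"
  shows "\<exists>Y\<in>L2_adapted M F b. (\<lambda>k. L2_dist M (step_integral W (p k) (m k) (\<xi> k)) Y) \<longlonglongrightarrow> 0"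
proof (rule L2_adapted_complete)
  note D = ito_approxD[OF A]
  show "0 \<le> b" using a by simp
  show "step_integral W (p k) (m k) (\<xi> k) \<in> L2_adapted M F b" for k
    by (rule step_integral_adapted[OF D(1) a(1) D(2)])
  fix \<epsilon> :: real assume \<epsilon>: "0 < \<epsilon>"
  define E where "E = (\<lambda>k. integral {a..b} (\<lambda>s. (L2_dist M (g s) (step_process (p k) (m k) (\<xi> k) s))\<^sup>2))"
  have "0 < \<epsilon>\<^sup>2 / 4" using \<epsilon> by simp
  \<comment> \<open>The squared distance will be bounded by 2 E i + 2 E j, hence the
    quarter.\<close>
  then obtain N where N: "\<And>k. k \<ge> N \<Longrightarrow> E k < \<epsilon>\<^sup>2 / 4"
    using LIMSEQ_D[OF D(5), of "\<epsilon>\<^sup>2 / 4"] unfolding E_def by force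
  have "L2_dist M (step_integral W (p i) (m i) (\<xi> i)) (step_integral W (p j) (m j) (\<xi> j)) < \<epsilon>"
    if ij: "i \<ge> N" "j \<ge> N" for i j
  proof -
    note h = step_ito_dist[OF D(1)[of i] D(1)[of j] a(1) D(2) D(2)]
    have "(L2_dist M (step_integral W (p i) (m i) (\<xi> i)) (step_integral W (p j) (m j) (\<xi> j)))\<^sup>2 \<le> 2 * E i + 2 * E j"
      unfolding E_def
    proof (rule has_integral_le[OF h])
      show "((\<lambda>s. 2 * (L2_dist M (g s) (step_process (p i) (m i) (\<xi> i) s))\<^sup>2 + 2 * (L2_dist M (g s) (step_process (p j) (m j) (\<xi> j) s))\<^sup>2)
        has_integral 2 * integral {a..b} (\<lambda>s. (L2_dist M (g s) (step_process (p i) (m i) (\<xi> i) s))\<^sup>2)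
          + 2 * integral {a..b} (\<lambda>s. (L2_dist M (g s) (step_process (p j) (m j) (\<xi> j) s))\<^sup>2)) {a..b}"
        by (intro has_integral_add has_integral_mult_right integrable_integral D)
      fix s assume s: "s \<in> {a..b}"
      have "L2_dist M (step_process (p i) (m i) (\<xi> i) s) (step_process (p j) (m j) (\<xi> j) s)
        \<le> L2_dist M (g s) (step_process (p i) (m i) (\<xi> i) s) + L2_dist M (g s) (step_process (p j) (m j) (\<xi> j) s)"
        using L2_dist_triangle[OF L2_step_process[OF D(3)] D(6)[OF s] L2_step_process[OF D(3)]]
        by (simp add: L2_dist_commute)
      then have "(L2_dist M (step_process (p i) (m i) (\<xi> i) s) (step_process (p j) (m j) (\<xi> j) s))\<^sup>2
        \<le> (L2_dist M (g s) (step_process (p i) (m i) (\<xi> i) s) + L2_dist M (g s) (step_process (p j) (m j) (\<xi> j) s))\<^sup>2"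
        by (intro power_mono) auto
      also have "\<dots> \<le> 2 * (L2_dist M (g s) (step_process (p i) (m i) (\<xi> i) s))\<^sup>2 + 2 * (L2_dist M (g s) (step_process (p j) (m j) (\<xi> j) s))\<^sup>2"
        using sum_squares_bound[of "L2_dist M (g s) (step_process (p i) (m i) (\<xi> i) s)" "L2_dist M (g s) (step_process (p j) (m j) (\<xi> j) s)"]
        by (simp add: power2_sum)
      finally show "(L2_dist M (step_process (p i) (m i) (\<xi> i) s) (step_process (p j) (m j) (\<xi> j) s))\<^sup>2
        \<le> 2 * (L2_dist M (g s) (step_process (p i) (m i) (\<xi> i) s))\<^sup>2 + 2 * (L2_dist M (g s) (step_process (p j) (m j) (\<xi> j) s))\<^sup>2" .
    qed
    also have "\<dots> < \<epsilon>\<^sup>2" using N[OF ij(1)] N[OF ij(2)] by simp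
    finally show ?thesis using \<epsilon> by (auto intro: power2_less_imp_less)
  qed
  then show "\<exists>N. \<forall>i\<ge>N. \<forall>j\<ge>N. L2_dist M (step_integral W (p i) (m i) (\<xi> i)) (step_integral W (p j) (m j) (\<xi> j)) < \<epsilon>"
    by blast
qed

text \<open>The Ito isometry in polarized form. The integrals come with unrelated partitions, and
  their k-th step integrals are paired directly. Uniqueness, and compatibility with differences, are
  obtained later by expanding squares with this identity.\<close>

lemma ito_integral_pairing:
  assumes Y: "has_ito_integral M F W g a b Y" and Z: "has_ito_integral M F W h a b Z"
    and g: "L2_continuous_on M {a..b} g" and h: "L2_continuous_on M {a..b} h" and a: "0 \<le> a" "a \<le> b"
  shows "((\<lambda>s. L2_inner M (g s) (h s)) has_integral L2_inner M Y Z) {a..b}"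
proof -
  obtain p m \<xi> where A: "ito_approx g a b p m \<xi>"
    and Ylim: "(\<lambda>k. L2_dist M (step_integral W (p k) (m k) (\<xi> k)) Y) \<longlonglongrightarrow> 0"
    using Y unfolding has_ito_integral_approx by blast
  obtain r l \<eta> where A': "ito_approx h a b r l \<eta>"
    and Zlim: "(\<lambda>k. L2_dist M (step_integral W (r k) (l k) (\<eta> k)) Z) \<longlonglongrightarrow> 0"
    using Z unfolding has_ito_integral_approx by blast
  note D = ito_approxD[OF A] and D' = ito_approxD[OF A']
  have YL: "Y \<in> L2 M" "Z \<in> L2 M" using Y Z by (auto simp: has_ito_integral_def)
  obtain B1 where B1: "0 < B1" "\<And>s. s \<in> {a..b} \<Longrightarrow> L2_norm M (g s) \<le> B1"
    using L2_continuous_on_bounded[OF g] by blast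
  obtain B2 where B2: "0 < B2" "\<And>s. s \<in> {a..b} \<Longrightarrow> L2_norm M (h s) \<le> B2"
    using L2_continuous_on_bounded[OF h] by blast
  define B where "B = max B1 B2"
  have f: "(\<lambda>s. L2_inner M (g s) (h s)) integrable_on {a..b}"
    by (intro integrable_continuous_interval L2_continuous_on_inner g h)
  have "(\<lambda>k. L2_inner M (step_integral W (p k) (m k) (\<xi> k)) (step_integral W (r k) (l k) (\<eta> k)))
      \<longlonglongrightarrow> integral {a..b} (\<lambda>s. L2_inner M (g s) (h s))"
  proof (rule integral_limit_of_square_errors[OF f _ D(4,5) D'(4,5)])
    show "((\<lambda>s. L2_inner M (step_process (p k) (m k) (\<xi> k) s) (step_process (r k) (l k) (\<eta> k) s)) has_integral
        L2_inner M (step_integral W (p k) (m k) (\<xi> k)) (step_integral W (r k) (l k) (\<eta> k))) {a..b}" for k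
      by (rule step_ito_pairing[OF D(1) D'(1) a(1) D(2) D'(2)])
    show "0 < B" using B1 by (simp add: B_def)
    fix k s assume s: "s \<in> {a..b}"
    let ?x = "L2_dist M (g s) (step_process (p k) (m k) (\<xi> k) s)"
    let ?y = "L2_dist M (h s) (step_process (r k) (l k) (\<eta> k) s)"
    have "\<bar>L2_inner M (step_process (p k) (m k) (\<xi> k) s) (step_process (r k) (l k) (\<eta> k) s) - L2_inner M (g s) (h s)\<bar>
      \<le> ?x * L2_norm M (h s) + L2_norm M (g s) * ?y + ?x * ?y"
      using L2_dist_inner_le[OF D(6)[OF s] L2_step_process[OF D(3)] D'(6)[OF s] L2_step_process[OF D'(3)]]
      by (simp add: L2_dist_commute)
    also have "\<dots> \<le> B * ?x + B * ?y + ?x * ?y"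
      using mult_left_mono[of "L2_norm M (h s)" B ?x] mult_right_mono[of "L2_norm M (g s)" B ?y]
        B1(2)[OF s] B2(2)[OF s] by (simp add: B_def mult.commute le_max_iff_disj)
    finally show "\<bar>L2_inner M (step_process (p k) (m k) (\<xi> k) s) (step_process (r k) (l k) (\<eta> k) s) - L2_inner M (g s) (h s)\<bar>
      \<le> B * ?x + B * ?y + ?x * ?y" .
  qed (use a in auto)
  moreover have "(\<lambda>k. L2_inner M (step_integral W (p k) (m k) (\<xi> k)) (step_integral W (r k) (l k) (\<eta> k))) \<longlonglongrightarrow> L2_inner M Y Z"
    using adapted_L2[OF step_integral_adapted[OF D(1) a(1) D(2)]]
      adapted_L2[OF step_integral_adapted[OF D'(1) a(1) D'(2)]]
    by (intro L2_inner_tendsto YL Ylim Zlim always_eventually allI) auto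
  ultimately have "integral {a..b} (\<lambda>s. L2_inner M (g s) (h s)) = L2_inner M Y Z"
    by (rule LIMSEQ_unique)
  with integrable_integral[OF f] show ?thesis by simp
qed

lemma ito_integral_past:
  assumes Y: "has_ito_integral M F W g a b Y" and a: "0 \<le> a" and \<zeta>: "\<zeta> \<in> L2_adapted M F a"
  shows "L2_inner M Y \<zeta> = 0"
proof -
  obtain p m \<xi> where A: "ito_approx g a b p m \<xi>"
    and Ylim: "(\<lambda>k. L2_dist M (step_integral W (p k) (m k) (\<xi> k)) Y) \<longlonglongrightarrow> 0"
    using Y unfolding has_ito_integral_approx by blast
  note D = ito_approxD[OF A]
  have YL: "Y \<in> L2 M" using Y by (auto simp: has_ito_integral_def)
  have "(\<lambda>k. L2_inner M (step_integral W (p k) (m k) (\<xi> k)) \<zeta>) \<longlonglongrightarrow> L2_inner M Y \<zeta>"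
    using adapted_L2[OF step_integral_adapted[OF D(1) a(1) D(2)]] adapted_L2[OF \<zeta>]
    by (intro L2_inner_tendsto YL Ylim always_eventually allI) auto
  moreover have "L2_inner M (step_integral W (p k) (m k) (\<xi> k)) \<zeta> = 0" for k
    by (rule step_ito_past[OF D(1) a D(2) \<zeta>])
  ultimately show ?thesis by (simp add: LIMSEQ_const_iff)
qed

text \<open>Moving the partition points before b to b collapses the cells that lie before b to empty
  ones; values stay adapted because points only move to later times.\<close>

lemma ito_approx_upper:
  assumes A: "ito_approx g a c p m \<xi>" and ab: "0 \<le> a" "a \<le> b" "b \<le> c"
  shows "ito_approx g b c (\<lambda>k i. max b (p k i)) m \<xi>"
proof -
  note D = ito_approxD[OF A]
  have eq: "step_process (\<lambda>i. max b (p k i)) (m k) (\<xi> k) s = step_process (p k) (m k) (\<xi> k) s" if "s \<in> {b..c}" for k s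
    using that unfolding step_process_def by (intro ext sum.cong refl) (auto simp: indicator_def)
  have int: "(\<lambda>s. (L2_dist M (g s) (step_process (p k) (m k) (\<xi> k) s))\<^sup>2) integrable_on {b..c}" for k
    by (rule integrable_subinterval_real[OF D(4)]) (use ab in auto)
  have bnd: "integral {b..c} (\<lambda>s. (L2_dist M (g s) (step_process (p k) (m k) (\<xi> k) s))\<^sup>2)
    \<le> integral {a..c} (\<lambda>s. (L2_dist M (g s) (step_process (p k) (m k) (\<xi> k) s))\<^sup>2)" for k
    by (rule integral_subset_le[OF _ int D(4)]) (use ab in auto)
  have "(\<lambda>k. integral {b..c} (\<lambda>s. (L2_dist M (g s) (step_process (p k) (m k) (\<xi> k) s))\<^sup>2)) \<longlonglongrightarrow> 0"
    by (rule tendsto_sandwich[OF _ _ tendsto_const D(5)]) (auto intro!: always_eventually integral_nonneg int bnd)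
  moreover have "is_partition b c (\<lambda>i. max b (p k i)) (m k)" for k
    using D(1)[of k] ab by (auto simp: is_partition_def max_def)
  moreover have "\<xi> k i \<in> L2_adapted M F (max b (p k i))" if "i < m k" for k i
    using adapted_mono[OF D(2)[rule_format, OF that]] partition_bounds[OF D(1)[of k], of i] that ab by auto
  moreover have "(\<lambda>s. (L2_dist M (g s) (step_process (\<lambda>i. max b (p k i)) (m k) (\<xi> k) s))\<^sup>2) integrable_on {b..c}" for k
    by (rule integrable_eq[OF int[of k]]) (simp add: eq)
  moreover have "integral {b..c} (\<lambda>s. (L2_dist M (g s) (step_process (\<lambda>i. max b (p k i)) (m k) (\<xi> k) s))\<^sup>2)
    = integral {b..c} (\<lambda>s. (L2_dist M (g s) (step_process (p k) (m k) (\<xi> k) s))\<^sup>2)" for k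
    by (rule Henstock_Kurzweil_Integration.integral_cong) (simp add: eq)
  ultimately show ?thesis
    unfolding ito_approx_def using D(6) ab by auto
qed

text \<open>Here points move to earlier times, so a value attached to a point after b would lose
  adaptedness; it sits on an empty cell and is replaced by 0. The two step processes can differ only
  at b, which does not affect the integrals.\<close>

lemma ito_approx_lower:
  assumes A: "ito_approx g a c p m \<xi>" and ab: "0 \<le> a" "a \<le> b" "b \<le> c"
  shows "ito_approx g a b (\<lambda>k i. min b (p k i)) m (\<lambda>k i w. if p k i \<le> b then \<xi> k i w else 0)"
proof -
  note D = ito_approxD[OF A]
  define \<xi>' where "\<xi>' = (\<lambda>k i w. if p k i \<le> b then \<xi> k i w else 0)"
  have eq: "step_process (\<lambda>i. min b (p k i)) (m k) (\<xi>' k) s = step_process (p k) (m k) (\<xi> k) s"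
    if "s \<in> {a..b} - {b}" for k s
    using that unfolding step_process_def \<xi>'_def by (intro ext sum.cong refl) (auto simp: indicator_def)
  have int: "(\<lambda>s. (L2_dist M (g s) (step_process (p k) (m k) (\<xi> k) s))\<^sup>2) integrable_on {a..b}" for k
    by (rule integrable_subinterval_real[OF D(4)]) (use ab in auto)
  have bnd: "integral {a..b} (\<lambda>s. (L2_dist M (g s) (step_process (p k) (m k) (\<xi> k) s))\<^sup>2)
    \<le> integral {a..c} (\<lambda>s. (L2_dist M (g s) (step_process (p k) (m k) (\<xi> k) s))\<^sup>2)" for k
    by (rule integral_subset_le[OF _ int D(4)]) (use ab in auto)
  have lim: "(\<lambda>k. integral {a..b} (\<lambda>s. (L2_dist M (g s) (step_process (p k) (m k) (\<xi> k) s))\<^sup>2)) \<longlonglongrightarrow> 0"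
    by (rule tendsto_sandwich[OF _ _ tendsto_const D(5)]) (auto intro!: always_eventually integral_nonneg int bnd)
  have int': "(\<lambda>s. (L2_dist M (g s) (step_process (\<lambda>i. min b (p k i)) (m k) (\<xi>' k) s))\<^sup>2) integrable_on {a..b}" for k
    by (rule integrable_spike_finite[of "{b}", OF _ _ int[of k]]) (use eq in auto)
  have ieq: "integral {a..b} (\<lambda>s. (L2_dist M (g s) (step_process (\<lambda>i. min b (p k i)) (m k) (\<xi>' k) s))\<^sup>2)
    = integral {a..b} (\<lambda>s. (L2_dist M (g s) (step_process (p k) (m k) (\<xi> k) s))\<^sup>2)" for k
    by (rule integral_spike[of "{b}"]) (use eq in auto)
  have "is_partition a b (\<lambda>i. min b (p k i)) (m k)" for k
    using D(1)[of k] ab by (auto simp: is_partition_def min_def)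
  moreover have "\<xi>' k i \<in> L2_adapted M F (min b (p k i))" if "i < m k" for k i
    using D(2)[rule_format, OF that] by (cases "p k i \<le> b") (simp_all add: \<xi>'_def min_def)
  ultimately show ?thesis
    unfolding ito_approx_def using D(6) ab int' lim ieq unfolding \<xi>'_def by auto
qed

text \<open>Both halves use the same approximating sequence, clamped at b from either side, so each
  step integral is exactly the sum of its halves. Completeness gives the limit on [b, c], and the
  limit on [a, b] is then the difference.\<close>

lemma ito_integral_split:
  assumes Y: "has_ito_integral M F W g a c Y" and ab: "0 \<le> a" "a \<le> b" "b \<le> c"
  shows "\<exists>Z. has_ito_integral M F W g b c Z \<and> has_ito_integral M F W g a b (\<lambda>w. Y w - Z w)"
proof -
  obtain p m \<xi> where A: "ito_approx g a c p m \<xi>"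
    and Ylim: "(\<lambda>k. L2_dist M (step_integral W (p k) (m k) (\<xi> k)) Y) \<longlonglongrightarrow> 0"
    using Y unfolding has_ito_integral_approx by blast
  have YL: "Y \<in> L2 M" using Y by (auto simp: has_ito_integral_def)
  define U where "U = (\<lambda>k. step_integral W (\<lambda>i. max b (p k i)) (m k) (\<xi> k))"
  define V where "V = (\<lambda>k. step_integral W (\<lambda>i. min b (p k i)) (m k) (\<lambda>i w. if p k i \<le> b then \<xi> k i w else 0))"
  note A1 = ito_approx_upper[OF A ab] and A2 = ito_approx_lower[OF A ab]
  note D = ito_approxD[OF A] and D1 = ito_approxD[OF A1] and D2 = ito_approxD[OF A2]
  have L: "step_integral W (p k) (m k) (\<xi> k) \<in> L2 M" "U k \<in> L2 M" "V k \<in> L2 M" for k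
    unfolding U_def V_def using ab
    by (auto intro!: adapted_L2[OF step_integral_adapted] D D1 D2)
  obtain Z where Z: "Z \<in> L2_adapted M F c" "(\<lambda>k. L2_dist M (U k) Z) \<longlonglongrightarrow> 0"
    using ito_approx_limit[OF A1] ab unfolding U_def by auto
  have ZL: "Z \<in> L2 M" by (rule adapted_L2[OF Z(1)])
  have sum: "step_integral W (p k) (m k) (\<xi> k) = (\<lambda>w. U k w + V k w)" for k
  proof
    fix w
    show "step_integral W (p k) (m k) (\<xi> k) w = U k w + V k w"
      unfolding U_def V_def step_integral_def sum.distrib[symmetric]
    proof (rule sum.cong[OF refl])
      fix i assume "i \<in> {..<m k}"
      then have "p k i \<le> p k (Suc i)" using partition_step[OF D(1)] by simp
      then show "(W (p k (Suc i)) w - W (p k i) w) *\<^sub>R \<xi> k i w =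
        (W (max b (p k (Suc i))) w - W (max b (p k i)) w) *\<^sub>R \<xi> k i w +
        (W (min b (p k (Suc i))) w - W (min b (p k i)) w) *\<^sub>R (if p k i \<le> b then \<xi> k i w else 0)"
        by (auto simp: max_def min_def algebra_simps)
    qed
  qed
  have Vlim: "(\<lambda>k. L2_dist M (V k) (\<lambda>w. Y w - Z w)) \<longlonglongrightarrow> 0"
  proof (rule tendsto_sandwich[OF _ _ tendsto_const])
    show "(\<lambda>k. L2_dist M (step_integral W (p k) (m k) (\<xi> k)) Y + L2_dist M (U k) Z) \<longlonglongrightarrow> 0"
      using Ylim Z(2) by (auto intro!: tendsto_eq_intros)
    have "L2_dist M (V k) (\<lambda>w. Y w - Z w) \<le> L2_dist M (step_integral W (p k) (m k) (\<xi> k)) Y + L2_dist M (U k) Z" for k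
    proof -
      have "L2_dist M (V k) (\<lambda>w. Y w - Z w) = L2_norm M (\<lambda>w. (step_integral W (p k) (m k) (\<xi> k) w - Y w) + (Z w - U k w))"
        by (simp add: L2_dist_norm sum algebra_simps)
      also have "\<dots> \<le> L2_norm M (\<lambda>w. step_integral W (p k) (m k) (\<xi> k) w - Y w) + L2_norm M (\<lambda>w. Z w - U k w)"
        by (intro L2_norm_triangle L2_diff L YL ZL)
      finally show ?thesis by (simp add: L2_dist_norm[symmetric] L2_dist_commute[of M Z])
    qed
    then show "\<forall>\<^sub>F k in sequentially. L2_dist M (V k) (\<lambda>w. Y w - Z w) \<le> L2_dist M (step_integral W (p k) (m k) (\<xi> k)) Y + L2_dist M (U k) Z"
      by simp
  qed simp
  have "has_ito_integral M F W g b c Z"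
    unfolding has_ito_integral_approx using A1 Z(2) ZL unfolding U_def by blast
  moreover have "has_ito_integral M F W g a b (\<lambda>w. Y w - Z w)"
    unfolding has_ito_integral_approx using A2 Vlim L2_diff[OF YL ZL] unfolding V_def by blast
  ultimately show ?thesis by blast
qed

lemma ito_integral_exists:
  assumes ab: "0 \<le> a" "a \<le> b" and g: "L2_continuous_on M {a..b} g"
    and ad: "\<And>s. s \<in> {a..b} \<Longrightarrow> g s \<in> L2_adapted M F s"
  shows "\<exists>Y\<in>L2_adapted M F b. has_ito_integral M F W g a b Y"
proof -
  define p where "p = uniform_partition a b"
  have P: "is_partition a b (p k) (Suc k)" for k unfolding p_def by (rule uniform_partition[OF ab(2)])
  have \<xi>A: "\<forall>i<Suc k. g (p k i) \<in> L2_adapted M F (p k i)" for k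
    using partition_bounds[OF P[of k]] by (auto intro!: ad)
  then have \<xi>L: "\<forall>i<Suc k. g (p k i) \<in> L2 M" for k using adapted_L2 by blast
  have A: "ito_approx g a b p Suc (\<lambda>k i. g (p k i))"
    unfolding ito_approx_def
    using L2_continuous_onD[OF g] P \<xi>A L2_dist_step_integrable(2)[OF P g \<xi>L]
      riemann_step_integral_tendsto(2)[OF ab(2) g, folded p_def] by auto
  from ito_approx_limit[OF A ab] obtain Y where Y: "Y \<in> L2_adapted M F b"
    "(\<lambda>k. L2_dist M (step_integral W (p k) (Suc k) (\<lambda>i. g (p k i))) Y) \<longlonglongrightarrow> 0" by blast
  then have "has_ito_integral M F W g a b Y"
    unfolding has_ito_integral_approx using A adapted_L2[OF Y(1)] by blast
  with Y(1) show ?thesis by blast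
qed

lemma ito_integral_linear:
  assumes T: "bounded_linear T" and Y: "has_ito_integral M F W g a b Y"
    and g: "L2_continuous_on M {a..b} g" and a: "0 \<le> a"
  shows "has_ito_integral M F W (\<lambda>s w. T (g s w)) a b (\<lambda>w. T (Y w))"
proof -
  interpret T: bounded_linear T by fact
  obtain C where C: "0 \<le> C" "\<And>x. norm (T x) \<le> C * norm x"
    using T.nonneg_bounded by (metis mult.commute)
  have dT: "L2_dist M (\<lambda>w. T (X w)) (\<lambda>w. T (Z w)) \<le> C * L2_dist M X Z" if "X \<in> L2 M" "Z \<in> L2 M" for X Z
    using L2_norm_linear[OF T C(2,1) L2_diff[OF that]] by (simp add: L2_dist_norm T.diff)
  obtain p m \<xi> where A: "ito_approx g a b p m \<xi>"
    and Ylim: "(\<lambda>k. L2_dist M (step_integral W (p k) (m k) (\<xi> k)) Y) \<longlonglongrightarrow> 0"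
    using Y unfolding has_ito_integral_approx by blast
  note D = ito_approxD[OF A]
  have YL: "Y \<in> L2 M" using Y by (auto simp: has_ito_integral_def)
  define \<xi>' where "\<xi>' = (\<lambda>k i w. T (\<xi> k i w))"
  have \<xi>'A: "\<xi>' k i \<in> L2_adapted M F (p k i)" if "i < m k" for k i
    unfolding \<xi>'_def by (rule adapted_linear[OF T D(2)[rule_format, OF that]])
  have sp: "step_process (p k) (m k) (\<xi>' k) s = (\<lambda>w. T (step_process (p k) (m k) (\<xi> k) s w))" for k s
    by (simp add: step_process_def \<xi>'_def fun_eq_iff T.sum T.scaleR)
  have si: "step_integral W (p k) (m k) (\<xi>' k) = (\<lambda>w. T (step_integral W (p k) (m k) (\<xi> k) w))" for k
    by (simp add: step_integral_def \<xi>'_def fun_eq_iff T.sum T.scaleR)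
  note gT = L2_continuous_on_linear[OF T g]
  have int: "(\<lambda>s. (L2_dist M (\<lambda>w. T (g s w)) (step_process (p k) (m k) (\<xi>' k) s))\<^sup>2) integrable_on {a..b}" for k
    by (rule L2_dist_step_integrable(2)[OF D(1) gT]) (use \<xi>'A adapted_L2 in blast)
  have "(\<lambda>k. integral {a..b} (\<lambda>s. (L2_dist M (\<lambda>w. T (g s w)) (step_process (p k) (m k) (\<xi>' k) s))\<^sup>2)) \<longlonglongrightarrow> 0"
  proof (rule tendsto_sandwich[OF _ _ tendsto_const])
    show "(\<lambda>k. C\<^sup>2 * integral {a..b} (\<lambda>s. (L2_dist M (g s) (step_process (p k) (m k) (\<xi> k) s))\<^sup>2)) \<longlonglongrightarrow> 0"
      using D(5) by (auto intro!: tendsto_eq_intros)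
    have "integral {a..b} (\<lambda>s. (L2_dist M (\<lambda>w. T (g s w)) (step_process (p k) (m k) (\<xi>' k) s))\<^sup>2)
      \<le> C\<^sup>2 * integral {a..b} (\<lambda>s. (L2_dist M (g s) (step_process (p k) (m k) (\<xi> k) s))\<^sup>2)" for k
    proof (rule has_integral_le[OF integrable_integral[OF int] has_integral_mult_right[OF integrable_integral[OF D(4)]]])
      fix s assume "s \<in> {a..b}"
      then have "L2_dist M (\<lambda>w. T (g s w)) (step_process (p k) (m k) (\<xi>' k) s) \<le> C * L2_dist M (g s) (step_process (p k) (m k) (\<xi> k) s)"
        unfolding sp by (intro dT D(6) L2_step_process D(3)) auto
      then have "(L2_dist M (\<lambda>w. T (g s w)) (step_process (p k) (m k) (\<xi>' k) s))\<^sup>2 \<le> (C * L2_dist M (g s) (step_process (p k) (m k) (\<xi> k) s))\<^sup>2"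
        by (rule power_mono) simp
      then show "(L2_dist M (\<lambda>w. T (g s w)) (step_process (p k) (m k) (\<xi>' k) s))\<^sup>2 \<le> C\<^sup>2 * (L2_dist M (g s) (step_process (p k) (m k) (\<xi> k) s))\<^sup>2"
        by (simp add: power_mult_distrib)
    qed
    then show "\<forall>\<^sub>F k in sequentially. integral {a..b} (\<lambda>s. (L2_dist M (\<lambda>w. T (g s w)) (step_process (p k) (m k) (\<xi>' k) s))\<^sup>2)
      \<le> C\<^sup>2 * integral {a..b} (\<lambda>s. (L2_dist M (g s) (step_process (p k) (m k) (\<xi> k) s))\<^sup>2)" by simp
  qed (auto intro!: always_eventually integral_nonneg int)
  then have "ito_approx (\<lambda>s w. T (g s w)) a b p m \<xi>'"
    unfolding ito_approx_def using D(1) \<xi>'A int L2_continuous_onD[OF gT] by auto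
  moreover have "(\<lambda>k. L2_dist M (step_integral W (p k) (m k) (\<xi>' k)) (\<lambda>w. T (Y w))) \<longlonglongrightarrow> 0"
  proof (rule tendsto_sandwich[OF _ _ tendsto_const])
    show "(\<lambda>k. C * L2_dist M (step_integral W (p k) (m k) (\<xi> k)) Y) \<longlonglongrightarrow> 0"
      using Ylim by (auto intro!: tendsto_eq_intros)
    show "\<forall>\<^sub>F k in sequentially. L2_dist M (step_integral W (p k) (m k) (\<xi>' k)) (\<lambda>w. T (Y w)) \<le> C * L2_dist M (step_integral W (p k) (m k) (\<xi> k)) Y"
      unfolding si by (intro always_eventually allI dT adapted_L2[OF step_integral_adapted[OF D(1) a D(2)]] YL)
  qed simp
  ultimately show ?thesis unfolding has_ito_integral_approx using L2_linear[OF T YL] by blast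
qed

end

section \<open>Ito processes\<close>

text \<open>The Bochner integral is kept only through its inner products. This is stable under
  differences, linear maps and restriction in time without handling approximating sequences, and
  norm bounds follow by duality.\<close>

definition weak_integral ::
  "'w measure \<Rightarrow> (real \<Rightarrow> 'w \<Rightarrow> 'b::euclidean_space) \<Rightarrow> real \<Rightarrow> real \<Rightarrow> ('w \<Rightarrow> 'b) \<Rightarrow> bool" where
  "weak_integral M g a b Y \<longleftrightarrow> Y \<in> L2 M \<and>
     (\<forall>z\<in>L2 M. L2_inner M Y z = integral {a..b} (\<lambda>s. L2_inner M (g s) z))"

lemma weak_integralD:
  assumes "weak_integral M g a b Y"
  shows "Y \<in> L2 M" "z \<in> L2 M \<Longrightarrow> L2_inner M Y z = integral {a..b} (\<lambda>s. L2_inner M (g s) z)"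
  using assms by (auto simp: weak_integral_def)

lemma has_L2_integral_weak:
  assumes "has_L2_integral M g a b Y" "L2_continuous_on M {a..b} g"
  shows "weak_integral M g a b Y"
  unfolding weak_integral_def
  using integral_unique[OF L2_integral_inner[OF assms]] assms(1) by (auto simp: has_L2_integral_def)

lemma L2_inner_const_integrable:
  "L2_continuous_on M {a..b} g \<Longrightarrow> z \<in> L2 M \<Longrightarrow> (\<lambda>s. L2_inner M (g s) z) integrable_on {a..b}"
  by (intro integrable_continuous_interval L2_continuous_on_inner L2_continuous_on_const)

lemma weak_integral_diff:
  assumes "weak_integral M g a b Y" "weak_integral M h a b Z"
    "L2_continuous_on M {a..b} g" "L2_continuous_on M {a..b} h"
  shows "weak_integral M (\<lambda>s w. g s w - h s w) a b (\<lambda>w. Y w - Z w)"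
  unfolding weak_integral_def
proof (intro conjI ballI)
  note YZ = weak_integralD(1)[OF assms(1)] weak_integralD(1)[OF assms(2)]
  show "(\<lambda>w. Y w - Z w) \<in> L2 M" by (rule L2_diff[OF YZ])
  fix z :: "'a \<Rightarrow> 'b" assume z: "z \<in> L2 M"
  have "L2_inner M (\<lambda>w. Y w - Z w) z = integral {a..b} (\<lambda>s. L2_inner M (g s) z - L2_inner M (h s) z)"
    using z YZ assms by (simp add: L2_inner_diff_left weak_integral_def integral_diff L2_inner_const_integrable)
  also have "\<dots> = integral {a..b} (\<lambda>s. L2_inner M (\<lambda>w. g s w - h s w) z)"
    by (rule Henstock_Kurzweil_Integration.integral_cong)
      (use z assms(3,4) in \<open>simp add: L2_inner_diff_left L2_continuous_onD\<close>)
  finally show "L2_inner M (\<lambda>w. Y w - Z w) z = integral {a..b} (\<lambda>s. L2_inner M (\<lambda>w. g s w - h s w) z)" .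
qed

lemma weak_integral_increment:
  assumes "weak_integral M g a c Y" "weak_integral M g a b Z" "L2_continuous_on M {a..c} g" "a \<le> b" "b \<le> c"
  shows "weak_integral M g b c (\<lambda>w. Y w - Z w)"
  unfolding weak_integral_def
proof (intro conjI ballI)
  note YZ = weak_integralD(1)[OF assms(1)] weak_integralD(1)[OF assms(2)]
  show "(\<lambda>w. Y w - Z w) \<in> L2 M" by (rule L2_diff[OF YZ])
  fix z :: "'a \<Rightarrow> 'b" assume z: "z \<in> L2 M"
  show "L2_inner M (\<lambda>w. Y w - Z w) z = integral {b..c} (\<lambda>s. L2_inner M (g s) z)"
    using Henstock_Kurzweil_Integration.integral_combine[OF assms(4,5) L2_inner_const_integrable[OF assms(3) z]]
      z YZ assms(1,2) by (simp add: L2_inner_diff_left weak_integral_def)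
qed

text \<open>The map is moved onto the test variable as its adjoint.\<close>

lemma weak_integral_linear:
  assumes T: "bounded_linear T" and Y: "weak_integral M g a b Y"
  shows "weak_integral M (\<lambda>s w. T (g s w)) a b (\<lambda>w. T (Y w))"
  unfolding weak_integral_def
proof (intro conjI ballI)
  show "(\<lambda>w. T (Y w)) \<in> L2 M" by (rule L2_linear[OF T weak_integralD(1)[OF Y]])
  fix z :: "'c \<Rightarrow> 'b" assume z: "z \<in> L2 M"
  note l = bounded_linear.linear[OF T]
  have a: "L2_inner M (\<lambda>w. T (X w)) z = L2_inner M X (\<lambda>w. adjoint T (z w))" for X
    unfolding L2_inner_def by (simp add: adjoint_works[OF l])
  have "(\<lambda>w. adjoint T (z w)) \<in> L2 M"
    using L2_linear[OF _ z] linear_conv_bounded_linear adjoint_linear[OF l] by blast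
  then show "L2_inner M (\<lambda>w. T (Y w)) z = integral {a..b} (\<lambda>s. L2_inner M (\<lambda>w. T (g s w)) z)"
    unfolding a using Y by (simp add: weak_integral_def)
qed

text \<open>Duality: the integral is tested against itself and one factor of its norm is
  cancelled.\<close>

lemma weak_integral_norm:
  assumes Y: "weak_integral M g a b Y" and g: "L2_continuous_on M {a..b} g" and "a \<le> b"
    and B: "\<And>s. s \<in> {a..b} \<Longrightarrow> L2_norm M (g s) \<le> B" "0 \<le> B"
  shows "L2_norm M Y \<le> B * (b - a)"
proof -
  note YL = weak_integralD(1)[OF Y]
  have "L2_norm M Y * L2_norm M Y = integral {a..b} (\<lambda>s. L2_inner M (g s) Y)"
    using weak_integralD(2)[OF Y YL] by (simp add: L2_norm_square flip: power2_eq_square)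
  also have "\<dots> \<le> B * L2_norm M Y * (b - a)"
  proof (rule has_integral_le[OF integrable_integral[OF L2_inner_const_integrable[OF g YL]]])
    show "((\<lambda>s. B * L2_norm M Y) has_integral B * L2_norm M Y * (b - a)) {a..b}"
      using has_integral_const_real[of "B * L2_norm M Y" a b] \<open>a \<le> b\<close> by (simp add: mult.commute)
    fix s assume s: "s \<in> {a..b}"
    have "L2_inner M (g s) Y \<le> L2_norm M (g s) * L2_norm M Y"
      using L2_Cauchy_Schwarz[OF L2_continuous_onD[OF g s] YL] by simp
    also have "\<dots> \<le> B * L2_norm M Y" by (intro mult_right_mono B s) simp
    finally show "L2_inner M (g s) Y \<le> B * L2_norm M Y" .
  qed
  finally have "L2_norm M Y * L2_norm M Y \<le> B * (b - a) * L2_norm M Y" by (simp add: mult_ac)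
  then show ?thesis
    using L2_norm_nonneg[of M Y] B \<open>a \<le> b\<close> by (cases "L2_norm M Y = 0") (auto simp: mult_le_cancel_right)
qed

text \<open>Cauchy-Schwarz in time, by testing against \<open>Y\<close> and applying Young's
  inequality with weight b - a; half of the squared norm of \<open>Y\<close> is absorbed on the
  left.\<close>

lemma weak_integral_square:
  assumes Y: "weak_integral M g a b Y" and g: "L2_continuous_on M {a..b} g" and "a \<le> b"
  shows "(L2_norm M Y)\<^sup>2 \<le> (b - a) * integral {a..b} (\<lambda>s. (L2_norm M (g s))\<^sup>2)"
proof (cases "a = b")
  case True
  then show ?thesis
    using weak_integralD(2)[OF Y weak_integralD(1)[OF Y]] by (simp add: L2_norm_square)
next
  case False
  with \<open>a \<le> b\<close> have l: "0 < b - a" by simp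
  note YL = weak_integralD(1)[OF Y]
  have i: "(\<lambda>s. (L2_norm M (g s))\<^sup>2) integrable_on {a..b}"
    by (intro integrable_continuous_interval L2_continuous_on_norm_square g)
  let ?y = "L2_norm M Y"
  have "?y\<^sup>2 = integral {a..b} (\<lambda>s. L2_inner M (g s) Y)"
    using weak_integralD(2)[OF Y YL] by (simp add: L2_norm_square)
  also have "\<dots> \<le> (b - a) / 2 * integral {a..b} (\<lambda>s. (L2_norm M (g s))\<^sup>2) + ?y\<^sup>2 / (2 * (b - a)) * (b - a)"
  proof (rule has_integral_le[OF integrable_integral[OF L2_inner_const_integrable[OF g YL]]])
    show "((\<lambda>s. (b - a) / 2 * (L2_norm M (g s))\<^sup>2 + ?y\<^sup>2 / (2 * (b - a))) has_integral
      (b - a) / 2 * integral {a..b} (\<lambda>s. (L2_norm M (g s))\<^sup>2) + ?y\<^sup>2 / (2 * (b - a)) * (b - a)) {a..b}"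
      using has_integral_add[OF has_integral_mult_right[OF integrable_integral[OF i], of "(b - a) / 2"]
          has_integral_const_real[of "?y\<^sup>2 / (2 * (b - a))" a b]] \<open>a \<le> b\<close> by (simp add: mult.commute)
    fix s assume s: "s \<in> {a..b}"
    let ?x = "L2_norm M (g s)"
    have "0 \<le> ((b - a) * ?x - ?y)\<^sup>2 / (2 * (b - a))" using l by simp
    also have "\<dots> = (b - a) / 2 * ?x\<^sup>2 + ?y\<^sup>2 / (2 * (b - a)) - ?x * ?y"
      using l by (simp add: power2_eq_square field_simps)
    finally show "L2_inner M (g s) Y \<le> (b - a) / 2 * ?x\<^sup>2 + ?y\<^sup>2 / (2 * (b - a))"
      using L2_Cauchy_Schwarz[OF L2_continuous_onD[OF g s] YL] by simp
  qed
  also have "?y\<^sup>2 / (2 * (b - a)) * (b - a) = ?y\<^sup>2 / 2" using l by (simp add: field_simps)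
  finally show ?thesis by simp
qed

text \<open>Increments that are uniformly o(t - s) add up to nothing over fine uniform partitions.
  This takes the place of differentiation in the proof of the product rule.\<close>

lemma telescoping_error_zero:
  fixes \<psi> :: "real \<Rightarrow> real"
  assumes ab: "a \<le> b"
    and loc: "\<And>\<epsilon>. 0 < \<epsilon> \<Longrightarrow> \<exists>d>0. \<forall>s t. a \<le> s \<and> s \<le> t \<and> t \<le> b \<and> t - s < d \<longrightarrow> \<bar>\<psi> t - \<psi> s\<bar> \<le> \<epsilon> * (t - s)"
  shows "\<psi> b = \<psi> a"
proof -
  have bnd: "\<bar>\<psi> b - \<psi> a\<bar> \<le> \<epsilon> * (b - a)" if "0 < \<epsilon>" for \<epsilon>
  proof -
    obtain d where d: "0 < d" "\<And>s t. a \<le> s \<Longrightarrow> s \<le> t \<Longrightarrow> t \<le> b \<Longrightarrow> t - s < d \<Longrightarrow> \<bar>\<psi> t - \<psi> s\<bar> \<le> \<epsilon> * (t - s)"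
      using loc[OF \<open>0 < \<epsilon>\<close>] by blast
    obtain k where "(b - a) / d < real k" using reals_Archimedean2 by blast
    then have "(b - a) / d < real (Suc k)" by simp
    then have k: "(b - a) / real (Suc k) < d" using d(1) by (simp add: field_simps)
    let ?p = "uniform_partition a b k"
    note P = uniform_partition[OF ab, of k]
    have e: "?p 0 = a" "?p (Suc k) = b" using P by (auto simp: is_partition_def)
    have "\<psi> b - \<psi> a = (\<Sum>i<Suc k. \<psi> (?p (Suc i)) - \<psi> (?p i))"
      using sum_lessThan_telescope[of "\<lambda>i. \<psi> (?p i)" "Suc k"] e by simp
    also have "\<bar>\<dots>\<bar> \<le> (\<Sum>i<Suc k. \<epsilon> * (?p (Suc i) - ?p i))"
    proof (rule order_trans[OF sum_abs sum_mono])
      fix i assume "i \<in> {..<Suc k}"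
      then show "\<bar>\<psi> (?p (Suc i)) - \<psi> (?p i)\<bar> \<le> \<epsilon> * (?p (Suc i) - ?p i)"
        using partition_bounds[OF P, of i] partition_bounds[OF P, of "Suc i"] partition_step[OF P, of i] k
        by (intro d(2)) (auto simp: uniform_partition_step)
    qed
    also have "\<dots> = \<epsilon> * (b - a)"
      using sum_lessThan_telescope[of ?p "Suc k"] e by (simp flip: sum_distrib_left)
    finally show ?thesis .
  qed
  have "\<bar>\<psi> b - \<psi> a\<bar> \<le> e" if "0 < e" for e
  proof -
    have p: "0 < b - a + 1" using ab by simp
    have "\<bar>\<psi> b - \<psi> a\<bar> \<le> e / (b - a + 1) * (b - a)"
      using bnd[of "e / (b - a + 1)"] that p by simp
    also have "\<dots> \<le> e / (b - a + 1) * (b - a + 1)"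
      using that p by (intro mult_left_mono) auto
    also have "\<dots> = e" using p by simp
    finally show ?thesis .
  qed
  then have "\<bar>\<psi> b - \<psi> a\<bar> \<le> 0" by (rule field_le_epsilon[of _ 0, simplified])
  then show ?thesis by simp
qed

text \<open>The maximum of \<phi>(t) exp(-l t) acts as a weighted sup norm: integrating the inverse
  weight gains a factor 1 / l, so the integral inequality contracts once l is large.\<close>

lemma gronwall_zero:
  fixes \<phi> :: "real \<Rightarrow> real"
  assumes c: "continuous_on {a..b} \<phi>" and nn: "\<And>t. t \<in> {a..b} \<Longrightarrow> 0 \<le> \<phi> t"
    and le: "\<And>t. t \<in> {a..b} \<Longrightarrow> \<phi> t \<le> C * integral {a..t} \<phi>" and t: "t \<in> {a..b}"
  shows "\<phi> t = 0"
proof -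
  \<comment> \<open>This choice makes (\<open>\<bar>C\<bar> + 1\<close>) / l equal to 1/2, whatever
    the sign of \<open>C\<close>.\<close>
  define l where "l = 2 * (\<bar>C\<bar> + 1)"
  have l: "0 < l" by (simp add: l_def)
  have "continuous_on {a..b} (\<lambda>t. \<phi> t * exp (- l * t))" by (intro continuous_intros c)
  then obtain m where m: "m \<in> {a..b}" "\<And>t. t \<in> {a..b} \<Longrightarrow> \<phi> t * exp (- l * t) \<le> \<phi> m * exp (- l * m)"
    using continuous_attains_sup[of "{a..b}" "\<lambda>t. \<phi> t * exp (- l * t)"] t by auto
  define S where "S = \<phi> m * exp (- l * m)"
  have S0: "0 \<le> S" using nn[OF m(1)] by (simp add: S_def)
  have bnd: "\<phi> r \<le> S * exp (l * r)" if "r \<in> {a..b}" for r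
    using mult_right_mono[OF m(2)[OF that, folded S_def], of "exp (l * r)"]
    by (simp add: mult.assoc flip: exp_add)
  have i: "\<phi> integrable_on {a..m}"
    by (intro integrable_continuous_interval continuous_on_subset[OF c]) (use m in auto)
  have "((\<lambda>r. S * exp (l * r)) has_integral S * exp (l * m) / l - S * exp (l * a) / l) {a..m}"
    by (rule fundamental_theorem_of_calculus)
      (use m l in \<open>auto intro!: derivative_eq_intros simp flip: has_real_derivative_iff_has_vector_derivative\<close>)
  from has_integral_le[OF integrable_integral[OF i] this]
  have "integral {a..m} \<phi> \<le> S * exp (l * m) / l - S * exp (l * a) / l" using bnd m by auto
  also have "\<dots> \<le> S * exp (l * m) / l" using S0 l by simp
  finally have ub: "integral {a..m} \<phi> \<le> S * exp (l * m) / l" .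
  have "0 \<le> integral {a..m} \<phi>" by (rule integral_nonneg[OF i]) (use nn m in auto)
  then have "C * integral {a..m} \<phi> \<le> (\<bar>C\<bar> + 1) * integral {a..m} \<phi>"
    by (intro mult_right_mono) simp_all
  with le[OF m(1)] have "\<phi> m \<le> (\<bar>C\<bar> + 1) * integral {a..m} \<phi>" by (rule order_trans)
  also have "\<dots> \<le> (\<bar>C\<bar> + 1) * (S * exp (l * m) / l)" by (intro mult_left_mono ub) simp
  also have "\<dots> = S * exp (l * m) / 2" by (simp add: l_def field_simps)
  finally have "S \<le> S * exp (l * m) / 2 * exp (- l * m)"
    using mult_right_mono[of "\<phi> m" "S * exp (l * m) / 2" "exp (- l * m)"] by (simp only: S_def) simp
  then have "S \<le> S / 2" by (simp add: mult.assoc flip: exp_add)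
  then have "S = 0" using S0 by simp
  then show ?thesis using bnd[OF t] nn[OF t] by simp
qed

section \<open>Increments, differences and mean square continuity of Ito processes\<close>

context brownian_basis
begin

lemma ito_integral_L2: "has_ito_integral M F W g a b Y \<Longrightarrow> Y \<in> L2 M"
  by (simp add: has_ito_integral_def)

lemma ito_integral_isometry:
  assumes "has_ito_integral M F W g a b Y" "has_ito_integral M F W h a b Z"
    "L2_continuous_on M {a..b} g" "L2_continuous_on M {a..b} h" "0 \<le> a" "a \<le> b"
  shows "((\<lambda>s. (L2_norm M (\<lambda>w. g s w - h s w))\<^sup>2) has_integral (L2_norm M (\<lambda>w. Y w - Z w))\<^sup>2) {a..b}"
proof -
  have sq: "(L2_norm M (\<lambda>w. X w - X' w))\<^sup>2 = L2_inner M X X - 2 * L2_inner M X X' + L2_inner M X' X'"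
    if "X \<in> L2 M" "X' \<in> L2 M" for X X'
    using that unfolding L2_norm_square
    by (simp add: L2_inner_diff_left L2_inner_diff_right L2_diff L2_inner_commute[of M X' X])
  note YZ = ito_integral_L2[OF assms(1)] ito_integral_L2[OF assms(2)]
  have "((\<lambda>s. L2_inner M (g s) (g s) - 2 * L2_inner M (g s) (h s) + L2_inner M (h s) (h s)) has_integral
    (L2_norm M (\<lambda>w. Y w - Z w))\<^sup>2) {a..b}"
    unfolding sq[OF YZ]
    by (intro has_integral_add has_integral_diff has_integral_mult_right ito_integral_pairing assms)
  then show ?thesis
    by (rule has_integral_eq[rotated]) (simp add: sq L2_continuous_onD[OF assms(3)] L2_continuous_onD[OF assms(4)])
qed

lemma ito_integral_unique:
  assumes "has_ito_integral M F W g a b Y" "has_ito_integral M F W g a b Z"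
    "L2_continuous_on M {a..b} g" "0 \<le> a" "a \<le> b"
  shows "AE w in M. Y w = Z w"
proof -
  note YZ = ito_integral_L2[OF assms(1)] ito_integral_L2[OF assms(2)]
  have "((\<lambda>s. 0) has_integral (L2_norm M (\<lambda>w. Y w - Z w))\<^sup>2) {a..b}"
    using ito_integral_isometry[OF assms(1,2,3,3,4,5)] by simp
  then have "L2_norm M (\<lambda>w. Y w - Z w) = 0"
    using has_integral_unique[OF _ has_integral_0] by auto
  then show ?thesis using L2_norm_eq_0_iff[OF L2_diff[OF YZ]] by simp
qed

text \<open>The equation is imposed on every [s, t], so that restarting at a later time is
  immediate. The drift is needed only weakly, while the noise keeps its Ito integral for
  orthogonality to the past. Mean square continuity of \<open>X\<close> is a consequence.\<close>

definition ito_process ::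
  "real \<Rightarrow> (real \<Rightarrow> 'w \<Rightarrow> 'b::euclidean_space) \<Rightarrow> (real \<Rightarrow> 'w \<Rightarrow> 'b) \<Rightarrow> (real \<Rightarrow> 'w \<Rightarrow> 'b) \<Rightarrow> bool"
  where "ito_process a X \<beta> \<sigma> \<longleftrightarrow> 0 \<le> a \<and> (\<forall>t\<ge>a. X t \<in> L2_adapted M F t) \<and>
    L2_continuous_on M {a..} \<beta> \<and> L2_continuous_on M {a..} \<sigma> \<and>
    (\<forall>s\<ge>a. \<forall>t\<ge>s. \<exists>Y Z. weak_integral M \<beta> s t Y \<and> has_ito_integral M F W \<sigma> s t Z \<and>
       (AE w in M. X t w = X s w + Y w + Z w))"

lemma ito_processD:
  assumes "ito_process a X \<beta> \<sigma>"
  shows "0 \<le> a" "a \<le> t \<Longrightarrow> X t \<in> L2_adapted M F t" "a \<le> t \<Longrightarrow> X t \<in> L2 M"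
    "a \<le> s \<Longrightarrow> L2_continuous_on M {s..t} \<beta>" "a \<le> s \<Longrightarrow> L2_continuous_on M {s..t} \<sigma>"
  using assms
  by (auto simp: ito_process_def intro: adapted_L2 L2_continuous_on_subset[of M "{a..}"])

lemma ito_process_increment:
  assumes "ito_process a X \<beta> \<sigma>" "a \<le> s" "s \<le> t"
  obtains Y Z where "weak_integral M \<beta> s t Y" "has_ito_integral M F W \<sigma> s t Z"
    "AE w in M. X t w = X s w + Y w + Z w"
  using assms unfolding ito_process_def by blast

lemma ito_process_restrict: "ito_process a X \<beta> \<sigma> \<Longrightarrow> a \<le> b \<Longrightarrow> ito_process b X \<beta> \<sigma>"
  unfolding ito_process_def
  by (auto intro: L2_continuous_on_subset[of M "{a..}"])

text \<open>The equations at s and t are subtracted. Splitting the noise integral at s leaves two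
  candidates for its part on [a, s], and uniqueness of the Ito integral identifies them.\<close>

lemma ito_processI:
  assumes a: "0 \<le> a" and X: "\<And>t. a \<le> t \<Longrightarrow> X t \<in> L2_adapted M F t"
    and \<beta>: "L2_continuous_on M {a..} \<beta>" and \<sigma>: "L2_continuous_on M {a..} \<sigma>"
    and eq: "\<And>t. a \<le> t \<Longrightarrow> \<exists>Y Z. has_L2_integral M \<beta> a t Y \<and> has_ito_integral M F W \<sigma> a t Z \<and>
       (AE w in M. X t w = x0 w + Y w + Z w)"
  shows "ito_process a X \<beta> \<sigma>" "AE w in M. X a w = x0 w"
proof -
  have c: "L2_continuous_on M {s..t} \<beta>" "L2_continuous_on M {s..t} \<sigma>" if "a \<le> s" for s t
    using that by (auto intro: L2_continuous_on_subset[OF \<beta>] L2_continuous_on_subset[OF \<sigma>])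
  show "ito_process a X \<beta> \<sigma>"
    unfolding ito_process_def
  proof (intro conjI allI impI a X \<beta> \<sigma>)
    fix s t assume st: "a \<le> s" "s \<le> t"
    obtain Y Z where YZ: "has_L2_integral M \<beta> a t Y" "has_ito_integral M F W \<sigma> a t Z"
      "AE w in M. X t w = x0 w + Y w + Z w" using eq[of t] st by auto
    obtain Y' Z' where YZ': "has_L2_integral M \<beta> a s Y'" "has_ito_integral M F W \<sigma> a s Z'"
      "AE w in M. X s w = x0 w + Y' w + Z' w" using eq[of s] st by auto
    obtain V where V: "has_ito_integral M F W \<sigma> s t V" "has_ito_integral M F W \<sigma> a s (\<lambda>w. Z w - V w)"
      using ito_integral_split[OF YZ(2) a st] by blast
    have "weak_integral M \<beta> s t (\<lambda>w. Y w - Y' w)"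
      using st by (intro weak_integral_increment[OF has_L2_integral_weak[OF YZ(1)] has_L2_integral_weak[OF YZ'(1)]] c) auto
    moreover have "AE w in M. X t w = X s w + (Y w - Y' w) + V w"
      using YZ(3) YZ'(3) ito_integral_unique[OF YZ'(2) V(2) c(2) a st(1)]
      by (auto elim!: eventually_elim2 AE_mp)
    ultimately show "\<exists>Y Z. weak_integral M \<beta> s t Y \<and> has_ito_integral M F W \<sigma> s t Z \<and>
       (AE w in M. X t w = X s w + Y w + Z w)" using V(1) by blast
  qed
  \<comment> \<open>Over the degenerate interval [a, a] both integrals have norm 0, which recovers
    the initial value from the equation at t = a.\<close>
  obtain Y Z where YZ: "has_L2_integral M \<beta> a a Y" "has_ito_integral M F W \<sigma> a a Z"
      "AE w in M. X a w = x0 w + Y w + Z w" using eq[of a] by auto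
  have YL: "Y \<in> L2 M" "Z \<in> L2 M" using YZ by (auto simp: has_L2_integral_def has_ito_integral_def)
  have "L2_norm M Y = 0"
    using weak_integralD(2)[OF has_L2_integral_weak[OF YZ(1) c(1)] YL(1)] by (simp flip: L2_norm_square)
  moreover have "((\<lambda>s. L2_inner M (\<sigma> s) (\<sigma> s)) has_integral L2_inner M Z Z) {a}"
    using ito_integral_pairing[OF YZ(2,2) c(2) c(2) a] by simp
  from has_integral_unique[OF this has_integral_refl(2)] have "L2_norm M Z = 0"
    by (simp flip: L2_norm_square)
  ultimately show "AE w in M. X a w = x0 w"
    using YZ(3) L2_norm_eq_0_iff[OF YL(1)] L2_norm_eq_0_iff[OF YL(2)]
    by (auto elim!: AE_mp)
qed

lemma ito_process_linear:
  assumes T: "bounded_linear T" and X: "ito_process a X \<beta> \<sigma>"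
  shows "ito_process a (\<lambda>t w. T (X t w)) (\<lambda>t w. T (\<beta> t w)) (\<lambda>t w. T (\<sigma> t w))"
  unfolding ito_process_def
proof (intro conjI allI impI)
  note D = ito_processD[OF X]
  show "0 \<le> a" by (rule D)
  show "L2_continuous_on M {a..} (\<lambda>t w. T (\<beta> t w))" "L2_continuous_on M {a..} (\<lambda>t w. T (\<sigma> t w))"
    using X by (auto simp: ito_process_def intro: L2_continuous_on_linear[OF T])
  show "(\<lambda>w. T (X t w)) \<in> L2_adapted M F t" if "a \<le> t" for t by (rule adapted_linear[OF T D(2)[OF that]])
  fix s t assume st: "a \<le> s" "s \<le> t"
  obtain Y Z where "weak_integral M \<beta> s t Y" "has_ito_integral M F W \<sigma> s t Z"
    "AE w in M. X t w = X s w + Y w + Z w" using ito_process_increment[OF X st] .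
  then show "\<exists>Y Z. weak_integral M (\<lambda>t w. T (\<beta> t w)) s t Y \<and> has_ito_integral M F W (\<lambda>t w. T (\<sigma> t w)) s t Z \<and>
    (AE w in M. T (X t w) = T (X s w) + Y w + Z w)"
    using st D(1) D(5)[OF st(1)]
    by (intro exI[of _ "\<lambda>w. T (Y w)"] exI[of _ "\<lambda>w. T (Z w)"] conjI)
      (auto simp: linear_simps[OF T] intro: weak_integral_linear[OF T] ito_integral_linear[OF T] elim!: AE_mp)
qed

text \<open>The given noise integrals may rest on different partitions, so their approximations are
  not subtracted. Instead an integral \<open>V\<close> of the difference is produced by existence,
  which is where adaptedness of the coefficients enters, and the squared norm of
  \<open>V - (Z - Z')\<close> is expanded by the pairing into the integral of 0.\<close>

lemma ito_process_diff:
  assumes X: "ito_process a X \<beta> \<sigma>" and X': "ito_process a X' \<beta>' \<sigma>'"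
    and ad: "\<And>s. a \<le> s \<Longrightarrow> \<sigma> s \<in> L2_adapted M F s" "\<And>s. a \<le> s \<Longrightarrow> \<sigma>' s \<in> L2_adapted M F s"
  shows "ito_process a (\<lambda>t w. X t w - X' t w) (\<lambda>t w. \<beta> t w - \<beta>' t w) (\<lambda>t w. \<sigma> t w - \<sigma>' t w)"
  unfolding ito_process_def
proof (intro conjI allI impI)
  note D = ito_processD[OF X] and D' = ito_processD[OF X']
  show "0 \<le> a" by (rule D)
  show "L2_continuous_on M {a..} (\<lambda>t w. \<beta> t w - \<beta>' t w)" "L2_continuous_on M {a..} (\<lambda>t w. \<sigma> t w - \<sigma>' t w)"
    using X X' by (auto simp: ito_process_def intro: L2_continuous_on_diff)
  show "(\<lambda>w. X t w - X' t w) \<in> L2_adapted M F t" if "a \<le> t" for t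
    by (rule adapted_diff[OF D(2)[OF that] D'(2)[OF that]])
  fix s t assume st: "a \<le> s" "s \<le> t"
  obtain Y Z where YZ: "weak_integral M \<beta> s t Y" "has_ito_integral M F W \<sigma> s t Z"
    "AE w in M. X t w = X s w + Y w + Z w" using ito_process_increment[OF X st] .
  obtain Y' Z' where YZ': "weak_integral M \<beta>' s t Y'" "has_ito_integral M F W \<sigma>' s t Z'"
    "AE w in M. X' t w = X' s w + Y' w + Z' w" using ito_process_increment[OF X' st] .
  note cs = D(5)[OF st(1), of t] D'(5)[OF st(1), of t]
  have s0: "0 \<le> s" using st D(1) by simp
  obtain V where V: "has_ito_integral M F W (\<lambda>t w. \<sigma> t w - \<sigma>' t w) s t V"
    using ito_integral_exists[OF s0 st(2) L2_continuous_on_diff[OF cs]] adapted_diff[OF ad] st by auto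
  note L = ito_integral_L2[OF YZ(2)] ito_integral_L2[OF YZ'(2)] ito_integral_L2[OF V]
  note pr = ito_integral_pairing[OF _ _ _ _ s0 st(2)]
  note cd = L2_continuous_on_diff[OF cs]
  have "(\<lambda>w. V w - (Z w - Z' w)) \<in> L2 M" by (intro L2_diff L)
  moreover have "(L2_norm M (\<lambda>w. V w - (Z w - Z' w)))\<^sup>2 = 0"
  proof -
    have e: "(L2_norm M (\<lambda>w. V w - (Z w - Z' w)))\<^sup>2 = L2_inner M V V - 2 * L2_inner M V Z + 2 * L2_inner M V Z'
      + L2_inner M Z Z - 2 * L2_inner M Z Z' + L2_inner M Z' Z'"
      unfolding L2_norm_square using L
      by (simp add: L2_inner_diff_left L2_inner_diff_right L2_diff L2_inner_commute[of M Z V] L2_inner_commute[of M Z' V]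
          L2_inner_commute[of M Z' Z])
    have int: "((\<lambda>r. L2_inner M (\<lambda>w. \<sigma> r w - \<sigma>' r w) (\<lambda>w. \<sigma> r w - \<sigma>' r w) - 2 * L2_inner M (\<lambda>w. \<sigma> r w - \<sigma>' r w) (\<sigma> r)
        + 2 * L2_inner M (\<lambda>w. \<sigma> r w - \<sigma>' r w) (\<sigma>' r)
      + L2_inner M (\<sigma> r) (\<sigma> r) - 2 * L2_inner M (\<sigma> r) (\<sigma>' r) + L2_inner M (\<sigma>' r) (\<sigma>' r)) has_integral
      (L2_inner M V V - 2 * L2_inner M V Z + 2 * L2_inner M V Z'
      + L2_inner M Z Z - 2 * L2_inner M Z Z' + L2_inner M Z' Z')) {s..t}"
      by (intro has_integral_add has_integral_diff has_integral_mult_right pr V YZ YZ' cs cd)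
    have zero: "L2_inner M (\<lambda>w. \<sigma> r w - \<sigma>' r w) (\<lambda>w. \<sigma> r w - \<sigma>' r w) - 2 * L2_inner M (\<lambda>w. \<sigma> r w - \<sigma>' r w) (\<sigma> r)
        + 2 * L2_inner M (\<lambda>w. \<sigma> r w - \<sigma>' r w) (\<sigma>' r)
      + L2_inner M (\<sigma> r) (\<sigma> r) - 2 * L2_inner M (\<sigma> r) (\<sigma>' r) + L2_inner M (\<sigma>' r) (\<sigma>' r) = 0" if "r \<in> {s..t}" for r
      using L2_continuous_onD[OF cs(1) that] L2_continuous_onD[OF cs(2) that]
      by (simp add: L2_inner_diff_left L2_inner_diff_right L2_diff L2_inner_commute[of M "\<sigma>' r" "\<sigma> r"])
    have "((\<lambda>r. 0) has_integral
      (L2_inner M V V - 2 * L2_inner M V Z + 2 * L2_inner M V Z'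
      + L2_inner M Z Z - 2 * L2_inner M Z Z' + L2_inner M Z' Z')) {s..t}"
      by (rule has_integral_eq[OF zero int])
    from has_integral_unique[OF this has_integral_0] show ?thesis unfolding e .
  qed
  ultimately have "AE w in M. V w - (Z w - Z' w) = 0" using L2_norm_eq_0_iff by fastforce
  then have "AE w in M. X t w - X' t w = X s w - X' s w + (Y w - Y' w) + V w"
    using YZ(3) YZ'(3) by eventually_elim (simp add: algebra_simps)
  moreover have "weak_integral M (\<lambda>t w. \<beta> t w - \<beta>' t w) s t (\<lambda>w. Y w - Y' w)"
    by (intro weak_integral_diff YZ YZ' D D' st)
  ultimately show "\<exists>Y Z. weak_integral M (\<lambda>t w. \<beta> t w - \<beta>' t w) s t Y \<and>
     has_ito_integral M F W (\<lambda>t w. \<sigma> t w - \<sigma>' t w) s t Z \<and>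
     (AE w in M. X t w - X' t w = X s w - X' s w + Y w + Z w)"
    using V by blast
qed

text \<open>Without adaptedness of the integrands no Ito integral of the difference is claimed.
  Estimates need only the norm of the noise part, and this follows from polarization.\<close>

lemma ito_process_diff_increment:
  assumes X: "ito_process a X \<beta> \<sigma>" and X': "ito_process a X' \<beta>' \<sigma>'" and st: "a \<le> s" "s \<le> t"
  obtains Y Z where "weak_integral M (\<lambda>r w. \<beta> r w - \<beta>' r w) s t Y" "Z \<in> L2 M"
    "((\<lambda>r. (L2_norm M (\<lambda>w. \<sigma> r w - \<sigma>' r w))\<^sup>2) has_integral (L2_norm M Z)\<^sup>2) {s..t}"
    "AE w in M. X t w - X' t w - (X s w - X' s w) = Y w + Z w"
proof -
  note D = ito_processD[OF X] and D' = ito_processD[OF X']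
  obtain Y Z where YZ: "weak_integral M \<beta> s t Y" "has_ito_integral M F W \<sigma> s t Z"
    "AE w in M. X t w = X s w + Y w + Z w" using ito_process_increment[OF X st] .
  obtain Y' Z' where YZ': "weak_integral M \<beta>' s t Y'" "has_ito_integral M F W \<sigma>' s t Z'"
    "AE w in M. X' t w = X' s w + Y' w + Z' w" using ito_process_increment[OF X' st] .
  have s0: "0 \<le> s" using st D(1) by simp
  show ?thesis
  proof (rule that)
    show "weak_integral M (\<lambda>t w. \<beta> t w - \<beta>' t w) s t (\<lambda>w. Y w - Y' w)"
      by (intro weak_integral_diff YZ YZ' D D' st)
    show "(\<lambda>w. Z w - Z' w) \<in> L2 M" by (intro L2_diff ito_integral_L2[OF YZ(2)] ito_integral_L2[OF YZ'(2)])
    show "((\<lambda>r. (L2_norm M (\<lambda>w. \<sigma> r w - \<sigma>' r w))\<^sup>2) has_integral (L2_norm M (\<lambda>w. Z w - Z' w))\<^sup>2) {s..t}"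
      by (intro ito_integral_isometry YZ YZ' D D' st s0)
    show "AE w in M. X t w - X' t w - (X s w - X' s w) = (Y w - Y' w) + (Z w - Z' w)"
      using YZ(3) YZ'(3) by eventually_elim (simp add: algebra_simps)
  qed
qed

text \<open>The drift contributes in proportion to the elapsed time and the noise, through the
  isometry, in proportion to its square root.\<close>

lemma ito_process_diff_bound:
  assumes X: "ito_process a X \<beta> \<sigma>" and X': "ito_process a X' \<beta>' \<sigma>'" and st: "a \<le> s" "s \<le> t"
    and P: "\<And>r. r \<in> {s..t} \<Longrightarrow> L2_norm M (\<lambda>w. \<beta> r w - \<beta>' r w) \<le> P" "0 \<le> P"
    and Q: "\<And>r. r \<in> {s..t} \<Longrightarrow> L2_norm M (\<lambda>w. \<sigma> r w - \<sigma>' r w) \<le> Q" "0 \<le> Q"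
  shows "L2_norm M (\<lambda>w. X t w - X' t w - (X s w - X' s w)) \<le> P * (t - s) + Q * sqrt (t - s)"
proof -
  note D = ito_processD[OF X] and D' = ito_processD[OF X']
  obtain Y Z where YZ: "weak_integral M (\<lambda>r w. \<beta> r w - \<beta>' r w) s t Y" "Z \<in> L2 M"
    "((\<lambda>r. (L2_norm M (\<lambda>w. \<sigma> r w - \<sigma>' r w))\<^sup>2) has_integral (L2_norm M Z)\<^sup>2) {s..t}"
    "AE w in M. X t w - X' t w - (X s w - X' s w) = Y w + Z w"
    using ito_process_diff_increment[OF X X' st] .
  have L: "(\<lambda>w. X t w - X' t w - (X s w - X' s w)) \<in> L2 M" by (intro L2_diff D D') (use st in auto)
  have YL: "Y \<in> L2 M" by (rule weak_integralD(1)[OF YZ(1)])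
  have y: "L2_norm M Y \<le> P * (t - s)"
    by (rule weak_integral_norm[OF YZ(1) L2_continuous_on_diff[OF D(4) D'(4)] st(2) P]) (use st in auto)
  have "((\<lambda>r. Q\<^sup>2) has_integral Q\<^sup>2 * (t - s)) {s..t}"
    using has_integral_const_real[of "Q\<^sup>2" s t] st by (simp add: mult.commute)
  from has_integral_le[OF YZ(3) this] have "(L2_norm M Z)\<^sup>2 \<le> Q\<^sup>2 * (t - s)"
    using Q(1) by (simp add: power_mono)
  also have "\<dots> = (Q * sqrt (t - s))\<^sup>2" using st by (simp add: power_mult_distrib)
  finally have z: "L2_norm M Z \<le> Q * sqrt (t - s)" by (rule power2_le_imp_le) (use Q st in simp)
  have "L2_norm M (\<lambda>w. X t w - X' t w - (X s w - X' s w)) = L2_norm M (\<lambda>w. Y w + Z w)"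
    by (rule L2_norm_cong_AE[OF YZ(4) L L2_add[OF YL YZ(2)]])
  also have "\<dots> \<le> L2_norm M Y + L2_norm M Z" by (rule L2_norm_triangle[OF YL YZ(2)])
  finally show ?thesis using y z by simp
qed

lemma ito_process_diff_square:
  assumes X: "ito_process a X \<beta> \<sigma>" and X': "ito_process a X' \<beta>' \<sigma>'" and st: "a \<le> s" "s \<le> t"
    and init: "AE w in M. X s w = X' s w"
  shows "(L2_norm M (\<lambda>w. X t w - X' t w))\<^sup>2 \<le>
    2 * (t - s) * integral {s..t} (\<lambda>r. (L2_norm M (\<lambda>w. \<beta> r w - \<beta>' r w))\<^sup>2)
    + 2 * integral {s..t} (\<lambda>r. (L2_norm M (\<lambda>w. \<sigma> r w - \<sigma>' r w))\<^sup>2)"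
proof -
  note D = ito_processD[OF X] and D' = ito_processD[OF X']
  obtain Y Z where YZ: "weak_integral M (\<lambda>r w. \<beta> r w - \<beta>' r w) s t Y" "Z \<in> L2 M"
    "((\<lambda>r. (L2_norm M (\<lambda>w. \<sigma> r w - \<sigma>' r w))\<^sup>2) has_integral (L2_norm M Z)\<^sup>2) {s..t}"
    "AE w in M. X t w - X' t w - (X s w - X' s w) = Y w + Z w"
    using ito_process_diff_increment[OF X X' st] .
  have L: "(\<lambda>w. X t w - X' t w) \<in> L2 M" by (intro L2_diff D D') (use st in auto)
  have YL: "Y \<in> L2 M" by (rule weak_integralD(1)[OF YZ(1)])
  have y: "(L2_norm M Y)\<^sup>2 \<le> (t - s) * integral {s..t} (\<lambda>r. (L2_norm M (\<lambda>w. \<beta> r w - \<beta>' r w))\<^sup>2)"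
    by (rule weak_integral_square[OF YZ(1) L2_continuous_on_diff[OF D(4) D'(4)] st(2)]) (use st in auto)
  have "AE w in M. X t w - X' t w = Y w + Z w"
    using YZ(4) init by eventually_elim simp
  then have "L2_norm M (\<lambda>w. X t w - X' t w) = L2_norm M (\<lambda>w. Y w + Z w)"
    by (rule L2_norm_cong_AE[OF _ L L2_add[OF YL YZ(2)]])
  also have "\<dots> \<le> L2_norm M Y + L2_norm M Z" by (rule L2_norm_triangle[OF YL YZ(2)])
  finally have "(L2_norm M (\<lambda>w. X t w - X' t w))\<^sup>2 \<le> (L2_norm M Y + L2_norm M Z)\<^sup>2"
    by (rule power_mono) simp
  also have "\<dots> \<le> 2 * (L2_norm M Y)\<^sup>2 + 2 * (L2_norm M Z)\<^sup>2"
    using sum_squares_bound[of "L2_norm M Y" "L2_norm M Z"] by (simp add: power2_sum)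
  finally show ?thesis unfolding integral_unique[OF YZ(3)] mult.assoc using y by linarith
qed

text \<open>Comparison with the zero process makes the bounds for differences available for a single
  process; this is how mean square continuity is obtained.\<close>

lemma ito_process_zero:
  "0 \<le> a \<Longrightarrow> ito_process a (\<lambda>t w. 0 :: 'b::euclidean_space) (\<lambda>t w. 0) (\<lambda>t w. 0)"
  unfolding ito_process_def
proof (intro conjI allI impI L2_continuous_on_const)
  fix s t :: real assume "0 \<le> a" "a \<le> s" "s \<le> t"
  then obtain Z :: "'w \<Rightarrow> 'b" where Z: "has_ito_integral M F W (\<lambda>t w. 0) s t Z"
    using ito_integral_exists[of s t "\<lambda>t w. 0 :: 'b"] by (auto simp: L2_continuous_on_const)
  have "((\<lambda>r. 0) has_integral L2_inner M Z Z) {s..t}"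
    using ito_integral_pairing[OF Z Z] \<open>0 \<le> a\<close> \<open>a \<le> s\<close> \<open>s \<le> t\<close> by (simp add: L2_continuous_on_const)
  then have "L2_norm M Z = 0" using has_integral_unique[OF _ has_integral_0] by (auto simp flip: L2_norm_square)
  then have ae: "AE w in M. Z w = 0" using L2_norm_eq_0_iff[OF ito_integral_L2[OF Z]] by simp
  show "\<exists>Y Z. weak_integral M (\<lambda>t w. 0) s t Y \<and> has_ito_integral M F W (\<lambda>t w. 0) s t Z \<and>
    (AE w in M. (0::'b) = 0 + Y w + Z w)"
    by (rule exI[of _ "\<lambda>w. 0"], rule exI[of _ Z]) (use ae Z in \<open>auto simp: weak_integral_def\<close>)
qed auto

lemma ito_process_continuous:
  assumes X: "ito_process a X \<beta> \<sigma>"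
  shows "L2_continuous_on M {a..} X"
proof -
  note D = ito_processD[OF X]
  have bnd: "\<exists>B\<ge>0. \<forall>r t. a \<le> r \<and> r \<le> t \<and> t \<le> T \<longrightarrow> L2_dist M (X r) (X t) \<le> B * (t - r) + B * sqrt (t - r)" for T
  proof -
    obtain B1 where B1: "0 < B1" "\<And>s. s \<in> {a..T} \<Longrightarrow> L2_norm M (\<beta> s) \<le> B1"
      using L2_continuous_on_bounded[OF D(4)[of a T]] by auto
    obtain B2 where B2: "0 < B2" "\<And>s. s \<in> {a..T} \<Longrightarrow> L2_norm M (\<sigma> s) \<le> B2"
      using L2_continuous_on_bounded[OF D(5)[of a T]] by auto
    have "L2_dist M (X r) (X t) \<le> max B1 B2 * (t - r) + max B1 B2 * sqrt (t - r)" if h: "a \<le> r \<and> r \<le> t \<and> t \<le> T" for r t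
    proof -
      have "L2_norm M (\<lambda>w. X t w - 0 - (X r w - 0)) \<le> max B1 B2 * (t - r) + max B1 B2 * sqrt (t - r)"
        by (rule ito_process_diff_bound[OF X ito_process_zero[OF D(1)]])
          (use h B1 B2 in \<open>auto simp: le_max_iff_disj\<close>)
      then show ?thesis by (subst L2_dist_commute) (simp add: L2_dist_norm)
    qed
    then show ?thesis using B1 by (intro exI[of _ "max B1 B2"]) auto
  qed
  show ?thesis
    unfolding L2_continuous_on_def
  proof (intro conjI ballI)
    show "X s \<in> L2 M" if "s \<in> {a..}" for s using D(3)[of s] that by simp
    fix s assume s: "s \<in> {a..}"
    obtain B where B: "0 \<le> B" "\<And>r t. a \<le> r \<Longrightarrow> r \<le> t \<Longrightarrow> t \<le> s + 1 \<Longrightarrow> L2_dist M (X r) (X t) \<le> B * (t - r) + B * sqrt (t - r)"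
      using bnd[of "s + 1"] by blast
    have le: "L2_dist M (X r) (X s) \<le> B * \<bar>r - s\<bar> + B * sqrt \<bar>r - s\<bar>" if "a \<le> r" "r \<le> s + 1" for r
      using B(2)[of r s] B(2)[of s r] s that by (cases "r \<le> s") (auto simp: L2_dist_commute)
    show "((\<lambda>r. L2_dist M (X r) (X s)) \<longlongrightarrow> 0) (at s within {a..})"
    proof (rule metric_tendsto_imp_tendsto)
      have "((\<lambda>r. B * \<bar>r - s\<bar> + B * sqrt \<bar>r - s\<bar>) \<longlongrightarrow> B * \<bar>s - s\<bar> + B * sqrt \<bar>s - s\<bar>) (at s within {a..})"
        by (intro tendsto_intros)
      then show "((\<lambda>r. B * \<bar>r - s\<bar> + B * sqrt \<bar>r - s\<bar>) \<longlongrightarrow> 0) (at s within {a..})" by simp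
      have "\<forall>\<^sub>F r in at s within {a..}. r \<in> {a..} \<and> r \<le> s + 1"
        using eventually_in_within[of "{a..}" s]
        by (auto simp: eventually_at dist_real_def intro!: exI[of _ 1])
      then show "\<forall>\<^sub>F r in at s within {a..}. dist (L2_dist M (X r) (X s)) 0 \<le> dist (B * \<bar>r - s\<bar> + B * sqrt \<bar>r - s\<bar>) 0"
        by eventually_elim (use le B(1) in auto)
    qed
  qed
qed

end

section \<open>Second moments of linear equations\<close>

text \<open>In matrix notation this is the entry (i, j) of A m + m A^T + G m G^T, the right-hand
  side of the differential equation for the second moments of the linear equation.\<close>

definition moment_generator ::
  "real^'n^'n \<Rightarrow> real^'n^'n \<Rightarrow> ('n \<Rightarrow> 'n \<Rightarrow> real) \<Rightarrow> 'n \<Rightarrow> 'n \<Rightarrow> real" where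
  "moment_generator A G m i j = (\<Sum>k\<in>UNIV. A $ i $ k * m k j) + (\<Sum>k\<in>UNIV. A $ j $ k * m i k)
     + (\<Sum>k\<in>UNIV. \<Sum>l\<in>UNIV. G $ i $ k * G $ j $ l * m k l)"

lemma moment_generator_diff:
  "moment_generator A G (\<lambda>i j. m i j - m' i j) i j = moment_generator A G m i j - moment_generator A G m' i j"
  by (simp add: moment_generator_def sum_subtractf right_diff_distrib)

lemma moment_generator_sum:
  "moment_generator A G (\<lambda>i j. \<Sum>p\<in>S. c p * m p i j) i j = (\<Sum>p\<in>S. c p * moment_generator A G (m p) i j)"
proof -
  have 1: "(\<Sum>k\<in>UNIV. a k * (\<Sum>p\<in>S. c p * f p k)) = (\<Sum>p\<in>S. c p * (\<Sum>k\<in>UNIV. a k * f p k))"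
    for a :: "'c \<Rightarrow> real" and f
    unfolding sum_distrib_left by (subst sum.swap) (simp add: mult_ac)
  have 2: "(\<Sum>k\<in>UNIV. \<Sum>l\<in>UNIV. a k l * (\<Sum>p\<in>S. c p * f p k l)) = (\<Sum>p\<in>S. c p * (\<Sum>k\<in>UNIV. \<Sum>l\<in>UNIV. a k l * f p k l))"
    for a :: "'c \<Rightarrow> 'd \<Rightarrow> real" and f
    unfolding 1 by (subst sum.swap) (simp add: sum_distrib_left)
  show ?thesis
    unfolding moment_generator_def 2 unfolding 1 by (simp add: sum.distrib distrib_left)
qed

lemma moment_generator_bound:
  fixes m :: "'n::finite \<Rightarrow> 'n \<Rightarrow> real"
  shows "\<bar>moment_generator A G m i j\<bar> \<le> (2 * norm A + (norm G)\<^sup>2) * (\<Sum>k\<in>UNIV. \<Sum>l\<in>UNIV. \<bar>m k l\<bar>)"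
proof -
  let ?S = "\<Sum>k\<in>UNIV. \<Sum>l\<in>UNIV. \<bar>m k l\<bar>"
  have e: "\<bar>B $ i $ k\<bar> \<le> norm B" for B :: "real^'n^'n" and i k
    using order_trans[OF component_le_norm_cart[of "B $ i" k] Finite_Cartesian_Product.norm_nth_le] by simp
  have col: "(\<Sum>k\<in>UNIV. \<bar>m k j\<bar>) \<le> ?S" for j
    by (intro sum_mono member_le_sum) auto
  have row: "(\<Sum>k\<in>UNIV. \<bar>m i k\<bar>) \<le> ?S" for i
    by (rule member_le_sum[of i UNIV "\<lambda>i. \<Sum>k\<in>UNIV. \<bar>m i k\<bar>"]) (auto intro: sum_nonneg)
  have "\<bar>\<Sum>k\<in>UNIV. A $ i $ k * m k j\<bar> \<le> (\<Sum>k\<in>UNIV. norm A * \<bar>m k j\<bar>)"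
    by (rule order_trans[OF sum_abs]) (auto intro!: sum_mono mult_right_mono e simp: abs_mult)
  also have "\<dots> \<le> norm A * ?S" using col by (simp flip: sum_distrib_left add: mult_left_mono)
  finally have 1: "\<bar>\<Sum>k\<in>UNIV. A $ i $ k * m k j\<bar> \<le> norm A * ?S" .
  have "\<bar>\<Sum>k\<in>UNIV. A $ j $ k * m i k\<bar> \<le> (\<Sum>k\<in>UNIV. norm A * \<bar>m i k\<bar>)"
    by (rule order_trans[OF sum_abs]) (auto intro!: sum_mono mult_right_mono e simp: abs_mult)
  also have "\<dots> \<le> norm A * ?S" using row by (simp flip: sum_distrib_left add: mult_left_mono)
  finally have 2: "\<bar>\<Sum>k\<in>UNIV. A $ j $ k * m i k\<bar> \<le> norm A * ?S" .
  have "\<bar>\<Sum>k\<in>UNIV. \<Sum>l\<in>UNIV. G $ i $ k * G $ j $ l * m k l\<bar> \<le> (\<Sum>k\<in>UNIV. \<Sum>l\<in>UNIV. (norm G)\<^sup>2 * \<bar>m k l\<bar>)"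
    by (intro order_trans[OF sum_abs] sum_mono) (auto intro!: mult_right_mono mult_mono e simp: abs_mult power2_eq_square)
  also have "\<dots> = (norm G)\<^sup>2 * ?S" by (simp flip: sum_distrib_left)
  finally have 3: "\<bar>\<Sum>k\<in>UNIV. \<Sum>l\<in>UNIV. G $ i $ k * G $ j $ l * m k l\<bar> \<le> (norm G)\<^sup>2 * ?S" .
  show ?thesis
    unfolding moment_generator_def using 1 2 3 by (simp add: distrib_right)
qed

lemma L2_inner_matrix_left:
  fixes A :: "real^'n^'n"
  assumes "X \<in> L2 M" "Y \<in> L2 M"
  shows "L2_inner M (\<lambda>w. (A *v X w) $ i) Y = (\<Sum>k\<in>UNIV. A $ i $ k * L2_inner M (\<lambda>w. X w $ k) Y)"
proof -
  have "L2_inner M (\<lambda>w. (A *v X w) $ i) Y = L2_inner M (\<lambda>w. \<Sum>k\<in>UNIV. A $ i $ k *\<^sub>R X w $ k) Y"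
    by (simp add: matrix_vector_mult_def)
  also have "\<dots> = (\<Sum>k\<in>UNIV. L2_inner M (\<lambda>w. A $ i $ k *\<^sub>R X w $ k) Y)"
    by (intro L2_inner_sum_left L2_scaleR L2_linear[OF bounded_linear_vec_nth] assms)
  finally show ?thesis unfolding L2_inner_scale_left .
qed

section \<open>Product rule in mean and the moment equation\<close>

context brownian_basis
begin

text \<open>The defect between the two sides has increments that are uniformly o(t - s), hence is
  constant. Martingale terms paired with the past vanish, and the pairing of the two noise parts is
  an exact integral by the isometry, so only the drift terms have to be estimated.\<close>

lemma ito_product:
  assumes X: "ito_process a X \<beta> \<sigma>" and X': "ito_process a X' \<beta>' \<sigma>'" and aT: "a \<le> T"
  shows "((\<lambda>r. L2_inner M (\<beta> r) (X' r) + L2_inner M (X r) (\<beta>' r) + L2_inner M (\<sigma> r) (\<sigma>' r))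
    has_integral L2_inner M (X T) (X' T) - L2_inner M (X a) (X' a)) {a..T}"
proof -
  note D = ito_processD[OF X] and D' = ito_processD[OF X']
  have cX: "L2_continuous_on M {s..t} X" and cX': "L2_continuous_on M {s..t} X'" if "a \<le> s" for s t
    using that by (auto intro: L2_continuous_on_subset[OF ito_process_continuous[OF X]]
        L2_continuous_on_subset[OF ito_process_continuous[OF X']])
  define f where "f = (\<lambda>r. L2_inner M (\<beta> r) (X' r) + L2_inner M (X r) (\<beta>' r) + L2_inner M (\<sigma> r) (\<sigma>' r))"
  have ints: "(\<lambda>r. L2_inner M (\<beta> r) (X' r)) integrable_on {s..t}" "(\<lambda>r. L2_inner M (X r) (\<beta>' r)) integrable_on {s..t}"
    "(\<lambda>r. L2_inner M (\<sigma> r) (\<sigma>' r)) integrable_on {s..t}" if "a \<le> s" for s t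
    using that by (auto intro!: integrable_continuous_interval L2_continuous_on_inner cX cX' D D')
  have fint: "f integrable_on {s..t}" if "a \<le> s" for s t
    unfolding f_def by (intro integrable_add ints that)
  define \<psi> where "\<psi> = (\<lambda>t. L2_inner M (X t) (X' t) - integral {a..t} f)"
  have "\<psi> T = \<psi> a"
  proof (rule telescoping_error_zero[OF aT])
    fix \<epsilon> :: real assume \<epsilon>: "0 < \<epsilon>"
    obtain B1 where B1: "0 < B1" "\<And>s. s \<in> {a..T} \<Longrightarrow> L2_norm M (\<beta> s) \<le> B1"
      using L2_continuous_on_bounded[OF D(4)[of a T]] by auto
    obtain B2 where B2: "0 < B2" "\<And>s. s \<in> {a..T} \<Longrightarrow> L2_norm M (\<beta>' s) \<le> B2"
      using L2_continuous_on_bounded[OF D'(4)[of a T]] by auto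
    define B where "B = max B1 B2"
    have B: "0 < B" "\<And>s. s \<in> {a..T} \<Longrightarrow> L2_norm M (\<beta> s) \<le> B" "\<And>s. s \<in> {a..T} \<Longrightarrow> L2_norm M (\<beta>' s) \<le> B"
      using B1 B2 by (auto simp: B_def le_max_iff_disj)
    \<comment> \<open>The two drift terms will cost \<epsilon>/4 each; the product of the drift
      increments costs \<epsilon>/2, by the bound \<epsilon> / (2 B^2) built into
      \<open>d\<close>.\<close>
    define e where "e = \<epsilon> / (4 * B)"
    have e: "0 < e" using \<epsilon> B(1) by (simp add: e_def)
    obtain d1 where d1: "0 < d1" "\<And>r s. r \<in> {a..T} \<Longrightarrow> s \<in> {a..T} \<Longrightarrow> \<bar>r - s\<bar> < d1 \<Longrightarrow> L2_dist M (X r) (X s) < e"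
      using L2_uniformly_continuous[OF cX e, of a T] by auto
    obtain d2 where d2: "0 < d2" "\<And>r s. r \<in> {a..T} \<Longrightarrow> s \<in> {a..T} \<Longrightarrow> \<bar>r - s\<bar> < d2 \<Longrightarrow> L2_dist M (X' r) (X' s) < e"
      using L2_uniformly_continuous[OF cX' e, of a T] by auto
    define d where "d = min (min d1 d2) (\<epsilon> / (2 * B\<^sup>2))"
    have "0 < d" using d1 d2 \<epsilon> B by (simp add: d_def)
    moreover have "\<bar>\<psi> t - \<psi> s\<bar> \<le> \<epsilon> * (t - s)" if st: "a \<le> s" "s \<le> t" "t \<le> T" "t - s < d" for s t
    proof -
      have s0: "0 \<le> s" using st D(1) by simp
      obtain Y Z where YZ: "weak_integral M \<beta> s t Y" "has_ito_integral M F W \<sigma> s t Z"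
        "AE w in M. X t w = X s w + Y w + Z w" using ito_process_increment[OF X st(1,2)] .
      obtain Y' Z' where YZ': "weak_integral M \<beta>' s t Y'" "has_ito_integral M F W \<sigma>' s t Z'"
        "AE w in M. X' t w = X' s w + Y' w + Z' w" using ito_process_increment[OF X' st(1,2)] .
      note L = weak_integralD(1)[OF YZ(1)] ito_integral_L2[OF YZ(2)] weak_integralD(1)[OF YZ'(1)] ito_integral_L2[OF YZ'(2)]
      note XL = D(3)[OF st(1)] D'(3)[OF st(1)] D(3)[OF order_trans[OF st(1,2)]] D'(3)[OF order_trans[OF st(1,2)]]
      have past: "L2_inner M Z (X' s) = 0" "L2_inner M (X s) Z' = 0"
        using ito_integral_past[OF YZ(2) s0 D'(2)[OF st(1)]] ito_integral_past[OF YZ'(2) s0 D(2)[OF st(1)]]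
        by (auto simp: L2_inner_commute)
      have x: "L2_inner M (X t) V = L2_inner M (X s) V + L2_inner M Y V + L2_inner M Z V" if "V \<in> L2 M" for V
        using L2_inner_cong_AE[OF YZ(3), of V V] that L XL by (simp add: L2_add L2_inner_add_left)
      have x': "L2_inner M V (X' t) = L2_inner M V (X' s) + L2_inner M V Y' + L2_inner M V Z'" if "V \<in> L2 M" for V
        using L2_inner_cong_AE[OF _ YZ'(3), of V V] that L XL by (simp add: L2_add L2_inner_add_right)
      have zz: "((\<lambda>r. L2_inner M (\<sigma> r) (\<sigma>' r)) has_integral L2_inner M Z Z') {s..t}"
        by (intro ito_integral_pairing YZ YZ' D D' st s0)
      \<comment> \<open>Taking the drift terms against the end values \<open>X t\<close> and
        \<open>X' t\<close> absorbs the mixed drift-noise products, which need not vanish; the drift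
        product is then counted twice and subtracted once.\<close>
      have id: "L2_inner M (X t) (X' t) - L2_inner M (X s) (X' s) =
          L2_inner M Y (X' t) + L2_inner M (X t) Y' - L2_inner M Y Y' + L2_inner M Z Z'"
        using x[OF XL(4)] x'[OF XL(1)] x'[OF L(2)] x[OF L(3)] past by simp
      have tT: "t \<in> {a..T}" "\<And>r. r \<in> {s..t} \<Longrightarrow> r \<in> {a..T}" using st by auto
      have h1: "((\<lambda>r. L2_inner M (\<beta> r) (X' t) - L2_inner M (\<beta> r) (X' r)) has_integral
          L2_inner M Y (X' t) - integral {s..t} (\<lambda>r. L2_inner M (\<beta> r) (X' r))) {s..t}"
        unfolding weak_integralD(2)[OF YZ(1) XL(4)]
        by (intro has_integral_diff integrable_integral ints L2_inner_const_integrable D st XL)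
      have h2: "((\<lambda>r. L2_inner M (\<beta>' r) (X t) - L2_inner M (X r) (\<beta>' r)) has_integral
          L2_inner M (X t) Y' - integral {s..t} (\<lambda>r. L2_inner M (X r) (\<beta>' r))) {s..t}"
        unfolding L2_inner_commute[of M "X t" Y'] weak_integralD(2)[OF YZ'(1) XL(3)]
        by (intro has_integral_diff integrable_integral ints L2_inner_const_integrable D' st XL)
      have b1: "norm (L2_inner M Y (X' t) - integral {s..t} (\<lambda>r. L2_inner M (\<beta> r) (X' r))) \<le> B * e * measure lborel {s..t}"
      proof (rule has_integral_bound_real[OF _ _ h1])
        fix r assume "r \<in> {s..t} - {}"
        then have r: "r \<in> {s..t}" by simp
        have \<beta>L: "\<beta> r \<in> L2 M" "X' r \<in> L2 M" using L2_continuous_onD[OF D(4)[OF st(1)] r] D'(3)[of r] r st by auto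
        have "L2_inner M (\<beta> r) (X' t) - L2_inner M (\<beta> r) (X' r) = L2_inner M (\<beta> r) (\<lambda>w. X' t w - X' r w)"
          using \<beta>L XL by (simp add: L2_inner_diff_right)
        also have "\<bar>\<dots>\<bar> \<le> L2_norm M (\<beta> r) * L2_norm M (\<lambda>w. X' t w - X' r w)"
          by (rule L2_Cauchy_Schwarz[OF \<beta>L(1) L2_diff[OF XL(4) \<beta>L(2)]])
        also have "\<dots> \<le> B * e"
          using d2(2)[OF tT(1) tT(2)[OF r]] B(2)[OF tT(2)[OF r]] r st(4) B(1)
          by (intro mult_mono) (auto simp: d_def L2_dist_norm)
        finally show "norm (L2_inner M (\<beta> r) (X' t) - L2_inner M (\<beta> r) (X' r)) \<le> B * e" by simp
      qed (use B e in auto)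
      have b2: "norm (L2_inner M (X t) Y' - integral {s..t} (\<lambda>r. L2_inner M (X r) (\<beta>' r))) \<le> B * e * measure lborel {s..t}"
      proof (rule has_integral_bound_real[OF _ _ h2])
        fix r assume "r \<in> {s..t} - {}"
        then have r: "r \<in> {s..t}" by simp
        have \<beta>L: "\<beta>' r \<in> L2 M" "X r \<in> L2 M" using L2_continuous_onD[OF D'(4)[OF st(1)] r] D(3)[of r] r st by auto
        have "L2_inner M (\<beta>' r) (X t) - L2_inner M (X r) (\<beta>' r) = L2_inner M (\<beta>' r) (\<lambda>w. X t w - X r w)"
          using \<beta>L XL by (simp add: L2_inner_diff_right L2_inner_commute[of M "X r"])
        also have "\<bar>\<dots>\<bar> \<le> L2_norm M (\<beta>' r) * L2_norm M (\<lambda>w. X t w - X r w)"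
          by (rule L2_Cauchy_Schwarz[OF \<beta>L(1) L2_diff[OF XL(3) \<beta>L(2)]])
        also have "\<dots> \<le> B * e"
          using d1(2)[OF tT(1) tT(2)[OF r]] B(3)[OF tT(2)[OF r]] r st(4) B(1)
          by (intro mult_mono) (auto simp: d_def L2_dist_norm)
        finally show "norm (L2_inner M (\<beta>' r) (X t) - L2_inner M (X r) (\<beta>' r)) \<le> B * e" by simp
      qed (use B e in auto)
      have "L2_norm M Y \<le> B * (t - s)" "L2_norm M Y' \<le> B * (t - s)"
        using weak_integral_norm[OF YZ(1) D(4)[OF st(1)] st(2), of B] weak_integral_norm[OF YZ'(1) D'(4)[OF st(1)] st(2), of B] B st
        by auto
      then have "L2_norm M Y * L2_norm M Y' \<le> (B * (t - s)) * (B * (t - s))"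
        using B st by (intro mult_mono) auto
      then have b3: "\<bar>L2_inner M Y Y'\<bar> \<le> B\<^sup>2 * (t - s) * (t - s)"
        using L2_Cauchy_Schwarz[OF L(1,3)] by (simp add: power2_eq_square mult_ac)
      have "B\<^sup>2 * (t - s) \<le> B\<^sup>2 * (\<epsilon> / (2 * B\<^sup>2))" using st(4) B(1) by (intro mult_left_mono) (auto simp: d_def)
      also have "\<dots> = \<epsilon> / 2" using B(1) by simp
      finally have "B\<^sup>2 * (t - s) * (t - s) \<le> \<epsilon> / 2 * (t - s)" using st by (intro mult_right_mono) auto
      then have b3': "\<bar>L2_inner M Y Y'\<bar> \<le> \<epsilon> / 2 * (t - s)" using b3 by linarith
      have m: "B * e * measure lborel {s..t} = \<epsilon> / 4 * (t - s)" using B(1) st(2) by (simp add: e_def)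
      have i1: "integral {s..t} f = integral {s..t} (\<lambda>r. L2_inner M (\<beta> r) (X' r)) + integral {s..t} (\<lambda>r. L2_inner M (X r) (\<beta>' r))
          + L2_inner M Z Z'"
        unfolding f_def using ints[OF st(1)] integral_unique[OF zz] by (simp add: integral_add integrable_add)
      have i2: "integral {a..t} f = integral {a..s} f + integral {s..t} f"
        using Henstock_Kurzweil_Integration.integral_combine[OF st(1,2) fint[OF order_refl]] by simp
      show ?thesis
        unfolding \<psi>_def using id b1[unfolded m real_norm_def] b2[unfolded m real_norm_def] b3' i1 i2 by argo
    qed
    ultimately show "\<exists>d>0. \<forall>s t. a \<le> s \<and> s \<le> t \<and> t \<le> T \<and> t - s < d \<longrightarrow> \<bar>\<psi> t - \<psi> s\<bar> \<le> \<epsilon> * (t - s)"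
      by blast
  qed
  then have "integral {a..T} f = L2_inner M (X T) (X' T) - L2_inner M (X a) (X' a)"
    by (simp add: \<psi>_def)
  with integrable_integral[OF fint[of a T]] show ?thesis unfolding f_def by simp
qed

definition linear_process :: "(real \<Rightarrow> real^'n^'n) \<Rightarrow> (real \<Rightarrow> real^'n^'n) \<Rightarrow> real \<Rightarrow> (real \<Rightarrow> 'w \<Rightarrow> real^'n) \<Rightarrow> bool" where
  "linear_process A G s X \<longleftrightarrow> ito_process s X (\<lambda>t w. A t *v X t w) (\<lambda>t w. G t *v X t w)"

definition cross_moment :: "(real \<Rightarrow> 'w \<Rightarrow> real^'n) \<Rightarrow> (real \<Rightarrow> 'w \<Rightarrow> real^'n) \<Rightarrow> real \<Rightarrow> 'n \<Rightarrow> 'n \<Rightarrow> real" where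
  "cross_moment P Q t i j = L2_inner M (\<lambda>w. P t w $ i) (\<lambda>w. Q t w $ j)"

lemma cross_moment_integral:
  assumes P: "linear_process A G s P" and Q: "linear_process A G s Q" and "s \<le> t"
  shows "((\<lambda>r. moment_generator (A r) (G r) (cross_moment P Q r) i j) has_integral
    cross_moment P Q t i j - cross_moment P Q s i j) {s..t}"
proof -
  note P' = P[unfolded linear_process_def] and Q' = Q[unfolded linear_process_def]
  note h = ito_product[OF ito_process_linear[OF bounded_linear_vec_nth P', of i] ito_process_linear[OF bounded_linear_vec_nth Q', of j] \<open>s \<le> t\<close>]
  have c: "(\<lambda>w. V w $ k) \<in> L2 M" if "V \<in> L2 M" for V :: "'w \<Rightarrow> real^'b" and k
    by (rule L2_linear[OF bounded_linear_vec_nth that])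
  have eq: "L2_inner M (\<lambda>w. (A r *v P r w) $ i) (\<lambda>w. Q r w $ j) + L2_inner M (\<lambda>w. P r w $ i) (\<lambda>w. (A r *v Q r w) $ j)
        + L2_inner M (\<lambda>w. (G r *v P r w) $ i) (\<lambda>w. (G r *v Q r w) $ j)
      = moment_generator (A r) (G r) (cross_moment P Q r) i j" if "r \<in> {s..t}" for r
  proof -
    from that have L: "P r \<in> L2 M" "Q r \<in> L2 M" using ito_processD(3)[OF P', of r] ito_processD(3)[OF Q', of r] by auto
    have GQ: "(\<lambda>w. G r *v Q r w) \<in> L2 M" by (rule L2_linear[OF matrix_vector_mul_bounded_linear L(2)])
    have "L2_inner M (\<lambda>w. (G r *v P r w) $ i) (\<lambda>w. (G r *v Q r w) $ j)
       = (\<Sum>k\<in>UNIV. G r $ i $ k * L2_inner M (\<lambda>w. P r w $ k) (\<lambda>w. (G r *v Q r w) $ j))"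
      by (rule L2_inner_matrix_left[OF L(1) c[OF GQ]])
    also have "\<dots> = (\<Sum>k\<in>UNIV. \<Sum>l\<in>UNIV. G r $ i $ k * G r $ j $ l * L2_inner M (\<lambda>w. P r w $ k) (\<lambda>w. Q r w $ l))"
      unfolding L2_inner_commute[of M "\<lambda>w. P r w $ _"] L2_inner_matrix_left[OF L(2) c[OF L(1)]] sum_distrib_left
      by (simp add: mult.assoc)
    finally show "L2_inner M (\<lambda>w. (A r *v P r w) $ i) (\<lambda>w. Q r w $ j) + L2_inner M (\<lambda>w. P r w $ i) (\<lambda>w. (A r *v Q r w) $ j)
        + L2_inner M (\<lambda>w. (G r *v P r w) $ i) (\<lambda>w. (G r *v Q r w) $ j)
      = moment_generator (A r) (G r) (cross_moment P Q r) i j"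
      unfolding moment_generator_def cross_moment_def
      by (simp add: L2_inner_matrix_left[OF L(1) c[OF L(2)]] L2_inner_commute[of M "\<lambda>w. P r w $ i"] L2_inner_matrix_left[OF L(2) c[OF L(1)]])
  qed
  show ?thesis
    unfolding cross_moment_def[of P Q t] cross_moment_def[of P Q s] by (rule has_integral_eq[OF eq h])
qed

lemma cross_moment_continuous:
  assumes P: "linear_process A G s P" and Q: "linear_process A G s Q"
  shows "continuous_on {s..} (\<lambda>t. cross_moment P Q t i j)"
  unfolding cross_moment_def using P Q
  by (intro L2_continuous_on_inner L2_continuous_on_linear[OF bounded_linear_vec_nth] ito_process_continuous)
    (auto simp: linear_process_def)

text \<open>Both sides solve the same linear integral equation, and they agree at time s because
  \<open>\<Phi> k\<close> starts at the k-th unit vector; Gronwall's inequality makes them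
  equal.\<close>

lemma cross_moment_expansion:
  fixes \<Phi> :: "'n::finite \<Rightarrow> real \<Rightarrow> 'w \<Rightarrow> real^'n"
  assumes X: "linear_process A G s X" and \<Phi>: "\<And>k. linear_process A G s (\<Phi> k)"
    and init: "\<And>k. AE w in M. \<Phi> k s w = axis k 1"
    and A: "continuous_on {s..} A" and G: "continuous_on {s..} G" and "s \<le> t"
  shows "cross_moment X X t i j = (\<Sum>p\<in>UNIV. cross_moment X X s (fst p) (snd p) * cross_moment (\<Phi> (fst p)) (\<Phi> (snd p)) t i j)"
proof -
  define d where "d = (\<lambda>r i j. cross_moment X X r i j
    - (\<Sum>p\<in>UNIV. cross_moment X X s (fst p) (snd p) * cross_moment (\<Phi> (fst p)) (\<Phi> (snd p)) r i j))"
  have dc: "continuous_on {s..} (\<lambda>r. d r i j)" for i j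
    unfolding d_def by (intro continuous_intros cross_moment_continuous[OF X X] cross_moment_continuous[OF \<Phi> \<Phi>])
  have "((\<lambda>r. moment_generator (A r) (G r) (d r) i j) has_integral d u i j - d s i j) {s..u}" if "s \<le> u" for u i j
  proof -
    have "((\<lambda>r. moment_generator (A r) (G r) (cross_moment X X r) i j -
        (\<Sum>p\<in>UNIV. cross_moment X X s (fst p) (snd p) * moment_generator (A r) (G r) (cross_moment (\<Phi> (fst p)) (\<Phi> (snd p)) r) i j)) has_integral
      (cross_moment X X u i j - cross_moment X X s i j) -
        (\<Sum>p\<in>UNIV. cross_moment X X s (fst p) (snd p) *
          (cross_moment (\<Phi> (fst p)) (\<Phi> (snd p)) u i j - cross_moment (\<Phi> (fst p)) (\<Phi> (snd p)) s i j))) {s..u}"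
      by (intro has_integral_diff has_integral_sum has_integral_mult_right cross_moment_integral X \<Phi> that) simp
    moreover have "(cross_moment X X u i j - cross_moment X X s i j) -
        (\<Sum>p\<in>UNIV. cross_moment X X s (fst p) (snd p) *
          (cross_moment (\<Phi> (fst p)) (\<Phi> (snd p)) u i j - cross_moment (\<Phi> (fst p)) (\<Phi> (snd p)) s i j))
      = d u i j - d s i j"
      by (simp add: d_def right_diff_distrib sum_subtractf)
    ultimately show ?thesis unfolding d_def moment_generator_diff moment_generator_sum by simp
  qed
  moreover have ds: "d s i j = 0" for i j
  proof -
    have L: "\<Phi> k s \<in> L2 M" for k using ito_processD(3)[OF \<Phi>[of k, unfolded linear_process_def]] by simp
    have "cross_moment (\<Phi> k) (\<Phi> l) s i j = (if i = k \<and> j = l then 1 else 0)" for k l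
    proof -
      have "cross_moment (\<Phi> k) (\<Phi> l) s i j = L2_inner M (\<lambda>w. (axis k 1 :: real^'n) $ i) (\<lambda>w. (axis l 1 :: real^'n) $ j)"
        unfolding cross_moment_def
        by (rule L2_inner_cong_AE) (use init[of k] init[of l] L L2_linear[OF bounded_linear_vec_nth L] in auto)
      also have "\<dots> = (if i = k \<and> j = l then 1 else 0)"
        by (simp add: L2_inner_def prob_space axis_def)
      finally show ?thesis .
    qed
    then have "(\<Sum>p\<in>UNIV. cross_moment X X s (fst p) (snd p) * cross_moment (\<Phi> (fst p)) (\<Phi> (snd p)) s i j)
      = (\<Sum>p\<in>UNIV. if p = (i, j) then cross_moment X X s i j else 0)"
      by (intro sum.cong) (auto simp: prod_eq_iff)
    then show ?thesis by (simp add: d_def)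
  qed
  ultimately have dint: "((\<lambda>r. moment_generator (A r) (G r) (d r) i j) has_integral d u i j) {s..u}" if "s \<le> u" for u i j
    using that by simp
  \<comment> \<open>The l^1 norm of the matrix \<open>d\<close>: each entry is bounded by C times
    the integral of \<delta>, and summing over all pairs of indices gives the Gronwall
    constant.\<close>
  define \<delta> where "\<delta> = (\<lambda>r. \<Sum>k\<in>UNIV. \<Sum>l\<in>UNIV. \<bar>d r k l\<bar>)"
  have \<delta>c: "continuous_on {s..u} \<delta>" for u
    unfolding \<delta>_def by (intro continuous_intros continuous_on_subset[OF dc]) auto
  have "bounded ((\<lambda>r. 2 * norm (A r) + (norm (G r))\<^sup>2) ` {s..t})"
    by (intro compact_imp_bounded compact_continuous_image continuous_intros continuous_on_subset[OF A] continuous_on_subset[OF G] compact_Icc) auto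
  then obtain C where "\<forall>x\<in>(\<lambda>r. 2 * norm (A r) + (norm (G r))\<^sup>2) ` {s..t}. norm x \<le> C"
    unfolding bounded_iff by blast
  then have C: "2 * norm (A r) + (norm (G r))\<^sup>2 \<le> C" if "r \<in> {s..t}" for r
    using that by (fastforce dest: abs_le_D1)
  have dle: "\<bar>d u i j\<bar> \<le> C * integral {s..u} \<delta>" if u: "u \<in> {s..t}" for u i j
  proof -
    have "norm (integral {s..u} (\<lambda>r. moment_generator (A r) (G r) (d r) i j)) \<le> integral {s..u} (\<lambda>r. C * \<delta> r)"
    proof (rule integral_norm_bound_integral)
      show "(\<lambda>r. moment_generator (A r) (G r) (d r) i j) integrable_on {s..u}"
        using dint[of u i j] u by auto
      show "(\<lambda>r. C * \<delta> r) integrable_on {s..u}"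
        by (intro integrable_continuous_interval continuous_intros \<delta>c)
      fix r assume r: "r \<in> {s..u}"
      have "\<bar>moment_generator (A r) (G r) (d r) i j\<bar> \<le> (2 * norm (A r) + (norm (G r))\<^sup>2) * \<delta> r"
        unfolding \<delta>_def by (rule moment_generator_bound)
      also have "\<dots> \<le> C * \<delta> r"
        using r u by (intro mult_right_mono C) (auto simp: \<delta>_def intro!: sum_nonneg)
      finally show "norm (moment_generator (A r) (G r) (d r) i j) \<le> C * \<delta> r" by simp
    qed
    then show ?thesis using integral_unique[OF dint, of u i j] u by simp
  qed
  have "\<delta> t = 0"
  proof (rule gronwall_zero[OF \<delta>c])
    show "0 \<le> \<delta> u" for u by (auto simp: \<delta>_def intro!: sum_nonneg)
    fix u assume u: "u \<in> {s..t}"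
    have "\<delta> u \<le> (\<Sum>k\<in>(UNIV::'n set). \<Sum>l\<in>(UNIV::'n set). C * integral {s..u} \<delta>)"
      unfolding \<delta>_def by (intro sum_mono dle[OF u, unfolded \<delta>_def])
    then show "\<delta> u \<le> (real CARD('n) * (real CARD('n) * C)) * integral {s..u} \<delta>" by simp
  qed (use \<open>s \<le> t\<close> in auto)
  then have "(\<Sum>l\<in>UNIV. \<bar>d t i l\<bar>) = 0"
    unfolding \<delta>_def by (subst (asm) sum_nonneg_eq_0_iff) (auto intro: sum_nonneg)
  then have "d t i j = 0" by (subst (asm) sum_nonneg_eq_0_iff) auto
  then show ?thesis by (simp add: d_def)
qed

text \<open>The second moment of a solution depends only on the second moment of its initial value;
  this replaces the independence of \<open>\<Phi>(t) \<Phi>(s)\<^sup>-\<^sup>1\<close> from \<open>F s\<close>.\<close>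

lemma linear_process_second_moment:
  fixes \<Phi> :: "'n::finite \<Rightarrow> real \<Rightarrow> 'w \<Rightarrow> real^'n"
  assumes X: "linear_process A G s X" and \<Phi>: "\<And>k. linear_process A G s (\<Phi> k)"
    and init: "\<And>k. AE w in M. \<Phi> k s w = axis k 1"
    and A: "continuous_on {s..} A" and G: "continuous_on {s..} G" and st: "s \<le> t"
    and \<kappa>: "\<And>x. (L2_norm M (\<lambda>w. \<Sum>k\<in>UNIV. x $ k *\<^sub>R \<Phi> k t w))\<^sup>2 \<le> \<kappa> * (norm x)\<^sup>2"
  shows "(L2_norm M (X t))\<^sup>2 \<le> \<kappa> * (L2_norm M (X s))\<^sup>2"
proof -
  have \<Phi>L: "\<Phi> k t \<in> L2 M" for k using ito_processD(3)[OF \<Phi>[of k, unfolded linear_process_def]] st by simp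
  have XL: "X r \<in> L2 M" if "s \<le> r" for r using ito_processD(3)[OF X[unfolded linear_process_def]] that by simp
  have c: "(\<lambda>w. V w $ k) \<in> L2 M" if "V \<in> L2 M" for V :: "'w \<Rightarrow> real^'n" and k
    by (rule L2_linear[OF bounded_linear_vec_nth that])
  have tr: "L2_inner M (P r) (Q r) = (\<Sum>i\<in>UNIV. cross_moment P Q r i i)" if "P r \<in> L2 M" "Q r \<in> L2 M"
    for P Q :: "real \<Rightarrow> 'w \<Rightarrow> real^'n" and r
    using L2_inner_integrable[OF c[OF that(1)] c[OF that(2)]]
    by (simp add: cross_moment_def L2_inner_def inner_vec_def Bochner_Integration.integral_sum)
  \<comment> \<open>The Gram matrix of the basis solutions at time t, which appears when the
    expansion is summed over equal indices; \<open>quad\<close> bounds its quadratic form on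
    deterministic vectors.\<close>
  define q where "q = (\<lambda>p. L2_inner M (\<Phi> (fst p) t) (\<Phi> (snd p) t))"
  have quad: "(\<Sum>p\<in>UNIV. (x $ fst p * x $ snd p) * q p) \<le> \<kappa> * (norm x)\<^sup>2" for x :: "real^'n"
  proof -
    have "(\<Sum>p\<in>UNIV. (x $ fst p * x $ snd p) * q p) = (\<Sum>k\<in>UNIV. \<Sum>l\<in>UNIV. x $ k * x $ l * L2_inner M (\<Phi> k t) (\<Phi> l t))"
      unfolding q_def UNIV_Times_UNIV[symmetric] sum.cartesian_product by (simp add: case_prod_beta)
    also have "\<dots> = (L2_norm M (\<lambda>w. \<Sum>k\<in>UNIV. x $ k *\<^sub>R \<Phi> k t w))\<^sup>2"
      unfolding L2_norm_square
      by (simp add: L2_inner_sum_left L2_inner_sum_right L2_scaleR L2_sum \<Phi>L L2_inner_scale_left L2_inner_scale_right sum_distrib_left mult.assoc)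
    finally show ?thesis using \<kappa>[of x] by simp
  qed
  have "(L2_norm M (X t))\<^sup>2 = (\<Sum>i\<in>UNIV. \<Sum>p\<in>UNIV. cross_moment X X s (fst p) (snd p) * cross_moment (\<Phi> (fst p)) (\<Phi> (snd p)) t i i)"
    unfolding L2_norm_square tr[of X t X, OF XL[OF st] XL[OF st]]
    by (intro sum.cong refl cross_moment_expansion[OF X \<Phi> init A G st])
  also have "\<dots> = (\<Sum>p\<in>UNIV. cross_moment X X s (fst p) (snd p) * q p)"
    by (subst sum.swap) (simp add: q_def tr[of "\<Phi> k" t "\<Phi> l" for k l, OF \<Phi>L \<Phi>L] sum_distrib_left)
  \<comment> \<open>The moments at time s enter linearly, so the sum is the expectation of that
    quadratic form at the random vector \<open>X s w\<close>, and the deterministic bound applies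
    under the integral.\<close>
  also have "\<dots> = (\<integral>w. (\<Sum>p\<in>UNIV. (X s w $ fst p * X s w $ snd p) * q p) \<partial>M)"
    using L2_inner_integrable[OF c[OF XL[OF order_refl]] c[OF XL[OF order_refl]]]
    by (simp add: Bochner_Integration.integral_sum cross_moment_def L2_inner_def)
  also have "\<dots> \<le> (\<integral>w. \<kappa> * (norm (X s w))\<^sup>2 \<partial>M)"
  proof (rule integral_mono)
    show "integrable M (\<lambda>w. \<Sum>p\<in>UNIV. (X s w $ fst p * X s w $ snd p) * q p)"
      using L2_inner_integrable[OF c[OF XL[OF order_refl]] c[OF XL[OF order_refl]]] by simp
    show "integrable M (\<lambda>w. \<kappa> * (norm (X s w))\<^sup>2)" using L2_square_integrable[OF XL[OF order_refl]] by simp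
  qed (rule quad)
  finally show ?thesis by (simp add: L2_norm_square_integral)
qed

end

section \<open>Existence and uniqueness for Lipschitz coefficients\<close>

context brownian_basis
begin

text \<open>The error \<open>e\<close> is kept separate from the difference of the processes: for
  uniqueness it is that difference, for Picard iteration the difference of the previous iterates.
  The factor with \<open>T\<close> is uniform in t.\<close>

lemma ito_process_diff_lipschitz:
  assumes X: "ito_process s X \<beta> \<sigma>" and X': "ito_process s X' \<beta>' \<sigma>'"
    and init: "AE w in M. X s w = X' s w" and st: "s \<le> t" "t \<le> T" and L: "0 \<le> L"
    and lip: "\<And>r. r \<in> {s..t} \<Longrightarrow> L2_norm M (\<lambda>w. \<beta> r w - \<beta>' r w) \<le> L * e r"
      "\<And>r. r \<in> {s..t} \<Longrightarrow> L2_norm M (\<lambda>w. \<sigma> r w - \<sigma>' r w) \<le> L * e r"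
    and e: "\<And>r. r \<in> {s..t} \<Longrightarrow> 0 \<le> e r" "(\<lambda>r. (e r)\<^sup>2) integrable_on {s..t}"
  shows "(L2_norm M (\<lambda>w. X t w - X' t w))\<^sup>2 \<le> 2 * (T - s + 1) * L\<^sup>2 * integral {s..t} (\<lambda>r. (e r)\<^sup>2)"
proof -
  note D = ito_processD[OF X] and D' = ito_processD[OF X']
  have le: "integral {s..t} (\<lambda>r. (L2_norm M (\<lambda>w. \<gamma> r w - \<gamma>' r w))\<^sup>2) \<le> L\<^sup>2 * integral {s..t} (\<lambda>r. (e r)\<^sup>2)"
    if c: "L2_continuous_on M {s..t} \<gamma>" "L2_continuous_on M {s..t} \<gamma>'"
      and l: "\<And>r. r \<in> {s..t} \<Longrightarrow> L2_norm M (\<lambda>w. \<gamma> r w - \<gamma>' r w) \<le> L * e r" for \<gamma> \<gamma>'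
  proof (rule has_integral_le[OF integrable_integral has_integral_mult_right[OF integrable_integral[OF e(2)]]])
    show "(\<lambda>r. (L2_norm M (\<lambda>w. \<gamma> r w - \<gamma>' r w))\<^sup>2) integrable_on {s..t}"
      by (intro integrable_continuous_interval L2_continuous_on_norm_square L2_continuous_on_diff c)
    show "(L2_norm M (\<lambda>w. \<gamma> r w - \<gamma>' r w))\<^sup>2 \<le> L\<^sup>2 * (e r)\<^sup>2" if "r \<in> {s..t}" for r
      using power_mono[OF l[OF that] L2_norm_nonneg, of 2] by (simp add: power_mult_distrib)
  qed
  let ?I = "L\<^sup>2 * integral {s..t} (\<lambda>r. (e r)\<^sup>2)"
  have I: "0 \<le> ?I" by (intro mult_nonneg_nonneg integral_nonneg e) auto
  have "(L2_norm M (\<lambda>w. X t w - X' t w))\<^sup>2 \<le>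
    2 * (t - s) * integral {s..t} (\<lambda>r. (L2_norm M (\<lambda>w. \<beta> r w - \<beta>' r w))\<^sup>2)
    + 2 * integral {s..t} (\<lambda>r. (L2_norm M (\<lambda>w. \<sigma> r w - \<sigma>' r w))\<^sup>2)"
    by (rule ito_process_diff_square[OF X X' order_refl st(1) init])
  also have "\<dots> \<le> 2 * (T - s) * ?I + 2 * ?I"
    using st by (intro add_mono mult_mono le D(4,5) D'(4,5) lip order_refl)
      (auto intro!: integral_nonneg integrable_continuous_interval L2_continuous_on_norm_square L2_continuous_on_diff D(4,5) D'(4,5))
  also have "\<dots> = 2 * (T - s + 1) * L\<^sup>2 * integral {s..t} (\<lambda>r. (e r)\<^sup>2)" by (simp add: algebra_simps)
  finally show ?thesis .
qed

lemma ito_process_unique: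
  assumes X: "ito_process s X \<beta> \<sigma>" and X': "ito_process s X' \<beta>' \<sigma>'"
    and init: "AE w in M. X s w = X' s w" and st: "s \<le> t" and L: "0 \<le> L"
    and lip: "\<And>r. r \<in> {s..t} \<Longrightarrow> L2_norm M (\<lambda>w. \<beta> r w - \<beta>' r w) \<le> L * L2_norm M (\<lambda>w. X r w - X' r w)"
      "\<And>r. r \<in> {s..t} \<Longrightarrow> L2_norm M (\<lambda>w. \<sigma> r w - \<sigma>' r w) \<le> L * L2_norm M (\<lambda>w. X r w - X' r w)"
  shows "AE w in M. X t w = X' t w"
proof -
  note D = ito_processD[OF X] and D' = ito_processD[OF X']
  have c: "continuous_on {s..u} (\<lambda>r. (L2_norm M (\<lambda>w. X r w - X' r w))\<^sup>2)" for u
    by (intro L2_continuous_on_norm_square L2_continuous_on_diff)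
      (auto intro: L2_continuous_on_subset[OF ito_process_continuous[OF X]] L2_continuous_on_subset[OF ito_process_continuous[OF X']])
  have "(L2_norm M (\<lambda>w. X t w - X' t w))\<^sup>2 = 0"
  proof (rule gronwall_zero[OF c])
    show "(L2_norm M (\<lambda>w. X u w - X' u w))\<^sup>2 \<le> 2 * (t - s + 1) * L\<^sup>2 * integral {s..u} (\<lambda>r. (L2_norm M (\<lambda>w. X r w - X' r w))\<^sup>2)"
      if "u \<in> {s..t}" for u
      using that by (intro ito_process_diff_lipschitz[OF X X' init] L lip integrable_continuous_interval c) auto
  qed (use st in auto)
  then have "L2_norm M (\<lambda>w. X t w - X' t w) = 0" by simp
  then show ?thesis using L2_norm_eq_0_iff[OF L2_diff[OF D(3)[OF st] D'(3)[OF st]]] by simp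
qed

text \<open>The process \<open>V\<close> inserted into the coefficients is separated from the output
  \<open>X\<close>: one Picard step has \<open>V\<close> and \<open>X\<close> different, a solution
  has them equal. The initial value is random because linear solutions are restarted from u.\<close>

definition solves ::
  "(real \<Rightarrow> ('w \<Rightarrow> 'b::euclidean_space) \<Rightarrow> ('w \<Rightarrow> 'b)) \<Rightarrow> (real \<Rightarrow> ('w \<Rightarrow> 'b) \<Rightarrow> ('w \<Rightarrow> 'b)) \<Rightarrow>
     real \<Rightarrow> ('w \<Rightarrow> 'b) \<Rightarrow> (real \<Rightarrow> 'w \<Rightarrow> 'b) \<Rightarrow> (real \<Rightarrow> 'w \<Rightarrow> 'b) \<Rightarrow> bool" where
  "solves B S s z V X \<longleftrightarrow> (\<forall>t\<ge>s. X t \<in> L2_adapted M F t) \<and> L2_continuous_on M {s..} X \<and>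
     (\<forall>t\<ge>s. \<exists>Y Z. has_L2_integral M (\<lambda>r. B r (V r)) s t Y \<and> has_ito_integral M F W (\<lambda>r. S r (V r)) s t Z \<and>
       (AE w in M. X t w = z w + Y w + Z w))"

definition L2_lipschitz_on :: "real \<Rightarrow> real \<Rightarrow> (real \<Rightarrow> ('w \<Rightarrow> 'b::euclidean_space) \<Rightarrow> ('w \<Rightarrow> 'b)) \<Rightarrow> real \<Rightarrow> bool" where
  "L2_lipschitz_on s T B L \<longleftrightarrow> 0 \<le> L \<and> (\<forall>t\<in>{s..T}. \<forall>U\<in>L2 M. \<forall>V\<in>L2 M. L2_dist M (B t U) (B t V) \<le> L * L2_dist M U V)"

text \<open>Continuity is asked along mean square continuous curves, as the integrals use it. The
  Lipschitz constant may depend on the horizon, since the matrix coefficients are bounded only on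
  compact time intervals.\<close>

definition admissible_coeff :: "real \<Rightarrow> (real \<Rightarrow> ('w \<Rightarrow> 'b::euclidean_space) \<Rightarrow> ('w \<Rightarrow> 'b)) \<Rightarrow> bool" where
  "admissible_coeff s B \<longleftrightarrow> (\<forall>t\<ge>s. \<forall>U\<in>L2_adapted M F t. B t U \<in> L2_adapted M F t) \<and>
     (\<forall>X. L2_continuous_on M {s..} X \<longrightarrow> L2_continuous_on M {s..} (\<lambda>t. B t (X t))) \<and>
     (\<forall>T. \<exists>L. L2_lipschitz_on s T B L)"

lemma admissible_lipschitz:
  fixes B S :: "real \<Rightarrow> ('w \<Rightarrow> 'b::euclidean_space) \<Rightarrow> ('w \<Rightarrow> 'b)"
  assumes B: "admissible_coeff s B" and S: "admissible_coeff s S"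
  obtains L where "L2_lipschitz_on s T B L" "L2_lipschitz_on s T S L"
proof -
  obtain La where La: "L2_lipschitz_on s T B La" using B unfolding admissible_coeff_def by blast
  obtain Lb where Lb: "L2_lipschitz_on s T S Lb" using S unfolding admissible_coeff_def by blast
  have mono: "L2_lipschitz_on s T H (max La Lb)" if H: "L2_lipschitz_on s T H l" "l \<le> max La Lb"
    for H :: "real \<Rightarrow> ('w \<Rightarrow> 'b) \<Rightarrow> ('w \<Rightarrow> 'b)" and l
    unfolding L2_lipschitz_on_def
  proof (intro conjI ballI)
    show "0 \<le> max La Lb" using La by (simp add: L2_lipschitz_on_def le_max_iff_disj)
    fix t :: real and U V :: "'w \<Rightarrow> 'b" assume "t \<in> {s..T}" "U \<in> L2 M" "V \<in> L2 M"
    then have "L2_dist M (H t U) (H t V) \<le> l * L2_dist M U V" using H(1) by (simp add: L2_lipschitz_on_def)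
    also have "\<dots> \<le> max La Lb * L2_dist M U V" by (rule mult_right_mono[OF H(2)]) simp
    finally show "L2_dist M (H t U) (H t V) \<le> max La Lb * L2_dist M U V" .
  qed
  show ?thesis using that mono[OF La] mono[OF Lb] by simp
qed

lemma solves_ito_process:
  assumes X: "solves B S s z V X" and s: "0 \<le> s" and B: "admissible_coeff s B" and S: "admissible_coeff s S"
    and V: "L2_continuous_on M {s..} V"
  shows "ito_process s X (\<lambda>t. B t (V t)) (\<lambda>t. S t (V t))" "AE w in M. X s w = z w"
  using ito_processI[OF s _ _ _, of X "\<lambda>t. B t (V t)" "\<lambda>t. S t (V t)" z] assms
  unfolding solves_def admissible_coeff_def by blast+

text \<open>The integrals are chosen separately for each t, which suffices because nothing about
  paths is required; mean square continuity of the result follows from its being an Ito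
  process.\<close>

lemma picard_step:
  assumes s: "0 \<le> s" and z: "z \<in> L2_adapted M F s" and B: "admissible_coeff s B" and S: "admissible_coeff s S"
    and V: "L2_continuous_on M {s..} V" "\<And>t. s \<le> t \<Longrightarrow> V t \<in> L2_adapted M F t"
  shows "\<exists>X. solves B S s z V X"
proof -
  have Bc: "L2_continuous_on M {s..} (\<lambda>t. B t (V t))" "L2_continuous_on M {s..} (\<lambda>t. S t (V t))"
    using B S V unfolding admissible_coeff_def by blast+
  have Ba: "B t (V t) \<in> L2_adapted M F t" "S t (V t) \<in> L2_adapted M F t" if "s \<le> t" for t
    using B S V(2)[OF that] that unfolding admissible_coeff_def by blast+
  have "\<exists>Y. Y \<in> L2_adapted M F t \<and> has_L2_integral M (\<lambda>r. B r (V r)) s t Y" if "s \<le> t" for t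
  proof -
    have "\<exists>Y\<in>L2_adapted M F t. has_L2_integral M (\<lambda>r. B r (V r)) s t Y"
    proof (rule L2_integral_exists[OF that])
      show "L2_continuous_on M {s..t} (\<lambda>r. B r (V r))" by (rule L2_continuous_on_subset[OF Bc(1)]) auto
      show "B r (V r) \<in> L2_adapted M F t" if "r \<in> {s..t}" for r
        using adapted_mono[OF Ba(1)[of r], of t] that s by auto
    qed (use s that in auto)
    then show ?thesis by blast
  qed
  then obtain Y where Y: "\<And>t. s \<le> t \<Longrightarrow> Y t \<in> L2_adapted M F t \<and> has_L2_integral M (\<lambda>r. B r (V r)) s t (Y t)"
    by metis
  have "\<exists>Z. Z \<in> L2_adapted M F t \<and> has_ito_integral M F W (\<lambda>r. S r (V r)) s t Z" if "s \<le> t" for t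
  proof -
    have "L2_continuous_on M {s..t} (\<lambda>r. S r (V r))" by (rule L2_continuous_on_subset[OF Bc(2)]) auto
    from ito_integral_exists[OF s that this] Ba(2) show ?thesis by auto
  qed
  then obtain Z where Z: "\<And>t. s \<le> t \<Longrightarrow> Z t \<in> L2_adapted M F t \<and> has_ito_integral M F W (\<lambda>r. S r (V r)) s t (Z t)"
    by metis
  define X where "X = (\<lambda>t w. z w + Y t w + Z t w)"
  have Xa: "X t \<in> L2_adapted M F t" if "s \<le> t" for t
    unfolding X_def using Y[OF that] Z[OF that] adapted_mono[OF z s that] by (intro adapted_add) auto
  have eq: "\<exists>Y Z. has_L2_integral M (\<lambda>r. B r (V r)) s t Y \<and> has_ito_integral M F W (\<lambda>r. S r (V r)) s t Z \<and>
       (AE w in M. X t w = z w + Y w + Z w)" if "s \<le> t" for t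
    using Y[OF that] Z[OF that] by (intro exI[of _ "Y t"] exI[of _ "Z t"]) (simp add: X_def)
  have "ito_process s X (\<lambda>t. B t (V t)) (\<lambda>t. S t (V t))"
    by (rule ito_processI(1)[OF s Xa Bc eq])
  then have "L2_continuous_on M {s..} X" by (rule ito_process_continuous)
  then show ?thesis unfolding solves_def using Xa eq by blast
qed

lemma solves_contraction:
  assumes s: "0 \<le> s" and B: "admissible_coeff s B" and S: "admissible_coeff s S"
    and X: "solves B S s z V X" "L2_continuous_on M {s..} V" and X': "solves B S s z V' X'" "L2_continuous_on M {s..} V'"
    and LB: "L2_lipschitz_on s T B L" and LS: "L2_lipschitz_on s T S L" and t: "s \<le> t" "t \<le> T"
  shows "(L2_dist M (X t) (X' t))\<^sup>2 \<le> 2 * (T - s + 1) * L\<^sup>2 * integral {s..t} (\<lambda>r. (L2_dist M (V r) (V' r))\<^sup>2)"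
proof -
  note P = solves_ito_process[OF X(1) s B S X(2)] and P' = solves_ito_process[OF X'(1) s B S X'(2)]
  have init: "AE w in M. X s w = X' s w" using P(2) P'(2) by eventually_elim simp
  have VL: "V r \<in> L2 M" "V' r \<in> L2 M" if "r \<in> {s..t}" for r
    using L2_continuous_onD[OF X(2)] L2_continuous_onD[OF X'(2)] that by auto
  have i: "(\<lambda>r. (L2_dist M (V r) (V' r))\<^sup>2) integrable_on {s..t}"
    unfolding L2_dist_norm
    by (intro integrable_continuous_interval L2_continuous_on_norm_square L2_continuous_on_diff
        L2_continuous_on_subset[OF X(2)] L2_continuous_on_subset[OF X'(2)]) auto
  have "0 \<le> L" using LB by (simp add: L2_lipschitz_on_def)
  then show ?thesis
    unfolding L2_dist_norm[of M "X t"]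
    by (rule ito_process_diff_lipschitz[OF P(1) P'(1) init t])
      (use LB LS t VL i in \<open>auto simp: L2_lipschitz_on_def L2_dist_norm\<close>)
qed

text \<open>Exponentially weighted estimates give a geometric rate on every horizon, so a single
  iteration works for all t >= s and no local solutions have to be pasted together.\<close>

theorem picard_existence:
  fixes B S :: "real \<Rightarrow> ('w \<Rightarrow> 'b::euclidean_space) \<Rightarrow> ('w \<Rightarrow> 'b)"
  assumes s: "0 \<le> s" and z: "z \<in> L2_adapted M F s" and B: "admissible_coeff s B" and S: "admissible_coeff s S"
  shows "\<exists>X. solves B S s z X X"
proof -
  define good where "good = (\<lambda>X :: real \<Rightarrow> 'w \<Rightarrow> 'b. L2_continuous_on M {s..} X \<and> (\<forall>t\<ge>s. X t \<in> L2_adapted M F t))"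
  have goodI: "good X" if "solves B S s z V X" for V X using that by (auto simp: good_def solves_def)
  have "\<exists>X. good V \<longrightarrow> solves B S s z V X" for V
    using picard_step[OF s z B S, of V] by (auto simp: good_def)
  then obtain N where N: "\<And>V. good V \<Longrightarrow> solves B S s z V (N V)" by metis
  define X where "X = (\<lambda>k. (N ^^ k) (\<lambda>t. z))"
  have X0: "good (X 0)"
    using adapted_mono[OF z s] adapted_L2[OF z] by (auto simp: X_def good_def L2_continuous_on_const)
  have Xs: "X (Suc k) = N (X k)" for k by (simp add: X_def)
  have Xg: "good (X k)" for k
    by (induction k) (auto simp: X0 Xs intro: goodI N)
  have Xsol: "solves B S s z (X k) (X (Suc k))" for k unfolding Xs by (rule N[OF Xg])
  have Xc: "L2_continuous_on M {s..} (X k)" for k using Xg by (simp add: good_def)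
  have XA: "X k t \<in> L2_adapted M F t" if "s \<le> t" for k t using Xg that by (simp add: good_def)
  have XL: "X k t \<in> L2 M" if "s \<le> t" for k t using adapted_L2[OF XA[OF that]] .
  have "\<exists>E\<ge>0. \<forall>k. \<forall>t\<in>{s..T}. L2_dist M (X (Suc k) t) (X k t) \<le> E * (1/2) ^ k" for T
  proof -
    obtain L where LB: "L2_lipschitz_on s T B L" "L2_lipschitz_on s T S L"
      using admissible_lipschitz[OF B S] .
    define C where "C = \<bar>2 * (T - s + 1) * L\<^sup>2\<bar>"
    \<comment> \<open>Integrating exp(l (r - s)) gains 1 / l, so squared distances shrink by C / l
      <= 1/4 per iteration and distances by 1/2.\<close>
    define l where "l = 4 * C + 1"
    have l: "0 < l" "C / l \<le> 1 / 4" by (auto simp: l_def C_def divide_le_eq add_pos_nonneg intro: add_nonneg_pos)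
    obtain D where D: "0 < D" "\<And>t. t \<in> {s..T} \<Longrightarrow> L2_norm M (\<lambda>w. X (Suc 0) t w - X 0 t w) \<le> D"
      using L2_continuous_on_bounded[OF L2_continuous_on_subset[OF L2_continuous_on_diff[OF Xc Xc]], of s T "Suc 0" 0] by auto
    have key: "(L2_dist M (X (Suc k) t) (X k t))\<^sup>2 \<le> D\<^sup>2 * (1/4) ^ k * exp (l * (t - s))" if "t \<in> {s..T}" for k t
      using that
    proof (induction k arbitrary: t)
      case 0
      have "(L2_dist M (X (Suc 0) t) (X 0 t))\<^sup>2 \<le> D\<^sup>2"
        unfolding L2_dist_norm by (intro power_mono D 0 L2_norm_nonneg)
      also have "\<dots> \<le> D\<^sup>2 * exp (l * (t - s))" using 0 l by (simp add: mult_le_cancel_left1)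
      finally show ?case by simp
    next
      case (Suc k)
      then have t: "s \<le> t" "t \<le> T" by auto
      define a where "a = D\<^sup>2 * (1/4) ^ k"
      have a: "0 \<le> a" by (simp add: a_def)
      have i: "(\<lambda>r. (L2_dist M (X (Suc k) r) (X k r))\<^sup>2) integrable_on {s..t}"
        unfolding L2_dist_norm
        by (intro integrable_continuous_interval L2_continuous_on_norm_square L2_continuous_on_diff L2_continuous_on_subset[OF Xc]) auto
      have "((\<lambda>r. a * exp (l * (r - s))) has_integral a * exp (l * (t - s)) / l - a * exp (l * (s - s)) / l) {s..t}"
        by (rule fundamental_theorem_of_calculus)
          (use t l in \<open>auto intro!: derivative_eq_intros simp flip: has_real_derivative_iff_has_vector_derivative\<close>)
      from has_integral_le[OF integrable_integral[OF i] this]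
      have "integral {s..t} (\<lambda>r. (L2_dist M (X (Suc k) r) (X k r))\<^sup>2) \<le> a * exp (l * (t - s)) / l - a * exp (l * (s - s)) / l"
        using Suc.IH t by (auto simp: a_def)
      also have "\<dots> \<le> a * exp (l * (t - s)) / l" using a l by simp
      finally have I: "integral {s..t} (\<lambda>r. (L2_dist M (X (Suc k) r) (X k r))\<^sup>2) \<le> a * exp (l * (t - s)) / l" .
      have "(L2_dist M (X (Suc (Suc k)) t) (X (Suc k) t))\<^sup>2 \<le> 2 * (T - s + 1) * L\<^sup>2 * integral {s..t} (\<lambda>r. (L2_dist M (X (Suc k) r) (X k r))\<^sup>2)"
        by (rule solves_contraction[OF s B S Xsol Xc Xsol Xc LB t])
      also have "\<dots> \<le> C * integral {s..t} (\<lambda>r. (L2_dist M (X (Suc k) r) (X k r))\<^sup>2)"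
        unfolding C_def by (rule mult_right_mono[OF abs_ge_self integral_nonneg[OF i]]) simp
      also have "\<dots> \<le> C * (a * exp (l * (t - s)) / l)"
        by (rule mult_left_mono[OF I]) (simp add: C_def)
      also have "\<dots> = C / l * (a * exp (l * (t - s)))" by simp
      also have "\<dots> \<le> 1 / 4 * (a * exp (l * (t - s)))" using a by (intro mult_right_mono l) simp
      finally show ?case by (simp add: a_def)
    qed
    define E where "E = D * exp (l * (T - s) / 2)"
    have "L2_dist M (X (Suc k) t) (X k t) \<le> E * (1/2) ^ k" if t: "t \<in> {s..T}" for k t
    proof (rule power2_le_imp_le)
      have "(L2_dist M (X (Suc k) t) (X k t))\<^sup>2 \<le> D\<^sup>2 * (1/4) ^ k * exp (l * (t - s))" by (rule key[OF t])
      also have "\<dots> \<le> D\<^sup>2 * (1/4) ^ k * exp (l * (T - s))" using t l by (intro mult_left_mono) auto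
      also have "exp (l * (T - s)) = (exp (l * (T - s) / 2))\<^sup>2" by (simp add: power2_eq_square flip: exp_add)
      also have "(1/4::real) ^ k = ((1/2) ^ k)\<^sup>2" by (simp add: power2_eq_square flip: power_mult_distrib)
      finally show "(L2_dist M (X (Suc k) t) (X k t))\<^sup>2 \<le> (E * (1/2) ^ k)\<^sup>2"
        by (simp add: E_def power_mult_distrib mult_ac)
    qed (use D in \<open>simp add: E_def\<close>)
    moreover have "0 \<le> E" using D by (simp add: E_def)
    ultimately show ?thesis by blast
  qed
  then obtain E where E: "\<And>T. 0 \<le> E T" "\<And>T k t. t \<in> {s..T} \<Longrightarrow> L2_dist M (X (Suc k) t) (X k t) \<le> E T * (1/2) ^ k"
    by metis
  have close: "L2_dist M (X (i + n) t) (X i t) \<le> 2 * E T * (1/2) ^ i * (1 - (1/2) ^ n)" if t: "t \<in> {s..T}" for i n t T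
  proof (induction n)
    case (Suc n)
    have st: "s \<le> t" using t by simp
    have "L2_dist M (X (i + Suc n) t) (X i t) \<le> L2_dist M (X (Suc (i + n)) t) (X (i + n) t) + L2_dist M (X (i + n) t) (X i t)"
      using L2_dist_triangle[OF XL[OF st] XL[OF st] XL[OF st], of "Suc (i + n)" i "i + n"] by simp
    also have "\<dots> \<le> E T * (1/2) ^ (i + n) + 2 * E T * (1/2) ^ i * (1 - (1/2) ^ n)"
      by (intro add_mono E t Suc.IH)
    also have "\<dots> = 2 * E T * (1/2) ^ i * (1 - (1/2) ^ Suc n)" by (simp add: power_add algebra_simps)
    finally show ?case .
  qed simp
  have close': "L2_dist M (X j t) (X i t) \<le> 2 * E T * (1/2) ^ i" if t: "t \<in> {s..T}" and ij: "i \<le> j" for i j t T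
  proof -
    have "L2_dist M (X j t) (X i t) \<le> 2 * E T * (1/2) ^ i * (1 - (1/2) ^ (j - i))" using close[OF t, of i "j - i"] ij by simp
    also have "\<dots> \<le> 2 * E T * (1/2) ^ i * 1" by (intro mult_left_mono) (auto simp: E(1))
    finally show ?thesis by simp
  qed
  have small: "(\<lambda>i. 2 * E T * (1/2) ^ i) \<longlonglongrightarrow> 0" for T
    by (auto intro!: tendsto_eq_intros LIMSEQ_power_zero)
  have "\<exists>Y\<in>L2_adapted M F t. (\<lambda>k. L2_dist M (X k t) Y) \<longlonglongrightarrow> 0" if t: "s \<le> t" for t
  proof (rule L2_adapted_complete)
    show "0 \<le> t" using s t by simp
    show "X k t \<in> L2_adapted M F t" for k by (rule XA[OF t])
    fix e :: real assume "0 < e"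
    then obtain N where "\<forall>i\<ge>N. norm (2 * E t * (1/2) ^ i - 0) < e / 2"
      using LIMSEQ_D[OF small[of t], of "e / 2"] by auto
    then have N: "2 * E t * (1/2) ^ N < e / 2" by auto
    have "L2_dist M (X i t) (X j t) < e" if "i \<ge> N" "j \<ge> N" for i j
      using L2_dist_triangle[OF XL[OF t] XL[OF t] XL[OF t], of i j N] close'[of t t N i] close'[of t t N j] that N t
      by (simp add: L2_dist_commute)
    then show "\<exists>N. \<forall>i\<ge>N. \<forall>j\<ge>N. L2_dist M (X i t) (X j t) < e" by blast
  qed
  \<comment> \<open>The limit is picked at each t by completeness; its continuity in t will come
    from the rate \<open>Yclose\<close>, which is uniform on each horizon.\<close>
  then obtain Y where YA: "\<And>t. s \<le> t \<Longrightarrow> Y t \<in> L2_adapted M F t"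
    and Ylim: "\<And>t. s \<le> t \<Longrightarrow> (\<lambda>k. L2_dist M (X k t) (Y t)) \<longlonglongrightarrow> 0" by metis
  have YL: "Y t \<in> L2 M" if "s \<le> t" for t using adapted_L2[OF YA[OF that]] .
  have Yclose: "L2_dist M (X i t) (Y t) \<le> 2 * E T * (1/2) ^ i" if t: "t \<in> {s..T}" for i t T
  proof -
    have st: "s \<le> t" using t by simp
    have "(\<lambda>j. 2 * E T * (1/2) ^ i + L2_dist M (X j t) (Y t)) \<longlonglongrightarrow> 2 * E T * (1/2) ^ i + 0"
      by (intro tendsto_intros Ylim st)
    moreover have "\<forall>\<^sub>F j in sequentially. L2_dist M (X i t) (Y t) \<le> 2 * E T * (1/2) ^ i + L2_dist M (X j t) (Y t)"
      using eventually_ge_at_top[of i]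
    proof eventually_elim
      case (elim j)
      show ?case using L2_dist_triangle[OF XL[OF st] XL[OF st] YL[OF st], of i j] close'[OF t elim]
        by (simp add: L2_dist_commute)
    qed
    ultimately show ?thesis by (intro tendsto_lowerbound) auto
  qed
  have Yc: "L2_continuous_on M {s..} Y"
    unfolding L2_continuous_on_def
  proof (intro conjI ballI)
    show "Y t \<in> L2 M" if "t \<in> {s..}" for t using YL that by simp
    fix t assume "t \<in> {s..}"
    then have t: "s \<le> t" by simp
    show "((\<lambda>r. L2_dist M (Y r) (Y t)) \<longlongrightarrow> 0) (at t within {s..})"
    proof (rule tendstoI)
      fix e :: real assume e: "0 < e"
      obtain i where "\<forall>k\<ge>i. norm (2 * E (t + 1) * (1/2) ^ k - 0) < e / 3"
        using LIMSEQ_D[OF small[of "t + 1"], of "e / 3"] e by auto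
      then have i: "2 * E (t + 1) * (1/2) ^ i < e / 3" by auto
      have "((\<lambda>r. L2_dist M (X i r) (X i t)) \<longlongrightarrow> 0) (at t within {s..})"
        using Xc[of i] t by (simp add: L2_continuous_on_def)
      then have "\<forall>\<^sub>F r in at t within {s..}. dist (L2_dist M (X i r) (X i t)) 0 < e / 3"
        using e by (intro tendstoD) auto
      moreover have "\<forall>\<^sub>F r in at t within {s..}. r \<in> {s..} \<and> r \<le> t + 1"
        by (auto simp: eventually_at dist_real_def intro!: exI[of _ 1])
      ultimately show "\<forall>\<^sub>F r in at t within {s..}. dist (L2_dist M (Y r) (Y t)) 0 < e"
      proof eventually_elim
        case (elim r)
        then have r: "s \<le> r" "r \<in> {s..t+1}" "t \<in> {s..t+1}" using t by auto
        have "L2_dist M (Y r) (Y t) \<le> L2_dist M (Y r) (X i r) + (L2_dist M (X i r) (X i t) + L2_dist M (X i t) (Y t))"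
          using L2_dist_triangle[OF YL[OF r(1)] XL[OF r(1)] YL[OF t], of i] L2_dist_triangle[OF XL[OF r(1)] XL[OF t] YL[OF t], of i i]
          by linarith
        also have "\<dots> < e"
          using Yclose[OF r(2), of i] Yclose[OF r(3), of i] elim(1) i by (simp add: L2_dist_commute[of M "Y r"])
        finally show ?case by simp
      qed
    qed
  qed
  \<comment> \<open>\<open>V\<close> is the Picard image of the limit. The iterates converge to both
    \<open>Y t\<close> and \<open>V t\<close>, so these agree almost surely; as the equation is an
    almost sure identity whose integrands already contain \<open>Y\<close>, it carries over to
    \<open>Y\<close>.\<close>
  obtain V where V: "solves B S s z Y V" using picard_step[OF s z B S Yc YA] by blast
  have VY: "AE w in M. Y t w = V t w" if t: "s \<le> t" for t
  proof -
    obtain L where LB: "L2_lipschitz_on s t B L" "L2_lipschitz_on s t S L"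
      using admissible_lipschitz[OF B S] .
    have VL: "V t \<in> L2 M" using V t by (auto simp: solves_def intro: adapted_L2)
    define c where "c = 2 * (t - s + 1) * L\<^sup>2"
    have c: "0 \<le> c" using t by (simp add: c_def)
    have le0: "(L2_dist M (X (Suc i) t) (V t))\<^sup>2 \<le> c * ((2 * E t * (1/2) ^ i)\<^sup>2 * (t - s))" for i
    proof -
      have ii: "(\<lambda>r. (L2_dist M (X i r) (Y r))\<^sup>2) integrable_on {s..t}"
        unfolding L2_dist_norm
        by (intro integrable_continuous_interval L2_continuous_on_norm_square L2_continuous_on_diff
            L2_continuous_on_subset[OF Xc] L2_continuous_on_subset[OF Yc]) auto
      have "((\<lambda>r. (2 * E t * (1/2) ^ i)\<^sup>2) has_integral (2 * E t * (1/2) ^ i)\<^sup>2 * (t - s)) {s..t}"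
        using has_integral_const_real[of "(2 * E t * (1/2) ^ i)\<^sup>2" s t] t by (simp add: mult.commute)
      then have "integral {s..t} (\<lambda>r. (L2_dist M (X i r) (Y r))\<^sup>2) \<le> (2 * E t * (1/2) ^ i)\<^sup>2 * (t - s)"
        by (rule has_integral_le[OF integrable_integral[OF ii]]) (intro power_mono Yclose L2_dist_nonneg)
      with solves_contraction[OF s B S Xsol Xc V Yc LB t order_refl, of i, folded c_def] c
      show ?thesis by (blast intro: order_trans mult_left_mono)
    qed
    have "(\<lambda>i. c * ((2 * E t * (1/2) ^ i)\<^sup>2 * (t - s))) \<longlonglongrightarrow> c * (0\<^sup>2 * (t - s))"
      by (intro tendsto_intros small)
    then have lim0: "(\<lambda>i. c * ((2 * E t * (1/2) ^ i)\<^sup>2 * (t - s))) \<longlonglongrightarrow> 0" by simp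
    have "(\<lambda>i. (L2_dist M (X (Suc i) t) (V t))\<^sup>2) \<longlonglongrightarrow> 0"
      by (rule tendsto_sandwich[OF _ _ tendsto_const lim0]) (use le0 in \<open>simp_all\<close>)
    from tendsto_real_sqrt[OF this] have "(\<lambda>i. L2_dist M (X (Suc i) t) (V t)) \<longlonglongrightarrow> 0" by simp
    moreover have "(\<lambda>i. L2_dist M (X (Suc i) t) (Y t)) \<longlonglongrightarrow> 0"
      using LIMSEQ_Suc[OF Ylim[OF t]] .
    ultimately show ?thesis
      by (intro L2_dist_limit_unique[of "\<lambda>i. X (Suc i) t"] XL YL VL t)
  qed
  have "solves B S s z Y Y"
    unfolding solves_def
  proof (intro conjI allI impI YA Yc)
    fix t assume t: "s \<le> t"
    obtain J I where JI: "has_L2_integral M (\<lambda>r. B r (Y r)) s t J" "has_ito_integral M F W (\<lambda>r. S r (Y r)) s t I"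
      "AE w in M. V t w = z w + J w + I w" using V t unfolding solves_def by blast
    have "AE w in M. Y t w = z w + J w + I w" using JI(3) VY[OF t] by eventually_elim simp
    then show "\<exists>Ya Z. has_L2_integral M (\<lambda>r. B r (Y r)) s t Ya \<and> has_ito_integral M F W (\<lambda>r. S r (Y r)) s t Z \<and>
      (AE w in M. Y t w = z w + Ya w + Z w)" using JI by blast
  qed
  then show ?thesis by blast
qed

end

section \<open>The linear flow\<close>

lemma bounded_bilinear_matrix_vector: "bounded_bilinear ((*v) :: real^'n^'m \<Rightarrow> real^'n \<Rightarrow> real^'m)"
  unfolding bilinear_conv_bounded_bilinear[symmetric] bilinear_def
  by (auto intro!: linearI simp: matrix_vector_right_distrib matrix_vector_mult_add_rdistrib
      scaleR_matrix_vector_assoc matrix_vector_mult_scaleR)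

lemma bounded_bilinear_matrix_matrix:
  "bounded_bilinear ((**) :: real^'n^'m \<Rightarrow> real^'k^'n \<Rightarrow> real^'k^'m)"
  unfolding bilinear_conv_bounded_bilinear[symmetric] bilinear_def
  by (auto intro!: linearI simp: matrix_add_ldistrib matrix_matrix_mult_def vec_eq_iff
      algebra_simps sum.distrib sum_distrib_left)

lemma norm_matrix_vector_le: "norm (A *v x) \<le> matrix_norm A * norm x"
  unfolding matrix_norm_def by (rule onorm[OF matrix_vector_mul_bounded_linear])

lemma matrix_norm_nonneg: "0 \<le> matrix_norm A"
  unfolding matrix_norm_def by (rule onorm_pos_le[OF matrix_vector_mul_bounded_linear])

text \<open>Links the operator norm of the hypotheses with the Frobenius norm in which matrix-valued
  random variables are measured.\<close>

lemma matrix_norm_le_norm: "\<exists>C\<ge>0. \<forall>A :: real^'n^'n. matrix_norm A \<le> C * norm A"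
proof -
  interpret bounded_bilinear "(*v) :: real^'n^'n \<Rightarrow> real^'n \<Rightarrow> real^'n" by (rule bounded_bilinear_matrix_vector)
  obtain C where C: "0 \<le> C" "\<And>(A :: real^'n^'n) x. norm (A *v x) \<le> norm A * norm x * C"
    using nonneg_bounded by blast
  have "matrix_norm A \<le> C * norm A" for A :: "real^'n^'n"
    unfolding matrix_norm_def by (rule onorm_le) (use C in \<open>simp add: mult_ac\<close>)
  with C(1) show ?thesis by blast
qed

lemma continuous_on_matrix_norm:
  assumes "continuous_on S A"
  shows "continuous_on S (\<lambda>t. matrix_norm (A t :: real^'n^'n))"
proof -
  obtain C where C: "0 \<le> C" "\<And>A :: real^'n^'n. matrix_norm A \<le> C * norm A"
    using matrix_norm_le_norm by blast
  have tri: "matrix_norm A \<le> matrix_norm B + C * norm (A - B)" for A B :: "real^'n^'n"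
  proof -
    have "matrix_norm A = onorm (\<lambda>x. B *v x + (A - B) *v x)"
      by (simp add: matrix_norm_def matrix_vector_mult_diff_rdistrib)
    also have "\<dots> \<le> matrix_norm B + matrix_norm (A - B)"
      unfolding matrix_norm_def by (intro onorm_triangle matrix_vector_mul_bounded_linear)
    finally show ?thesis using C(2)[of "A - B"] by simp
  qed
  show ?thesis
    unfolding continuous_on_def
  proof
    fix t assume t: "t \<in> S"
    show "((\<lambda>t. matrix_norm (A t)) \<longlongrightarrow> matrix_norm (A t)) (at t within S)"
    proof (rule metric_tendsto_imp_tendsto)
      have "(A \<longlongrightarrow> A t) (at t within S)" using assms t by (simp add: continuous_on_def)
      then show "((\<lambda>r. C * norm (A r - A t)) \<longlongrightarrow> 0) (at t within S)" by (auto intro!: tendsto_eq_intros)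
      show "\<forall>\<^sub>F r in at t within S. dist (matrix_norm (A r)) (matrix_norm (A t)) \<le> dist (C * norm (A r - A t)) 0"
        using tri[of "A _" "A t"] tri[of "A t" "A _"] C(1)
        by (intro always_eventually allI) (simp add: dist_real_def norm_minus_commute abs_le_iff algebra_simps)
    qed
  qed
qed

lemma matrix_norm_bounded:
  assumes "continuous_on {0..} (A :: real \<Rightarrow> real^'n^'n)"
  obtains B where "0 \<le> B" "\<And>t. t \<in> {0..T} \<Longrightarrow> matrix_norm (A t) \<le> B"
proof -
  have "bounded ((\<lambda>t. matrix_norm (A t)) ` {0..T})"
    by (intro compact_imp_bounded compact_continuous_image continuous_on_matrix_norm continuous_on_subset[OF assms] compact_Icc) auto
  then obtain B where "\<forall>x\<in>(\<lambda>t. matrix_norm (A t)) ` {0..T}. norm x \<le> B" unfolding bounded_iff by blast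
  then have "\<forall>t\<in>{0..T}. \<bar>matrix_norm (A t)\<bar> \<le> B" by simp
  then have "matrix_norm (A t) \<le> max 0 B" if "t \<in> {0..T}" for t
    using that by (meson abs_le_D1 max.coboundedI2)
  then show ?thesis using that[of "max 0 B"] by simp
qed

text \<open>Here \<epsilon> will be a fixed fraction of q \<alpha> - \<beta>, so the growth of the
  coefficients costs only part of the available decay.\<close>

lemma matrix_norm_subexponential:
  assumes A: "continuous_on {0..} (A :: real \<Rightarrow> real^'n^'n)"
    and lim: "Limsup at_top (\<lambda>t. ereal (log_plus (matrix_norm (A t)) / t)) = 0" and \<epsilon>: "0 < \<epsilon>"
  obtains C where "0 < C" "\<And>t. 0 \<le> t \<Longrightarrow> matrix_norm (A t) \<le> C * exp (\<epsilon> * t)"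
proof -
  have "Limsup at_top (\<lambda>t. ereal (log_plus (matrix_norm (A t)) / t)) < ereal \<epsilon>" using lim \<epsilon> by simp
  then have "\<forall>\<^sub>F t in at_top. ereal (log_plus (matrix_norm (A t)) / t) < ereal \<epsilon>" by (rule Limsup_lessD)
  then have "\<forall>\<^sub>F t in at_top. log_plus (matrix_norm (A t)) / t < \<epsilon>" by simp
  then obtain T where T: "\<And>t. t \<ge> T \<Longrightarrow> log_plus (matrix_norm (A t)) / t < \<epsilon>"
    unfolding eventually_at_top_linorder by blast
  \<comment> \<open>Going up to at least 1 ensures t > 0 in the remaining range, where the quotient
    by t is multiplied out; since B + 1 >= 1, one constant then serves both ranges.\<close>
  obtain B where B: "0 \<le> B" "\<And>t. t \<in> {0..max T 1} \<Longrightarrow> matrix_norm (A t) \<le> B"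
    using matrix_norm_bounded[OF A, of "max T 1"] by blast
  have "matrix_norm (A t) \<le> (B + 1) * exp (\<epsilon> * t)" if t: "0 \<le> t" for t
  proof (cases "t \<le> max T 1")
    case True
    then have "matrix_norm (A t) \<le> B + 1" using B(2)[of t] t by simp
    also have "\<dots> \<le> (B + 1) * exp (\<epsilon> * t)" using B(1) \<epsilon> t by (simp add: mult_le_cancel_left1)
    finally show ?thesis .
  next
    case False
    then have "log_plus (matrix_norm (A t)) / t < \<epsilon>" "0 < t" using T[of t] by auto
    then have "log_plus (matrix_norm (A t)) < \<epsilon> * t" by (simp add: field_simps)
    then have ln: "ln (matrix_norm (A t)) < \<epsilon> * t" by (simp add: log_plus_def)
    have "matrix_norm (A t) \<le> exp (\<epsilon> * t)"
    proof (cases "matrix_norm (A t) = 0")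
      case False
      then have "0 < matrix_norm (A t)" using matrix_norm_nonneg[of "A t"] by simp
      then show ?thesis using ln by (metis exp_ln exp_less_mono less_imp_le)
    qed simp
    also have "\<dots> \<le> (B + 1) * exp (\<epsilon> * t)" using B(1) by (simp add: mult_le_cancel_right1)
    finally show ?thesis .
  qed
  with B(1) show ?thesis using that[of "B + 1"] by simp
qed

lemma brownian_basisI:
  assumes "prob_space M" and F: "filtration_on M I F" and W: "brownian_motion_on M I F W" and I: "{0..} \<subseteq> I"
  shows "brownian_basis M F W"
proof -
  interpret prob_space M by fact
  have i: "t \<in> I" if "0 \<le> t" for t using that I by auto
  note F' = F[unfolded filtration_on_def] and W' = W[unfolded brownian_motion_on_def]
  show ?thesis
  proof
    fix s t :: real
    show "subalgebra M (F t)" if "0 \<le> t" using F' i[OF that] by blast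
    show "W t \<in> borel_measurable M" if "0 \<le> t" using W' i[OF that] by blast
    assume s: "0 \<le> s"
    show "sets (F s) \<subseteq> sets (F t)" if "s \<le> t"
      using F' i[OF s] i[OF order_trans[OF s that]] that by blast
    show "(\<lambda>w. W t w - W s w) \<in> borel_measurable (F t)" if "s \<le> t"
      using W' i[OF s] i[OF order_trans[OF s that]] that by blast
    show "distributed M lborel (\<lambda>w. W t w - W s w) (normal_density 0 (sqrt (t - s)))"
      "indep_set (sets (F s)) {(\<lambda>w. W t w - W s w) -` B \<inter> space M | B. B \<in> sets borel}" if "s < t"
      using W' i[OF s] i[OF order_trans[OF s less_imp_le[OF that]]] that by blast+
  qed
qed

lemma L2_norm_matrix_vector:
  assumes "X \<in> L2 M"
  shows "L2_norm M (\<lambda>w. A *v X w) \<le> matrix_norm A * L2_norm M X"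
  by (rule L2_norm_linear[OF matrix_vector_mul_bounded_linear norm_matrix_vector_le matrix_norm_nonneg assms])

context brownian_basis
begin

text \<open>Evaluating a matrix at a fixed x is linear, and linear images of Ito processes are Ito
  processes.\<close>

lemma fundamental_matrix_linear_process:
  fixes A G :: "real \<Rightarrow> real^'n^'n"
  assumes \<Phi>: "fundamental_matrix M I F W A G \<Phi>" and I: "{0..} \<subseteq> I" and s: "0 \<le> s"
    and A: "continuous_on {0..} A" and G: "continuous_on {0..} G"
    and \<Psi>_def: "\<Psi> = (\<lambda>t w. \<Phi> t w ** matrix_inv (\<Phi> s w))"
  shows "linear_process A G s (\<lambda>t w. \<Psi> t w *v x)" "AE w in M. \<Psi> s w *v x = x"
    "s \<le> t \<Longrightarrow> \<Psi> t \<in> L2 M"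
proof -
  have sol: "sde_solution M F W (\<lambda>t U w. A t ** U w) (\<lambda>t U w. G t ** U w) s (mat 1) \<Psi>"
    using \<Phi> I s unfolding fundamental_matrix_def \<Psi>_def by auto
  have \<Psi>a: "\<Psi> t \<in> L2_adapted M F t" if "s \<le> t" for t
    using sol that unfolding sde_solution_def by blast
  then have \<Psi>c: "L2_continuous_on M {s..} \<Psi>"
    using sol unfolding sde_solution_def L2_continuous_on_def by (auto intro: adapted_L2)
  show "\<Psi> t \<in> L2 M" if "s \<le> t" using adapted_L2[OF \<Psi>a[OF that]] .
  have c: "L2_continuous_on M {s..} (\<lambda>t w. A t ** \<Psi> t w)" "L2_continuous_on M {s..} (\<lambda>t w. G t ** \<Psi> t w)"
    using s by (auto intro!: L2_continuous_on_bilinear[OF bounded_bilinear_matrix_matrix _ \<Psi>c]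
        continuous_on_subset[OF A] continuous_on_subset[OF G])
  have eq: "\<exists>Y Z. has_L2_integral M (\<lambda>t w. A t ** \<Psi> t w) s t Y \<and> has_ito_integral M F W (\<lambda>t w. G t ** \<Psi> t w) s t Z \<and>
       (AE w in M. \<Psi> t w = (\<lambda>w. mat 1) w + Y w + Z w)" if "s \<le> t" for t
    using sol that unfolding sde_solution_def by blast
  have P: "ito_process s \<Psi> (\<lambda>t w. A t ** \<Psi> t w) (\<lambda>t w. G t ** \<Psi> t w)" "AE w in M. \<Psi> s w = mat 1"
    by (rule ito_processI[OF s \<Psi>a c eq]; assumption)+
  have T: "bounded_linear (\<lambda>N :: real^'n^'n. N *v x)"
    by (rule bounded_bilinear.bounded_linear_left[OF bounded_bilinear_matrix_vector])
  show "linear_process A G s (\<lambda>t w. \<Psi> t w *v x)"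
    using ito_process_linear[OF T P(1)] by (simp add: linear_process_def matrix_vector_mul_assoc)
  show "AE w in M. \<Psi> s w *v x = x" using P(2) by eventually_elim simp
qed

text \<open>For deterministic x the mean square of the solution is at most the contraction bound
  times the squared norm of x; \<open>linear_process_second_moment\<close> passes to the random
  value \<open>X s\<close>. The result is stated for norms because defects will be added in
  norm.\<close>

lemma linear_process_contraction:
  fixes A G :: "real \<Rightarrow> real^'n^'n"
  assumes \<Phi>: "fundamental_matrix M I F W A G \<Phi>" and I: "{0..} \<subseteq> I"
    and A: "continuous_on {0..} A" and G: "continuous_on {0..} G"
    and con: "nonuniform_ms_exp_contraction M I \<Phi> K \<alpha> \<beta>"
    and s: "0 \<le> s" "s \<le> t" and X: "linear_process A G s X"
  shows "L2_norm M (X t) \<le> sqrt K * exp ((- \<alpha> * (t - s) + \<beta> * s) / 2) * L2_norm M (X s)"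
proof -
  define \<Psi> where "\<Psi> = (\<lambda>t w. \<Phi> t w ** matrix_inv (\<Phi> s w))"
  note F = fundamental_matrix_linear_process[OF \<Phi> I s(1) A G \<Psi>_def]
  define \<kappa> where "\<kappa> = K * exp (- \<alpha> * (t - s) + \<beta> * s)"
  obtain C where C: "0 \<le> C" "\<And>A :: real^'n^'n. matrix_norm A \<le> C * norm A"
    using matrix_norm_le_norm by blast
  have meas: "(\<lambda>w. matrix_norm (\<Psi> t w)) \<in> borel_measurable M"
    using L2_measurable[OF F(3)[OF s(2)]]
      borel_measurable_continuous_onI[OF continuous_on_matrix_norm[OF continuous_on_id]] by (rule measurable_compose)
  have pt: "(matrix_norm N)\<^sup>2 \<le> C\<^sup>2 * (norm N)\<^sup>2" for N :: "real^'n^'n"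
    using power_mono[OF C(2)[of N] matrix_norm_nonneg, of 2] by (simp add: power_mult_distrib)
  \<comment> \<open>The integral of a non-integrable function is 0 by convention, so the contraction
    hypothesis carries information only together with integrability, which comes from
    \<open>\<Psi> t\<close> being in \<open>L2 M\<close>.\<close>
  have int: "integrable M (\<lambda>w. (matrix_norm (\<Psi> t w))\<^sup>2)"
  proof (rule Bochner_Integration.integrable_bound)
    show "integrable M (\<lambda>w. C\<^sup>2 * (norm (\<Psi> t w))\<^sup>2)"
      using L2_square_integrable[OF F(3)[OF s(2)]] by simp
    show "(\<lambda>w. (matrix_norm (\<Psi> t w))\<^sup>2) \<in> borel_measurable M" using meas by measurable
    show "AE w in M. norm ((matrix_norm (\<Psi> t w))\<^sup>2) \<le> norm (C\<^sup>2 * (norm (\<Psi> t w))\<^sup>2)"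
      by (rule AE_I2) (simp add: pt)
  qed
  have k: "(\<integral>w. (matrix_norm (\<Psi> t w))\<^sup>2 \<partial>M) \<le> \<kappa>"
  proof -
    have "s \<in> I" "t \<in> I" "\<bar>s\<bar> = s" using I s by auto
    moreover from this have "(\<integral>w. (matrix_norm (\<Phi> t w ** matrix_inv (\<Phi> s w)))\<^sup>2 \<partial>M)
        \<le> K * exp (- \<alpha> * (t - s) + \<beta> * \<bar>s\<bar>)"
      using con s(2) unfolding nonuniform_ms_exp_contraction_def by blast
    ultimately show ?thesis unfolding \<Psi>_def \<kappa>_def by simp
  qed
  have m: "(L2_norm M (\<lambda>w. \<Psi> t w *v x))\<^sup>2 \<le> (\<integral>w. (matrix_norm (\<Psi> t w))\<^sup>2 * (norm x)\<^sup>2 \<partial>M)" for x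
    unfolding L2_norm_square_integral
  proof (rule integral_mono)
    have "(\<lambda>w. \<Psi> t w *v x) \<in> L2 M"
      by (rule L2_linear[OF bounded_bilinear.bounded_linear_left[OF bounded_bilinear_matrix_vector] F(3)[OF s(2)]])
    then show "integrable M (\<lambda>w. (norm (\<Psi> t w *v x))\<^sup>2)" by (rule L2_square_integrable)
    show "(norm (\<Psi> t w *v x))\<^sup>2 \<le> (matrix_norm (\<Psi> t w))\<^sup>2 * (norm x)\<^sup>2" for w
      using power_mono[OF norm_matrix_vector_le norm_ge_zero, of "\<Psi> t w" x 2] by (simp add: power_mult_distrib)
  qed (use int in simp)
  have b: "(L2_norm M (\<lambda>w. \<Psi> t w *v x))\<^sup>2 \<le> \<kappa> * (norm x)\<^sup>2" for x
    using order_trans[OF m[unfolded Bochner_Integration.integral_mult_left_zero] mult_right_mono[OF k zero_le_power2]] .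
  have "(\<Sum>k\<in>UNIV. x $ k *\<^sub>R (\<Psi> t w *v axis k 1)) = \<Psi> t w *v x" for x w
  proof -
    have "\<Psi> t w *v x = \<Psi> t w *v (\<Sum>k\<in>UNIV. x $ k *\<^sub>R axis k 1)"
      using basis_expansion[of x] by (simp add: scalar_mult_eq_scaleR)
    then show ?thesis
      by (simp add: linear_sum[OF matrix_vector_mul_linear] matrix_vector_mult_scaleR)
  qed
  then have "(L2_norm M (X t))\<^sup>2 \<le> \<kappa> * (L2_norm M (X s))\<^sup>2"
    by (intro linear_process_second_moment[OF X F(1) F(2) continuous_on_subset[OF A] continuous_on_subset[OF G] s(2)])
      (use b s in simp_all)
  also have "\<dots> = (sqrt K * exp ((- \<alpha> * (t - s) + \<beta> * s) / 2) * L2_norm M (X s))\<^sup>2"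
  proof -
    have "(exp ((- \<alpha> * (t - s) + \<beta> * s) / 2))\<^sup>2 = exp (- \<alpha> * (t - s) + \<beta> * s)"
      by (simp add: power2_eq_square flip: exp_add)
    moreover have "0 < K" using con by (simp add: nonuniform_ms_exp_contraction_def)
    ultimately show ?thesis by (simp add: \<kappa>_def power_mult_distrib)
  qed
  finally show ?thesis
    by (rule power2_le_imp_le) (use con in \<open>simp add: nonuniform_ms_exp_contraction_def\<close>)
qed

lemma admissible_matrix:
  assumes A: "continuous_on {0..} (A :: real \<Rightarrow> real^'n^'n)" and s: "0 \<le> s"
  shows "admissible_coeff s (\<lambda>t U w. A t *v U w)"
  unfolding admissible_coeff_def
proof (intro conjI allI impI ballI)
  show "(\<lambda>w. A t *v U w) \<in> L2_adapted M F t" if "U \<in> L2_adapted M F t" for t U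
    by (rule adapted_linear[OF matrix_vector_mul_bounded_linear that])
  show "L2_continuous_on M {s..} (\<lambda>t w. A t *v X t w)" if "L2_continuous_on M {s..} X" for X
    by (rule L2_continuous_on_bilinear[OF bounded_bilinear_matrix_vector continuous_on_subset[OF A] that]) (use s in auto)
  fix T
  obtain B where B: "0 \<le> B" "\<And>t. t \<in> {0..T} \<Longrightarrow> matrix_norm (A t) \<le> B"
    using matrix_norm_bounded[OF A, of T] by blast
  have "L2_dist M (\<lambda>w. A t *v U w) (\<lambda>w. A t *v V w) \<le> B * L2_dist M U V"
    if "t \<in> {s..T}" "U \<in> L2 M" "V \<in> L2 M" for t U V
    using L2_norm_matrix_vector[OF L2_diff[OF that(2,3)], of "A t"] mult_right_mono[OF B(2)[of t] L2_norm_nonneg, of M "\<lambda>w. U w - V w"] that s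
    by (simp add: L2_dist_norm matrix_vector_mult_diff_distrib)
  with B(1) show "\<exists>L. L2_lipschitz_on s T (\<lambda>t U w. A t *v U w) L"
    unfolding L2_lipschitz_on_def by blast
qed

text \<open>Solutions with a random initial value come from Picard iteration and not as fundamental
  matrix times \<open>z\<close>: a product of two square integrable factors need not be square
  integrable.\<close>

lemma linear_process_exists:
  assumes A: "continuous_on {0..} (A :: real \<Rightarrow> real^'n^'n)" and G: "continuous_on {0..} G"
    and s: "0 \<le> s" and z: "z \<in> L2_adapted M F s"
  shows "\<exists>Y. linear_process A G s Y \<and> (AE w in M. Y s w = z w)"
proof -
  note adm = admissible_matrix[OF A s] admissible_matrix[OF G s]
  obtain Y where Y: "solves (\<lambda>t U w. A t *v U w) (\<lambda>t U w. G t *v U w) s z Y Y"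
    using picard_existence[OF s z adm] by blast
  then have "L2_continuous_on M {s..} Y" by (simp add: solves_def)
  from solves_ito_process[OF Y s adm this] show ?thesis unfolding linear_process_def by blast
qed

lemma linear_process_diff:
  assumes X: "linear_process A G s X" and Y: "linear_process A G s Y"
  shows "linear_process A G s (\<lambda>t w. X t w - Y t w)"
proof -
  have a: "(\<lambda>w. G t *v V w) \<in> L2_adapted M F t" if "V \<in> L2_adapted M F t" for t V
    by (rule adapted_linear[OF matrix_vector_mul_bounded_linear that])
  show ?thesis
    using ito_process_diff[OF X[unfolded linear_process_def] Y[unfolded linear_process_def] a a]
      ito_processD(2)[OF X[unfolded linear_process_def]] ito_processD(2)[OF Y[unfolded linear_process_def]]
    by (simp add: linear_process_def matrix_vector_mult_diff_distrib)
qed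

lemma linear_process_restrict: "linear_process A G s X \<Longrightarrow> s \<le> t \<Longrightarrow> linear_process A G t X"
  unfolding linear_process_def by (rule ito_process_restrict)

text \<open>At a time where the distance of \<open>u\<close> and \<open>y\<close> attains its
  maximum m over the cell, the smallness conditions leave at most m / 2 to the linear part, which is
  absorbed. What remains does not depend on the size of \<open>A\<close> and
  \<open>G\<close>.\<close>

lemma local_response:
  fixes A G :: "real \<Rightarrow> real^'n^'n"
  assumes u: "ito_process 0 u (\<lambda>t w. A t *v u t w + \<phi> t w) (\<lambda>t w. G t *v u t w + \<psi> t w)"
    and y: "linear_process A G s y" and init: "AE w in M. y s w = u s w" and s: "0 \<le> s" "s \<le> t" "t - s \<le> 1"
    and L: "\<And>r. s \<le> r \<Longrightarrow> \<phi> r \<in> L2 M" "\<And>r. s \<le> r \<Longrightarrow> \<psi> r \<in> L2 M"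
    and C: "\<And>r. r \<in> {s..t} \<Longrightarrow> matrix_norm (A r) \<le> C" "\<And>r. r \<in> {s..t} \<Longrightarrow> matrix_norm (G r) \<le> C" "0 \<le> C"
    and small: "C * (t - s) \<le> 1 / 4" "C * sqrt (t - s) \<le> 1 / 4"
    and H: "\<And>r. r \<in> {s..t} \<Longrightarrow> L2_norm M (\<phi> r) \<le> H" "\<And>r. r \<in> {s..t} \<Longrightarrow> L2_norm M (\<psi> r) \<le> H"
  shows "L2_norm M (\<lambda>w. u t w - y t w) \<le> 4 * H"
proof -
  note u' = ito_process_restrict[OF u s(1)] and y' = y[unfolded linear_process_def]
  note D = ito_processD[OF u'] and D' = ito_processD[OF y']
  have "continuous_on {s..t} (\<lambda>r. L2_norm M (\<lambda>w. u r w - y r w))"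
    by (intro L2_continuous_on_norm L2_continuous_on_diff L2_continuous_on_subset[OF ito_process_continuous[OF u']]
        L2_continuous_on_subset[OF ito_process_continuous[OF y']]) auto
  then obtain r where r: "r \<in> {s..t}" "\<And>x. x \<in> {s..t} \<Longrightarrow> L2_norm M (\<lambda>w. u x w - y x w) \<le> L2_norm M (\<lambda>w. u r w - y r w)"
    using continuous_attains_sup[of "{s..t}" "\<lambda>r. L2_norm M (\<lambda>w. u r w - y r w)"] s(2) by auto
  define m where "m = L2_norm M (\<lambda>w. u r w - y r w)"
  have m: "0 \<le> m" by (simp add: m_def)
  have H0: "0 \<le> H" using H(1)[OF r(1)] L2_norm_nonneg[of M "\<phi> r"] by linarith
  have bnd: "L2_norm M (\<lambda>w. B x *v u x w + \<eta> x w - B x *v y x w) \<le> C * m + H"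
    if x: "x \<in> {s..r}" and B: "matrix_norm (B x) \<le> C" and \<eta>: "L2_norm M (\<eta> x) \<le> H" "\<eta> x \<in> L2 M" for x \<eta> and B :: "real \<Rightarrow> real^'n^'n"
  proof -
    have d: "(\<lambda>w. u x w - y x w) \<in> L2 M" using x by (intro L2_diff D D') auto
    have "L2_norm M (\<lambda>w. B x *v u x w + \<eta> x w - B x *v y x w) = L2_norm M (\<lambda>w. B x *v (u x w - y x w) + \<eta> x w)"
      by (simp add: matrix_vector_mult_diff_distrib algebra_simps)
    also have "\<dots> \<le> L2_norm M (\<lambda>w. B x *v (u x w - y x w)) + L2_norm M (\<eta> x)"
      by (intro L2_norm_triangle \<eta> L2_linear[OF matrix_vector_mul_bounded_linear d])
    also have "L2_norm M (\<lambda>w. B x *v (u x w - y x w)) \<le> matrix_norm (B x) * L2_norm M (\<lambda>w. u x w - y x w)"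
      by (rule L2_norm_matrix_vector[OF d])
    also have "\<dots> \<le> C * m"
      using x r by (intro mult_mono B C) (auto simp: m_def)
    finally show ?thesis using \<eta> by simp
  qed
  have P: "0 \<le> C * m + H" using C(3) m H0 by simp
  have "L2_norm M (\<lambda>w. u r w - y r w - (u s w - y s w)) \<le> (C * m + H) * (r - s) + (C * m + H) * sqrt (r - s)"
    by (rule ito_process_diff_bound[OF u' y' order_refl _ _ P _ P]) (use r C H L bnd in auto)
  also have "L2_norm M (\<lambda>w. u r w - y r w - (u s w - y s w)) = m"
    unfolding m_def
    by (rule L2_norm_cong_AE) (use init r in \<open>auto intro!: L2_diff D D'\<close>)
  also have "(C * m + H) * (r - s) + (C * m + H) * sqrt (r - s) \<le> (C * m + H) * (t - s) + (C * m + H) * sqrt (t - s)"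
    using r P by (intro add_mono mult_left_mono) auto
  also have "\<dots> = m * (C * (t - s)) + m * (C * sqrt (t - s)) + H * (t - s) + H * sqrt (t - s)"
    by (simp add: algebra_simps)
  also have "\<dots> \<le> m * (1 / 4) + m * (1 / 4) + H * 1 + H * 1"
    using s by (intro add_mono mult_left_mono small m H0) auto
  finally have "m \<le> 4 * H" by simp
  then show ?thesis using r(2)[of t] s by (simp add: m_def)
qed

end

section \<open>The a priori bound\<close>

text \<open>The points follow d\<tau>/dj = \<kappa> exp(-2 \<epsilon> \<tau>), solved by \<tau> =
  ln(1 + 2 \<epsilon> \<kappa> j) / (2 \<epsilon>). Thus exp(2 \<epsilon> \<tau>) is affine in j:
  the points tend to infinity, ln(1 + x) <= x bounds the steps, and the sum is one of inverse
  squares.\<close>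

lemma grid_exists:
  fixes \<epsilon> \<kappa> :: real
  assumes \<epsilon>: "0 < \<epsilon>" and \<kappa>: "0 < \<kappa>"
  obtains \<tau> :: "nat \<Rightarrow> real" and S where "\<tau> 0 = 0" "\<And>j. \<tau> j \<le> \<tau> (Suc j)"
    "\<And>j. \<tau> (Suc j) - \<tau> j \<le> \<kappa> * exp (- 2 * \<epsilon> * \<tau> j)" "\<And>t. \<exists>n. t \<le> \<tau> n"
    "0 \<le> S" "\<And>n. (\<Sum>j<n. exp (- 4 * \<epsilon> * \<tau> j)) \<le> S"
proof -
  define b where "b = 2 * \<epsilon> * \<kappa>"
  have b: "0 < b" using assms by (simp add: b_def)
  define \<tau> where "\<tau> = (\<lambda>j. ln (1 + b * real j) / (2 * \<epsilon>))"
  have p: "0 < 1 + b * real j" for j using b by (simp add: add_pos_nonneg)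
  have e: "exp (2 * \<epsilon> * \<tau> j) = 1 + b * real j" for j using \<epsilon> p[of j] by (simp add: \<tau>_def)
  have e4: "exp (- 4 * \<epsilon> * \<tau> j) = 1 / (1 + b * real j)\<^sup>2" for j
  proof -
    have "exp (- 4 * \<epsilon> * \<tau> j) = 1 / (exp (2 * \<epsilon> * \<tau> j))\<^sup>2"
      by (simp add: power2_eq_square exp_minus inverse_eq_divide flip: exp_add)
    then show ?thesis by (simp add: e)
  qed
  have step: "\<tau> (Suc j) - \<tau> j \<le> \<kappa> * exp (- 2 * \<epsilon> * \<tau> j)" for j
  proof -
    have "\<tau> (Suc j) - \<tau> j = ln ((1 + b * real (Suc j)) / (1 + b * real j)) / (2 * \<epsilon>)"
      using p[of j] p[of "Suc j"] by (simp add: \<tau>_def ln_div diff_divide_distrib)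
    also have "(1 + b * real (Suc j)) / (1 + b * real j) = 1 + b / (1 + b * real j)"
      using p[of j] by (simp add: field_simps)
    also have "ln (1 + b / (1 + b * real j)) / (2 * \<epsilon>) \<le> b / (1 + b * real j) / (2 * \<epsilon>)"
      using b p[of j] \<epsilon> by (intro divide_right_mono ln_add_one_self_le_self) auto
    also have "\<dots> = \<kappa> / exp (2 * \<epsilon> * \<tau> j)" using \<epsilon> by (simp add: e b_def)
    also have "\<dots> = \<kappa> * exp (- 2 * \<epsilon> * \<tau> j)" by (simp add: exp_minus divide_inverse)
    finally show ?thesis .
  qed
  have mono: "\<tau> j \<le> \<tau> (Suc j)" for j
    unfolding \<tau>_def using b \<epsilon> p[of j] by (intro divide_right_mono) (simp_all add: algebra_simps)
  have cof: "\<exists>n. t \<le> \<tau> n" for t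
  proof -
    obtain n where "exp (2 * \<epsilon> * t) / b < real n" using reals_Archimedean2 by blast
    then have "exp (2 * \<epsilon> * t) < b * real n" using b by (simp add: field_simps)
    then have "exp (2 * \<epsilon> * t) < exp (2 * \<epsilon> * \<tau> n)" unfolding e by simp
    then have "t \<le> \<tau> n" using \<epsilon> by simp
    then show ?thesis by blast
  qed
  have sm: "summable (\<lambda>j. exp (- 4 * \<epsilon> * \<tau> j))"
  proof (rule summable_comparison_test')
    \<comment> \<open>This m satisfies m (j + 1) <= 1 + b j for all j, which allows comparison with
      the sum of 1 / (j + 1)^2.\<close>
    define m where "m = min 1 b"
    have m: "0 < m" using b by (simp add: m_def)
    show "summable (\<lambda>j. (1 / m\<^sup>2) * inverse (real (Suc j) ^ 2))"
      using inverse_power_summable[of 2, where 'a = real] by (intro summable_mult) (subst summable_Suc_iff, simp)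
    show "norm (exp (- 4 * \<epsilon> * \<tau> j)) \<le> (1 / m\<^sup>2) * inverse (real (Suc j) ^ 2)" if "0 \<le> j" for j
    proof -
      have "m * real (Suc j) = m + m * real j" by (simp add: algebra_simps)
      also have "\<dots> \<le> 1 + b * real j" by (intro add_mono mult_right_mono) (auto simp: m_def)
      finally have "(m * real (Suc j))\<^sup>2 \<le> (1 + b * real j)\<^sup>2" using m by (intro power_mono) auto
      moreover have "0 < (m * real (Suc j))\<^sup>2" using m by simp
      ultimately have "1 / (1 + b * real j)\<^sup>2 \<le> 1 / (m * real (Suc j))\<^sup>2"
        by (intro divide_left_mono mult_pos_pos zero_less_power p m) auto
      then show ?thesis unfolding e4 by (simp add: power_mult_distrib divide_inverse)
    qed
  qed
  show ?thesis
  proof (rule that)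
    show "\<tau> 0 = 0" by (simp add: \<tau>_def)
    show "0 \<le> (\<Sum>j. exp (- 4 * \<epsilon> * \<tau> j))" by (rule suminf_nonneg[OF sm]) simp
    show "(\<Sum>j<n. exp (- 4 * \<epsilon> * \<tau> j)) \<le> (\<Sum>j. exp (- 4 * \<epsilon> * \<tau> j))" for n
      by (rule sum_le_suminf[OF sm]) auto
  qed (rule mono step cof)+
qed

text \<open>Growth of order 1 + q raises the decay rate \<alpha>/2 of \<open>x\<close> to \<alpha>(1
  + q)/2 for \<open>y\<close>; this surplus is what competes with the nonuniformity \<beta>.\<close>

lemma power_growth_bound:
  fixes x y c q N \<alpha> r :: real
  assumes "y\<^sup>2 \<le> c * x\<^sup>2 * (x\<^sup>2) powr q" "0 \<le> x" "x \<le> N * exp (- \<alpha> * r / 2)" "0 < N" "0 < c" "0 < q"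
  shows "y \<le> sqrt c * N * N powr q * exp (- \<alpha> * (1 + q) * r / 2)"
proof -
  define E where "E = exp (- \<alpha> * r / 2)"
  have E: "0 < E" by (simp add: E_def)
  have x2: "x\<^sup>2 \<le> (N * E)\<^sup>2" using assms by (intro power_mono) (auto simp: E_def)
  have "(x\<^sup>2) powr q \<le> ((N * E)\<^sup>2) powr q" using x2 assms by (intro powr_mono2) auto
  also have "\<dots> = ((N * E) powr q)\<^sup>2"
    using assms E by (simp add: powr_power powr_powr mult.commute flip: powr_numeral)
  also have "(N * E) powr q = N powr q * exp (- \<alpha> * r / 2 * q)"
    using assms E by (simp add: powr_mult) (simp add: E_def powr_def)
  finally have xq: "(x\<^sup>2) powr q \<le> (N powr q * exp (- \<alpha> * r / 2 * q))\<^sup>2" .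
  have "y\<^sup>2 \<le> c * (N * E)\<^sup>2 * (N powr q * exp (- \<alpha> * r / 2 * q))\<^sup>2"
    by (rule order_trans[OF assms(1)]) (intro mult_mono x2 xq order_refl mult_nonneg_nonneg; use assms in simp)
  also have "\<dots> = (sqrt c * (N * E) * (N powr q * exp (- \<alpha> * r / 2 * q)))\<^sup>2"
    using assms by (simp add: power_mult_distrib)
  also have "sqrt c * (N * E) * (N powr q * exp (- \<alpha> * r / 2 * q)) = sqrt c * N * N powr q * (E * exp (- \<alpha> * r / 2 * q))"
    by (simp add: mult_ac)
  also have "E * exp (- \<alpha> * r / 2 * q) = exp (- \<alpha> * (1 + q) * r / 2)"
    unfolding E_def by (simp flip: exp_add) (simp add: field_simps)
  finally show ?thesis by (rule power2_le_imp_le) (use assms in simp)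
qed

text \<open>If the level N were reached, there would be a first such time, since the level set is
  compact; up to that time y <= N, so the hypothesis gives y < N there.\<close>

lemma continuous_bootstrap:
  fixes y :: "real \<Rightarrow> real"
  assumes c: "continuous_on {0..} y" and y0: "y 0 < N"
    and imp: "\<And>t. 0 \<le> t \<Longrightarrow> (\<And>r. r \<in> {0..t} \<Longrightarrow> y r \<le> N) \<Longrightarrow> y t < N" and t: "0 \<le> t"
  shows "y t < N"
proof (rule ccontr)
  assume "\<not> y t < N"
  then have yt: "N \<le> y t" by simp
  let ?Z = "{0..t} \<inter> y -` {N}"
  have ct: "continuous_on {0..t} y" by (rule continuous_on_subset[OF c]) auto
  have "closed ?Z" by (rule continuous_closed_preimage[OF ct]) auto
  then have cmp: "compact ?Z" by (intro compact_eq_bounded_closed[THEN iffD2] conjI bounded_Int disjI1 bounded_closed_interval) auto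
  have "\<exists>r\<ge>0. r \<le> t \<and> y r = N" using IVT'[of y 0 N t] y0 yt t ct by auto
  then have ne: "?Z \<noteq> {}" by auto
  obtain m where m: "m \<in> ?Z" "\<And>r. r \<in> ?Z \<Longrightarrow> m \<le> r" using compact_attains_inf[OF cmp ne] by blast
  have "y r \<le> N" if r: "r \<in> {0..m}" for r
  proof (rule ccontr)
    assume "\<not> y r \<le> N"
    then have yr: "N < y r" by simp
    have "continuous_on {0..r} y" by (rule continuous_on_subset[OF c]) auto
    then obtain x where "0 \<le> x" "x \<le> r" "y x = N" using IVT'[of y 0 N r] y0 yr r by auto
    then have "m \<le> x" using m r by auto
    then have "x = r" using \<open>x \<le> r\<close> r by auto
    then show False using yr \<open>y x = N\<close> by simp
  qed
  then have "y m < N" using imp[of m] m(1) by auto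
  then show False using m(1) by simp
qed

context brownian_basis
begin

text \<open>Minkowski's inequality is essential here: estimating \<open>E |u|\<^sup>2\<close> directly leads to cross terms
  that need \<open>2 \<beta> < q \<alpha>\<close>.\<close>

lemma restart_estimate:
  fixes A G :: "real \<Rightarrow> real^'n^'n"
  assumes A: "continuous_on {0..} A" and G: "continuous_on {0..} G"
    and flow: "\<And>s t X. 0 \<le> s \<Longrightarrow> s \<le> t \<Longrightarrow> linear_process A G s X \<Longrightarrow>
      L2_norm M (X t) \<le> sqrt K * exp ((- \<alpha> * (t - s) + \<beta> * s) / 2) * L2_norm M (X s)"
    and K: "0 < K" and \<alpha>: "0 < \<alpha>" and \<beta>: "0 \<le> \<beta>" and c: "0 < c" and q: "0 < q"
    and \<epsilon>: "0 < \<epsilon>" "8 * \<epsilon> = q * \<alpha> - \<beta>"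
    and C: "0 < C" "\<And>t. 0 \<le> t \<Longrightarrow> matrix_norm (A t) \<le> C * exp (\<epsilon> * t)" "\<And>t. 0 \<le> t \<Longrightarrow> matrix_norm (G t) \<le> C * exp (\<epsilon> * t)"
    and \<kappa>: "0 < \<kappa>" "\<kappa> \<le> 1" "C * exp \<epsilon> * \<kappa> \<le> 1 / 4" "C * exp \<epsilon> * sqrt \<kappa> \<le> 1 / 4"
    and \<tau>: "\<tau> 0 = 0" "\<And>j. \<tau> j \<le> \<tau> (Suc j)" "\<And>j. \<tau> (Suc j) - \<tau> j \<le> \<kappa> * exp (- 2 * \<epsilon> * \<tau> j)"
      "\<And>t. \<exists>n. t \<le> \<tau> n" "\<And>n. (\<Sum>j<n. exp (- 4 * \<epsilon> * \<tau> j)) \<le> S"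
    and u: "ito_process 0 u (\<lambda>t w. A t *v u t w + \<phi> t w) (\<lambda>t w. G t *v u t w + \<psi> t w)"
    and L: "\<And>r. 0 \<le> r \<Longrightarrow> \<phi> r \<in> L2 M" "\<And>r. 0 \<le> r \<Longrightarrow> \<psi> r \<in> L2 M"
    and gr: "\<And>r. 0 \<le> r \<Longrightarrow> (L2_norm M (\<phi> r))\<^sup>2 \<le> c * (L2_norm M (u r))\<^sup>2 * ((L2_norm M (u r))\<^sup>2) powr q"
      "\<And>r. 0 \<le> r \<Longrightarrow> (L2_norm M (\<psi> r))\<^sup>2 \<le> c * (L2_norm M (u r))\<^sup>2 * ((L2_norm M (u r))\<^sup>2) powr q"
    and t: "0 \<le> t" and N: "0 < N" "\<And>r. r \<in> {0..t} \<Longrightarrow> L2_norm M (u r) \<le> N * exp (- \<alpha> * r / 2)"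
  shows "L2_norm M (u t) \<le> (sqrt K * L2_norm M (u 0) +
    4 * sqrt K * sqrt c * exp ((\<alpha> + \<beta>) / 2) * S * (N * N powr q)) * exp (- \<alpha> * t / 2)"
proof -
  have mono: "\<tau> i \<le> \<tau> j" if "i \<le> j" for i j using lift_Suc_mono_le[of \<tau>, OF \<tau>(2) that] .
  have \<tau>0: "0 \<le> \<tau> j" for j using mono[of 0 j] \<tau>(1) by simp
  \<comment> \<open>The least grid index that reaches t; all earlier grid points lie strictly before
    t.\<close>
  define n where "n = (LEAST n. t \<le> \<tau> n)"
  have n: "t \<le> \<tau> n" "\<And>j. j < n \<Longrightarrow> \<tau> j < t"
    unfolding n_def using LeastI_ex[OF \<tau>(4)[of t]] not_less_Least by (auto simp: not_le[symmetric])
  \<comment> \<open>Stopping the grid at t makes the last cell end at t, so the solution restarted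
    at index n equals \<open>u t\<close>.\<close>
  define \<sigma> where "\<sigma> = (\<lambda>j. min (\<tau> j) t)"
  have \<sigma>: "0 \<le> \<sigma> j" "\<sigma> j \<le> t" "\<sigma> j \<le> \<sigma> (Suc j)" for j using \<tau>0 t \<tau>(2)[of j] by (auto simp: \<sigma>_def)
  note D = ito_processD[OF u]
  have "\<exists>Y. linear_process A G (\<sigma> j) Y \<and> (AE w in M. Y (\<sigma> j) w = u (\<sigma> j) w)" for j
    by (rule linear_process_exists[OF A G \<sigma>(1) D(2)[OF \<sigma>(1)]])
  then obtain y where y: "\<And>j. linear_process A G (\<sigma> j) (y j)" "\<And>j. AE w in M. y j (\<sigma> j) w = u (\<sigma> j) w" by metis
  have yL: "y j r \<in> L2 M" if "\<sigma> j \<le> r" for j r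
    using ito_processD(3)[OF y(1)[of j, unfolded linear_process_def] that] .
  define Q where "Q = 4 * sqrt K * sqrt c * exp ((\<alpha> + \<beta>) / 2) * (N * N powr q) * exp (- \<alpha> * t / 2)"
  have defect: "L2_dist M (y (Suc j) t) (y j t) \<le> Q * exp (- 4 * \<epsilon> * \<tau> j)" if j: "j < n" for j
  proof -
    define s where "s = \<sigma> j"
    define s' where "s' = \<sigma> (Suc j)"
    have s\<tau>: "s = \<tau> j" using n(2)[OF j] by (simp add: s_def \<sigma>_def)
    have s0: "0 \<le> s" "s \<le> s'" "s' \<le> t" using \<sigma> by (auto simp: s_def s'_def)
    have len: "s' - s \<le> \<kappa> * exp (- 2 * \<epsilon> * s)"
      using \<tau>(3)[of j] unfolding s\<tau> s'_def \<sigma>_def by linarith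
    have "exp (- 2 * \<epsilon> * s) \<le> 1" using \<epsilon>(1) s0 by simp
    then have "\<kappa> * exp (- 2 * \<epsilon> * s) \<le> 1 * 1" using \<kappa> by (intro mult_mono) auto
    then have l1: "s' - s \<le> 1" using len by simp
    \<comment> \<open>A bound for the linear coefficients on the whole cell: its length is at most
      1, which costs the factor exp \<epsilon>.\<close>
    define C' where "C' = C * exp \<epsilon> * exp (\<epsilon> * s)"
    have C': "0 \<le> C'" using C(1) by (simp add: C'_def)
    have CC: "C * exp (\<epsilon> * r) \<le> C'" if "r \<in> {s..s'}" for r
    proof -
      have "\<epsilon> * r \<le> \<epsilon> * (1 + s)" using \<epsilon>(1) l1 that by (intro mult_left_mono) auto
      then have "exp (\<epsilon> * r) \<le> exp \<epsilon> * exp (\<epsilon> * s)" by (simp add: distrib_left flip: exp_add)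
      then show ?thesis using C(1) by (simp add: C'_def mult.assoc)
    qed
    have "C' * (s' - s) \<le> C' * (\<kappa> * exp (- 2 * \<epsilon> * s))" using len C' by (rule mult_left_mono)
    also have "\<dots> = C * exp \<epsilon> * \<kappa> * exp (- \<epsilon> * s)"
    proof -
      have "exp (- \<epsilon> * s) = exp (\<epsilon> * s) * exp (- 2 * \<epsilon> * s)" by (simp flip: exp_add)
      then show ?thesis by (simp add: C'_def mult_ac)
    qed
    also have "\<dots> \<le> C * exp \<epsilon> * \<kappa> * 1" using C(1) \<kappa>(1) \<epsilon>(1) s0 by (intro mult_left_mono) auto
    finally have sm1: "C' * (s' - s) \<le> 1 / 4" using \<kappa>(3) by simp
    \<comment> \<open>Noise scales with the square root of the cell length; this estimate is what
      dictates cells of order exp(-2 \<epsilon> s).\<close>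
    have "sqrt (s' - s) \<le> sqrt (\<kappa> * exp (- 2 * \<epsilon> * s))" using len by simp
    also have "\<dots> = sqrt \<kappa> * exp (- \<epsilon> * s)"
    proof -
      have "exp (- 2 * \<epsilon> * s) = (exp (- \<epsilon> * s))\<^sup>2" by (simp add: power2_eq_square flip: exp_add)
      then show ?thesis by (simp add: real_sqrt_mult)
    qed
    finally have "C' * sqrt (s' - s) \<le> C' * (sqrt \<kappa> * exp (- \<epsilon> * s))" using C' by (rule mult_left_mono)
    also have "\<dots> = C * exp \<epsilon> * sqrt \<kappa> * (exp (\<epsilon> * s) * exp (- \<epsilon> * s))" by (simp add: C'_def)
    also have "exp (\<epsilon> * s) * exp (- \<epsilon> * s) = 1" by (simp flip: exp_add)
    finally have sm2: "C' * sqrt (s' - s) \<le> 1 / 4" using \<kappa>(4) by simp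
    define H where "H = sqrt c * N * N powr q * exp (- \<alpha> * (1 + q) * s / 2)"
    have Hm: "sqrt c * N * N powr q * exp (- \<alpha> * (1 + q) * r / 2) \<le> H" if "s \<le> r" for r
      unfolding H_def using that \<alpha> q c N(1) by (intro mult_left_mono) auto
    have H: "L2_norm M (\<phi> r) \<le> H" "L2_norm M (\<psi> r) \<le> H" if r: "r \<in> {s..s'}" for r
    proof -
      have r': "0 \<le> r" "r \<in> {0..t}" "s \<le> r" using r s0 by auto
      show "L2_norm M (\<phi> r) \<le> H"
        using power_growth_bound[OF gr(1)[OF r'(1)] L2_norm_nonneg N(2)[OF r'(2)] N(1) c q] Hm[OF r'(3)] by linarith
      show "L2_norm M (\<psi> r) \<le> H"
        using power_growth_bound[OF gr(2)[OF r'(1)] L2_norm_nonneg N(2)[OF r'(2)] N(1) c q] Hm[OF r'(3)] by linarith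
    qed
    have loc: "L2_norm M (\<lambda>w. u s' w - y j s' w) \<le> 4 * H"
    proof (rule local_response[OF u y(1)[of j, folded s_def] y(2)[of j, folded s_def] s0(1,2) l1 _ _ _ _ C' sm1 sm2 H])
      show "matrix_norm (A r) \<le> C'" "matrix_norm (G r) \<le> C'" if "r \<in> {s..s'}" for r
        using CC[OF that] C(2)[of r] C(3)[of r] s0 that by auto
    qed (use L s0 in auto)
    \<comment> \<open>Restarting changes the linear solution by another linear solution whose value
      at s' is the defect u - y j, so the contraction estimate applies to the change.\<close>
    have V: "linear_process A G s' (\<lambda>r w. y (Suc j) r w - y j r w)"
      using y(1)[of "Suc j"] linear_process_restrict[OF y(1)[of j] \<sigma>(3)] unfolding s'_def by (rule linear_process_diff)
    have "L2_dist M (y (Suc j) t) (y j t) \<le> sqrt K * exp ((- \<alpha> * (t - s') + \<beta> * s') / 2) * L2_norm M (\<lambda>w. y (Suc j) s' w - y j s' w)"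
      unfolding L2_dist_norm using flow[OF order_trans[OF s0(1,2)] s0(3) V] .
    also have "L2_norm M (\<lambda>w. y (Suc j) s' w - y j s' w) = L2_norm M (\<lambda>w. u s' w - y j s' w)"
    proof (rule L2_norm_cong_AE)
      show "AE w in M. y (Suc j) s' w - y j s' w = u s' w - y j s' w"
        using y(2)[of "Suc j"] unfolding s'_def by eventually_elim simp
    qed (auto intro!: L2_diff yL D(3) simp: s'_def \<sigma>)
    also have "sqrt K * exp ((- \<alpha> * (t - s') + \<beta> * s') / 2) * L2_norm M (\<lambda>w. u s' w - y j s' w)
      \<le> sqrt K * exp (- \<alpha> * t / 2 + (\<alpha> + \<beta>) * (s + 1) / 2) * (4 * H)"
    proof (intro mult_mono loc)
      have "(\<alpha> + \<beta>) * s' \<le> (\<alpha> + \<beta>) * (s + 1)" using l1 \<alpha> \<beta> by (intro mult_left_mono) auto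
      then show "exp ((- \<alpha> * (t - s') + \<beta> * s') / 2) \<le> exp (- \<alpha> * t / 2 + (\<alpha> + \<beta>) * (s + 1) / 2)"
        unfolding exp_le_cancel_iff
      proof -
        have "(- \<alpha> * (t - s') + \<beta> * s') / 2 = - \<alpha> * t / 2 + (\<alpha> + \<beta>) * s' / 2" by (simp add: field_simps)
        then show "(- \<alpha> * (t - s') + \<beta> * s') / 2 \<le> - \<alpha> * t / 2 + (\<alpha> + \<beta>) * (s + 1) / 2"
          using \<open>(\<alpha> + \<beta>) * s' \<le> (\<alpha> + \<beta>) * (s + 1)\<close> by linarith
      qed
    qed (use K in auto)
    also have "\<dots> = 4 * sqrt K * sqrt c * (N * N powr q) * (exp (- \<alpha> * t / 2 + (\<alpha> + \<beta>) * (s + 1) / 2) * exp (- \<alpha> * (1 + q) * s / 2))"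
      by (simp add: H_def mult_ac)
    also have "exp (- \<alpha> * t / 2 + (\<alpha> + \<beta>) * (s + 1) / 2) * exp (- \<alpha> * (1 + q) * s / 2)
      = exp ((\<alpha> + \<beta>) / 2) * exp (- \<alpha> * t / 2) * exp (- 4 * \<epsilon> * s)"
    proof -
      \<comment> \<open>The coefficients of s/2 add up to (\<alpha> + \<beta>) - \<alpha>(1 + q) =
        -8 \<epsilon>; the part from s + 1 is the constant exp((\<alpha> + \<beta>)/2).\<close>
      have "- \<alpha> * t / 2 + (\<alpha> + \<beta>) * (s + 1) / 2 + - \<alpha> * (1 + q) * s / 2 = (\<alpha> + \<beta>) / 2 + - \<alpha> * t / 2 + - (8 * \<epsilon>) * s / 2"
        unfolding \<epsilon>(2) by (simp add: field_simps)
      then show ?thesis by (simp flip: exp_add)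
    qed
    finally show ?thesis by (simp add: Q_def s\<tau> mult_ac)
  qed
  have tele: "L2_norm M (y k t) \<le> L2_norm M (y 0 t) + (\<Sum>j<k. Q * exp (- 4 * \<epsilon> * \<tau> j))" if "k \<le> n" for k
    using that
  proof (induction k)
    case (Suc k)
    have "L2_norm M (y (Suc k) t) \<le> L2_norm M (y k t) + L2_dist M (y (Suc k) t) (y k t)"
      using L2_norm_diff_le[OF yL yL, of "Suc k" t k t] \<sigma>(2) by auto
    then show ?case using Suc defect[of k] by simp
  qed simp
  have "L2_norm M (u t) = L2_norm M (y n t)"
  proof (rule L2_norm_cong_AE)
    have "\<sigma> n = t" using n(1) by (simp add: \<sigma>_def)
    then show "AE w in M. u t w = y n t w" using y(2)[of n] by auto
  qed (use t \<sigma> in \<open>auto intro: yL D(3)\<close>)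
  also have "\<dots> \<le> L2_norm M (y 0 t) + (\<Sum>j<n. Q * exp (- 4 * \<epsilon> * \<tau> j))" by (rule tele) simp
  also have "\<dots> \<le> sqrt K * exp (- \<alpha> * t / 2) * L2_norm M (u 0) + Q * S"
  proof (rule add_mono)
    have s0: "\<sigma> 0 = 0" using \<tau>(1) t by (simp add: \<sigma>_def)
    have "L2_norm M (y 0 0) = L2_norm M (u 0)"
      by (rule L2_norm_cong_AE) (use y(2)[of 0] s0 yL[of 0 0] D(3)[of 0] in auto)
    then show "L2_norm M (y 0 t) \<le> sqrt K * exp (- \<alpha> * t / 2) * L2_norm M (u 0)"
      using flow[OF order_refl t, of "y 0"] y(1)[of 0] s0 by simp
    have "0 \<le> Q" using K c N by (simp add: Q_def)
    then show "(\<Sum>j<n. Q * exp (- 4 * \<epsilon> * \<tau> j)) \<le> Q * S"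
      using \<tau>(5)[of n] by (simp flip: sum_distrib_left add: mult_left_mono)
  qed
  finally show ?thesis by (simp add: Q_def algebra_simps)
qed

text \<open>Only the size of the perturbation along \<open>u\<close> is retained, so that one a
  priori bound covers both the original and the truncated equation.\<close>

definition power_bounded :: "real \<Rightarrow> real \<Rightarrow> (real \<Rightarrow> 'w \<Rightarrow> real^'n) \<Rightarrow> (real \<Rightarrow> 'w \<Rightarrow> real^'n) \<Rightarrow> bool" where
  "power_bounded c q u \<phi> \<longleftrightarrow> (\<forall>r\<ge>0. \<phi> r \<in> L2 M \<and>
     (L2_norm M (\<phi> r))\<^sup>2 \<le> c * (L2_norm M (u r))\<^sup>2 * ((L2_norm M (u r))\<^sup>2) powr q)"

text \<open>The constants are fixed before \<open>u\<close> and its perturbations. For y t = norm of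
  u t times exp(\<alpha> t/2), the restart estimate improves y <= N to y <= N / 2, and the
  continuity argument closes.\<close>

lemma a_priori_bound:
  fixes A G :: "real \<Rightarrow> real^'n^'n"
  assumes A: "continuous_on {0..} A" and G: "continuous_on {0..} G"
    and flow: "\<And>s t X. 0 \<le> s \<Longrightarrow> s \<le> t \<Longrightarrow> linear_process A G s X \<Longrightarrow>
      L2_norm M (X t) \<le> sqrt K * exp ((- \<alpha> * (t - s) + \<beta> * s) / 2) * L2_norm M (X s)"
    and K: "0 < K" and \<alpha>: "0 < \<alpha>" and \<beta>: "0 \<le> \<beta>" and c: "0 < c" and q: "0 < q" "0 < q * \<alpha> - \<beta>"
    and growth: "Limsup at_top (\<lambda>t. ereal (log_plus (matrix_norm (A t)) / t)) = 0"
      "Limsup at_top (\<lambda>t. ereal (log_plus (matrix_norm (G t)) / t)) = 0"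
  obtains \<delta> N where "0 < \<delta>" "0 < N"
    "\<And>u \<phi> \<psi> t. ito_process 0 u (\<lambda>t w. A t *v u t w + \<phi> t w) (\<lambda>t w. G t *v u t w + \<psi> t w) \<Longrightarrow>
      L2_norm M (u 0) \<le> \<delta> \<Longrightarrow>
      power_bounded c q u \<phi> \<Longrightarrow> power_bounded c q u \<psi> \<Longrightarrow>
      0 \<le> t \<Longrightarrow> L2_norm M (u t) \<le> N * exp (- \<alpha> * t / 2)"
proof -
  \<comment> \<open>Passing to norms halves q \<alpha> - \<beta> to 4 \<epsilon>; half of this pays
    for the growing number of grid points per unit of time.\<close>
  define \<epsilon> where "\<epsilon> = (q * \<alpha> - \<beta>) / 8"
  have \<epsilon>: "0 < \<epsilon>" "8 * \<epsilon> = q * \<alpha> - \<beta>" using q by (auto simp: \<epsilon>_def)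
  obtain C1 where C1: "0 < C1" "\<And>t. 0 \<le> t \<Longrightarrow> matrix_norm (A t) \<le> C1 * exp (\<epsilon> * t)"
    using matrix_norm_subexponential[OF A growth(1) \<epsilon>(1)] by blast
  obtain C2 where C2: "0 < C2" "\<And>t. 0 \<le> t \<Longrightarrow> matrix_norm (G t) \<le> C2 * exp (\<epsilon> * t)"
    using matrix_norm_subexponential[OF G growth(2) \<epsilon>(1)] by blast
  define C where "C = max C1 C2"
  have C: "0 < C" "\<And>t. 0 \<le> t \<Longrightarrow> matrix_norm (A t) \<le> C * exp (\<epsilon> * t)" "\<And>t. 0 \<le> t \<Longrightarrow> matrix_norm (G t) \<le> C * exp (\<epsilon> * t)"
    using C1(1) order_trans[OF C1(2) mult_right_mono[of C1 C]] order_trans[OF C2(2) mult_right_mono[of C2 C]]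
    by (auto simp: C_def)
  define B where "B = C * exp \<epsilon>"
  have B: "0 < B" using C(1) by (simp add: B_def)
  \<comment> \<open>Both B \<kappa> and B sqrt \<kappa> must be at most 1/4; the square makes sqrt
    \<kappa> explicit, and \<kappa> <= sqrt \<kappa> reduces the first condition to the
    second.\<close>
  define \<kappa> where "\<kappa> = (1 / (4 * (B + 1)))\<^sup>2"
  have sk: "sqrt \<kappa> = 1 / (4 * (B + 1))" using B by (simp add: \<kappa>_def)
  have s1: "1 / (4 * (B + 1)) \<le> 1" "0 < 1 / (4 * (B + 1))" using B by auto
  have \<kappa>1: "0 < \<kappa>" "\<kappa> \<le> 1 / (4 * (B + 1))"
    using s1(2) mult_left_mono[OF s1(1) less_imp_le[OF s1(2)]] unfolding \<kappa>_def power2_eq_square by simp_all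
  have B4: "B * (1 / (4 * (B + 1))) \<le> 1 / 4" using B by (simp add: field_simps)
  have "B * \<kappa> \<le> B * (1 / (4 * (B + 1)))" using \<kappa>1(2) B by (intro mult_left_mono) auto
  then have \<kappa>: "0 < \<kappa>" "\<kappa> \<le> 1" "C * exp \<epsilon> * \<kappa> \<le> 1 / 4" "C * exp \<epsilon> * sqrt \<kappa> \<le> 1 / 4"
    using \<kappa>1 s1 B4 unfolding sk B_def[symmetric] by linarith+
  obtain \<tau> S where \<tau>: "\<tau> 0 = 0" "\<And>j. \<tau> j \<le> \<tau> (Suc j)"
    "\<And>j. \<tau> (Suc j) - \<tau> j \<le> \<kappa> * exp (- 2 * \<epsilon> * \<tau> j)" "\<And>t. \<exists>n. t \<le> \<tau> n"
    "0 \<le> S" "\<And>n. (\<Sum>j<n. exp (- 4 * \<epsilon> * \<tau> j)) \<le> S" using grid_exists[OF \<epsilon>(1) \<kappa>(1)] by blast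
  define R where "R = 4 * sqrt K * sqrt c * exp ((\<alpha> + \<beta>) / 2) * S"
  have R: "0 \<le> R" using K c \<tau>(5) by (simp add: R_def)
  \<comment> \<open>The level at which R N^q <= 1/4, so that the superlinear term uses at most a
    quarter of N.\<close>
  define N where "N = (1 / (4 * (R + 1))) powr (1 / q)"
  have N: "0 < N" using R by (simp add: N_def)
  have Nq: "N powr q = 1 / (4 * (R + 1))" using q R by (simp add: N_def powr_powr)
  have RN: "R * (N * N powr q) \<le> N / 4"
  proof -
    have "R * (N * N powr q) = N * (R * (1 / (4 * (R + 1))))" unfolding Nq by simp
    also have "\<dots> \<le> N * (1 / 4)" using N R by (intro mult_left_mono) (auto simp: field_simps)
    finally show ?thesis by simp
  qed
  \<comment> \<open>The initial value may use another quarter, sqrt K \<delta> <= N / 4; adding 1 to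
    sqrt K also gives \<delta> < N, with which the continuity argument starts, even for small
    K.\<close>
  define \<delta> where "\<delta> = N / (4 * (sqrt K + 1))"
  have \<delta>: "0 < \<delta>" "sqrt K * \<delta> \<le> N / 4" "\<delta> < N"
  proof -
    define x where "x = sqrt K"
    have x: "0 < x" "\<delta> = N / (4 * (x + 1))" using K by (simp_all add: x_def \<delta>_def)
    show d: "0 < \<delta>" using N x by simp
    have "N = 4 * (x * \<delta>) + 4 * \<delta>" using x by (simp add: field_simps)
    then show "sqrt K * \<delta> \<le> N / 4" using d by (simp add: x_def[symmetric])
    have "N * 1 < N * (4 * (x + 1))" using N x by (intro mult_strict_left_mono) auto
    then show "\<delta> < N" using x by (simp add: pos_divide_less_eq)
  qed
  show ?thesis
  proof (rule that[OF \<delta>(1) N])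
    fix u \<phi> \<psi> :: "real \<Rightarrow> 'w \<Rightarrow> real^'n" and t :: real
    assume u: "ito_process 0 u (\<lambda>t w. A t *v u t w + \<phi> t w) (\<lambda>t w. G t *v u t w + \<psi> t w)"
      and u0: "L2_norm M (u 0) \<le> \<delta>" and t: "0 \<le> t"
      and gr: "power_bounded c q u \<phi>" "power_bounded c q u \<psi>"
    define y where "y = (\<lambda>t. L2_norm M (u t) * exp (\<alpha> * t / 2))"
    have yN: "y r \<le> m \<longleftrightarrow> L2_norm M (u r) \<le> m * exp (- \<alpha> * r / 2)" for r m
      by (simp add: y_def exp_minus field_simps)
    have "y t < N"
    proof (rule continuous_bootstrap[OF _ _ _ t])
      show "continuous_on {0..} y"
        unfolding y_def by (intro continuous_intros L2_continuous_on_norm ito_process_continuous[OF u]) auto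
      show "y 0 < N" using u0 \<delta>(3) by (simp add: y_def)
      fix r :: real assume r: "0 \<le> r" and le: "\<And>x. x \<in> {0..r} \<Longrightarrow> y x \<le> N"
      have "L2_norm M (u r) \<le> (sqrt K * L2_norm M (u 0) +
          4 * sqrt K * sqrt c * exp ((\<alpha> + \<beta>) / 2) * S * (N * N powr q)) * exp (- \<alpha> * r / 2)"
        by (rule restart_estimate[OF A G flow K \<alpha> \<beta> c q(1) \<epsilon> C \<kappa> \<tau>(1-4,6) u _ _ _ _ r N])
          (use gr[unfolded power_bounded_def] le[unfolded yN] in auto)
      then have "y r \<le> sqrt K * L2_norm M (u 0) + R * (N * N powr q)"
        unfolding yN R_def .
      also have "\<dots> \<le> N / 4 + N / 4"
        using order_trans[OF mult_left_mono[OF u0 real_sqrt_ge_zero[OF less_imp_le[OF K]]] \<delta>(2)] RN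
        by (rule add_mono)
      finally show "y r < N" using N by simp
    qed
    then show "L2_norm M (u t) \<le> N * exp (- \<alpha> * t / 2)" using yN[of t N] by simp
  qed
qed

end

section \<open>Truncation and the main theorem\<close>

text \<open>Truncated and original coefficients will be known to agree only along the solution and
  at nonnegative times.\<close>

lemma has_L2_integral_cong:
  assumes "has_L2_integral M g a b Y" and eq: "\<And>s. s \<in> {a..b} \<Longrightarrow> g s = g' s"
  shows "has_L2_integral M g' a b Y"
proof -
  have "(\<lambda>s. L2_dist M (g' s) (V s)) integrable_on {a..b} \<longleftrightarrow> (\<lambda>s. L2_dist M (g s) (V s)) integrable_on {a..b}"
    "integral {a..b} (\<lambda>s. L2_dist M (g' s) (V s)) = integral {a..b} (\<lambda>s. L2_dist M (g s) (V s))" for V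
    by (auto intro!: integrable_cong Henstock_Kurzweil_Integration.integral_cong simp: eq)
  then show ?thesis using assms(1) eq unfolding has_L2_integral_def by simp
qed

lemma has_ito_integral_cong:
  assumes "has_ito_integral M F W g a b Y" and eq: "\<And>s. s \<in> {a..b} \<Longrightarrow> g s = g' s"
  shows "has_ito_integral M F W g' a b Y"
proof -
  have "(\<lambda>s. (L2_dist M (g' s) (V s))\<^sup>2) integrable_on {a..b} \<longleftrightarrow> (\<lambda>s. (L2_dist M (g s) (V s))\<^sup>2) integrable_on {a..b}"
    "integral {a..b} (\<lambda>s. (L2_dist M (g' s) (V s))\<^sup>2) = integral {a..b} (\<lambda>s. (L2_dist M (g s) (V s))\<^sup>2)" for V
    by (auto intro!: integrable_cong Henstock_Kurzweil_Integration.integral_cong simp: eq)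
  then show ?thesis using assms(1) eq unfolding has_ito_integral_def by simp
qed

lemma L2_continuous_coeff_compose:
  assumes f: "L2_continuous_coeff M f" and X: "L2_continuous_on M {0..} X"
  shows "L2_continuous_on M {0..} (\<lambda>t. f t (X t))"
  unfolding L2_continuous_on_def
proof (intro conjI ballI)
  have XL: "X t \<in> L2 M" if "0 \<le> t" for t using L2_continuous_onD[OF X] that by simp
  show "f t (X t) \<in> L2 M" if "t \<in> {0..}" for t
    using f XL[of t] that by (simp add: L2_continuous_coeff_def)
  fix t :: real assume "t \<in> {0..}"
  then have t: "0 \<le> t" by simp
  show "((\<lambda>r. L2_dist M (f r (X r)) (f t (X t))) \<longlongrightarrow> 0) (at t within {0..})"
  proof (rule tendstoI)
    fix e :: real assume "0 < e"
    then have "\<exists>d>0. \<forall>s\<ge>0. \<forall>v\<in>L2 M. \<bar>s - t\<bar> < d \<and> L2_dist M v (X t) < d \<longrightarrow> L2_dist M (f s v) (f t (X t)) < e"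
      using f t XL[OF t] unfolding L2_continuous_coeff_def by blast
    then obtain d where d: "0 < d" "\<And>s v. 0 \<le> s \<Longrightarrow> v \<in> L2 M \<Longrightarrow> \<bar>s - t\<bar> < d \<Longrightarrow> L2_dist M v (X t) < d \<Longrightarrow>
        L2_dist M (f s v) (f t (X t)) < e"
      by blast
    have "((\<lambda>r. L2_dist M (X r) (X t)) \<longlongrightarrow> 0) (at t within {0..})"
      using X t by (simp add: L2_continuous_on_def)
    then have "\<forall>\<^sub>F r in at t within {0..}. dist (L2_dist M (X r) (X t)) 0 < d"
      using d(1) by (rule tendstoD)
    moreover have "\<forall>\<^sub>F r in at t within {0..}. dist r t < d \<and> r \<in> {0..}"
      using d(1) by (auto simp: eventually_at intro!: exI[of _ d])
    ultimately show "\<forall>\<^sub>F r in at t within {0..}. dist (L2_dist M (f r (X r)) (f t (X t))) 0 < e"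
      by eventually_elim (auto intro!: d(2) XL simp: dist_real_def)
  qed
qed

text \<open>The factor depends on \<open>U\<close> only through its L^2 norm and is a deterministic
  number, so adaptedness is preserved. A pointwise cut-off would alter solutions that are small only
  in mean square.\<close>

definition L2_truncate :: "'w measure \<Rightarrow> real \<Rightarrow> ('w \<Rightarrow> 'b::euclidean_space) \<Rightarrow> 'w \<Rightarrow> 'b" where
  "L2_truncate M R U = (\<lambda>w. (R / max R (L2_norm M U)) *\<^sub>R U w)"

lemma L2_truncate_id: "0 < R \<Longrightarrow> L2_norm M U \<le> R \<Longrightarrow> L2_truncate M R U = U"
  by (simp add: L2_truncate_def max_def)

lemma L2_truncate_L2: "U \<in> L2 M \<Longrightarrow> L2_truncate M R U \<in> L2 M"
  unfolding L2_truncate_def by (rule L2_scaleR)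

lemma L2_truncate_norm:
  assumes "0 < R"
  shows "L2_norm M (L2_truncate M R U) \<le> R" "L2_norm M (L2_truncate M R U) \<le> L2_norm M U"
proof -
  let ?m = "max R (L2_norm M U)"
  have m: "0 < ?m" "L2_norm M U \<le> ?m" "R \<le> ?m" using assms by auto
  have e: "L2_norm M (L2_truncate M R U) = R * L2_norm M U / ?m"
    using assms m(1) by (simp add: L2_truncate_def L2_norm_scaleR)
  show "L2_norm M (L2_truncate M R U) \<le> R"
    unfolding e using mult_left_mono[OF m(2), of R] assms m(1) by (simp add: pos_divide_le_eq)
  show "L2_norm M (L2_truncate M R U) \<le> L2_norm M U"
    unfolding e using mult_right_mono[OF m(3) L2_norm_nonneg] m(1) by (simp add: pos_divide_le_eq mult.commute)
qed

text \<open>Changing the vector and changing the factor each cost at most one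
  \<open>L2_dist M U V\<close>; the second because \<open>max R (L2_norm M U)\<close> is 1-Lipschitz
  in \<open>U\<close>.\<close>

lemma L2_truncate_lipschitz:
  assumes R: "0 < R" and U: "U \<in> L2 M" and V: "V \<in> L2 M"
  shows "L2_dist M (L2_truncate M R U) (L2_truncate M R V) \<le> 2 * L2_dist M U V"
proof -
  define a b where "a = max R (L2_norm M U)" and "b = max R (L2_norm M V)"
  have ab: "0 < a" "0 < b" "R \<le> a" "L2_norm M V \<le> b" using R by (auto simp: a_def b_def)
  have d: "\<bar>b - a\<bar> \<le> L2_dist M U V"
    using L2_norm_diff_le[OF U V] unfolding a_def b_def by linarith
  have "L2_dist M (L2_truncate M R U) (L2_truncate M R V) = L2_norm M (\<lambda>w. (R / a) *\<^sub>R (U w - V w) + (R / a - R / b) *\<^sub>R V w)"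
    by (simp add: L2_dist_norm L2_truncate_def a_def b_def algebra_simps)
  also have "\<dots> \<le> L2_norm M (\<lambda>w. (R / a) *\<^sub>R (U w - V w)) + L2_norm M (\<lambda>w. (R / a - R / b) *\<^sub>R V w)"
    by (intro L2_norm_triangle L2_scaleR L2_diff U V)
  also have "L2_norm M (\<lambda>w. (R / a) *\<^sub>R (U w - V w)) \<le> 1 * L2_dist M U V"
    unfolding L2_norm_scaleR L2_dist_norm using ab R by (intro mult_right_mono) auto
  also have "L2_norm M (\<lambda>w. (R / a - R / b) *\<^sub>R V w) \<le> L2_dist M U V"
  proof -
    have "R / a - R / b = (R / a) * ((b - a) / b)" using ab by (simp add: field_simps)
    then have "L2_norm M (\<lambda>w. (R / a - R / b) *\<^sub>R V w) = (R / a) * (L2_norm M V / b) * \<bar>b - a\<bar>"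
      using ab R by (simp add: L2_norm_scaleR abs_mult)
    also have "\<dots> \<le> (1 * 1) * L2_dist M U V"
      using ab R d by (intro mult_mono) auto
    finally show ?thesis by simp
  qed
  finally show ?thesis by simp
qed

lemma (in brownian_basis) L2_truncate_adapted:
  "U \<in> L2_adapted M F t \<Longrightarrow> L2_truncate M R U \<in> L2_adapted M F t"
  unfolding L2_truncate_def by (rule adapted_scaleR)

lemma L2_truncate_continuous:
  assumes R: "0 < R" and X: "L2_continuous_on M S X"
  shows "L2_continuous_on M S (\<lambda>t. L2_truncate M R (X t))"
proof (rule L2_continuous_onI_le)
  note XL = L2_continuous_onD[OF X]
  show "L2_truncate M R (X s) \<in> L2 M" if "s \<in> S" for s by (rule L2_truncate_L2[OF XL[OF that]])
  show "((\<lambda>r. 2 * L2_dist M (X r) (X s)) \<longlongrightarrow> 0) (at s within S)" if "s \<in> S" for s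
    using X that by (auto simp: L2_continuous_on_def intro!: tendsto_eq_intros)
  show "L2_dist M (L2_truncate M R (X r)) (L2_truncate M R (X s)) \<le> 2 * L2_dist M (X r) (X s)" if "r \<in> S" "s \<in> S" for r s
    by (rule L2_truncate_lipschitz[OF R XL[OF that(1)] XL[OF that(2)]])
qed

definition power_lipschitz ::
  "'w measure \<Rightarrow> real \<Rightarrow> real \<Rightarrow> (real \<Rightarrow> ('w \<Rightarrow> 'b::euclidean_space) \<Rightarrow> ('w \<Rightarrow> 'b)) \<Rightarrow> bool" where
  "power_lipschitz M c q f \<longleftrightarrow> (\<forall>t\<ge>0. \<forall>u\<in>L2 M. \<forall>v\<in>L2 M.
     (L2_dist M (f t u) (f t v))\<^sup>2 \<le> c * (L2_dist M u v)\<^sup>2 * ((L2_norm M u)\<^sup>2 + (L2_norm M v)\<^sup>2) powr q)"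

lemma power_lipschitz_growth:
  assumes f: "power_lipschitz M c q f" "L2_continuous_coeff M f" and f0: "AE w in M. f t (\<lambda>_. 0) w = 0"
    and t: "0 \<le> t" and u: "u \<in> L2 M"
  shows "(L2_norm M (f t u))\<^sup>2 \<le> c * (L2_norm M u)\<^sup>2 * ((L2_norm M u)\<^sup>2) powr q"
proof -
  have fL: "f t v \<in> L2 M" if "v \<in> L2 M" for v using f(2) t that by (simp add: L2_continuous_coeff_def)
  have "L2_norm M (f t u) = L2_dist M (f t u) (f t (\<lambda>w. 0))"
    unfolding L2_dist_norm
  proof (rule L2_norm_cong_AE)
    show "AE w in M. f t u w = f t u w - f t (\<lambda>w. 0) w" using f0 by eventually_elim simp
  qed (auto intro!: L2_diff fL u)
  also have "\<dots>\<^sup>2 \<le> c * (L2_dist M u (\<lambda>w. 0))\<^sup>2 * ((L2_norm M u)\<^sup>2 + (L2_norm M (\<lambda>w. 0 :: 'b))\<^sup>2) powr q"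
    using f(1) t u unfolding power_lipschitz_def by (auto simp del: L2_norm_zero)
  finally show ?thesis by (simp add: L2_dist_norm)
qed

lemma power_lipschitz_ball:
  assumes f: "power_lipschitz M c q f" and c: "0 < c" "0 < q" and R: "0 < R" and t: "0 \<le> t"
    and u: "u \<in> L2 M" "L2_norm M u \<le> R" and v: "v \<in> L2 M" "L2_norm M v \<le> R"
  shows "L2_dist M (f t u) (f t v) \<le> sqrt (c * (2 * R\<^sup>2) powr q) * L2_dist M u v"
proof (rule power2_le_imp_le)
  have "(L2_norm M u)\<^sup>2 \<le> R\<^sup>2" "(L2_norm M v)\<^sup>2 \<le> R\<^sup>2" using u v by (auto intro: power_mono)
  then have p: "((L2_norm M u)\<^sup>2 + (L2_norm M v)\<^sup>2) powr q \<le> (2 * R\<^sup>2) powr q"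
    using c by (intro powr_mono2) auto
  have "(L2_dist M (f t u) (f t v))\<^sup>2 \<le> c * (L2_dist M u v)\<^sup>2 * ((L2_norm M u)\<^sup>2 + (L2_norm M v)\<^sup>2) powr q"
    using f t u v unfolding power_lipschitz_def by blast
  also have "\<dots> \<le> c * (L2_dist M u v)\<^sup>2 * (2 * R\<^sup>2) powr q" using p c by (intro mult_left_mono) auto
  also have "\<dots> = (sqrt (c * (2 * R\<^sup>2) powr q) * L2_dist M u v)\<^sup>2"
    using c by (simp add: power_mult_distrib)
  finally show "(L2_dist M (f t u) (f t v))\<^sup>2 \<le> (sqrt (c * (2 * R\<^sup>2) powr q) * L2_dist M u v)\<^sup>2" .
qed (use c in simp)

context brownian_basis
begin

lemma perturbed_solution_ito_process:
  fixes A G :: "real \<Rightarrow> real^'n^'n"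
  assumes u: "perturbed_solution M F W A G f h \<xi>0 u" and A: "continuous_on {0..} A" and G: "continuous_on {0..} G"
    and f: "L2_continuous_coeff M f" and h: "L2_continuous_coeff M h"
  shows "ito_process 0 u (\<lambda>t w. A t *v u t w + f t (u t) w) (\<lambda>t w. G t *v u t w + h t (u t) w)"
    "AE w in M. u 0 w = \<xi>0"
proof -
  note S = u[unfolded perturbed_solution_def sde_solution_def]
  have ua: "u t \<in> L2_adapted M F t" if "0 \<le> t" for t using S that by blast
  have uc: "L2_continuous_on M {0..} u"
    unfolding L2_continuous_on_def
  proof (intro conjI ballI)
    show "u t \<in> L2 M" if "t \<in> {0..}" for t using adapted_L2[OF ua] that by simp
    have "\<forall>t\<ge>0. ((\<lambda>s. L2_dist M (u s) (u t)) \<longlongrightarrow> 0) (at t within {0..})" using S by blast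
    then show "((\<lambda>s. L2_dist M (u s) (u t)) \<longlongrightarrow> 0) (at t within {0..})" if "t \<in> {0..}" for t using that by simp
  qed
  have c: "L2_continuous_on M {0..} (\<lambda>t w. A t *v u t w + f t (u t) w)"
    "L2_continuous_on M {0..} (\<lambda>t w. G t *v u t w + h t (u t) w)"
    by (rule L2_continuous_on_add[OF L2_continuous_on_bilinear[OF bounded_bilinear_matrix_vector A uc] L2_continuous_coeff_compose[OF f uc]]
        L2_continuous_on_add[OF L2_continuous_on_bilinear[OF bounded_bilinear_matrix_vector G uc] L2_continuous_coeff_compose[OF h uc]])+
  have eq: "\<exists>Y Z. has_L2_integral M (\<lambda>t w. A t *v u t w + f t (u t) w) 0 t Y \<and>
      has_ito_integral M F W (\<lambda>t w. G t *v u t w + h t (u t) w) 0 t Z \<and>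
      (AE w in M. u t w = (\<lambda>w. \<xi>0) w + Y w + Z w)" if "0 \<le> t" for t
    using S that by blast
  show "ito_process 0 u (\<lambda>t w. A t *v u t w + f t (u t) w) (\<lambda>t w. G t *v u t w + h t (u t) w)"
    "AE w in M. u 0 w = \<xi>0"
    by (rule ito_processI[OF order_refl ua c eq]; assumption)+
qed

text \<open>The perturbations are Lipschitz only on balls of L^2. The common bound R, later supplied
  by the a priori bound, keeps both solutions in one ball, where Gronwall's inequality
  applies.\<close>

lemma perturbed_solution_unique:
  fixes A G :: "real \<Rightarrow> real^'n^'n"
  assumes u: "perturbed_solution M F W A G f h \<xi>0 u" and v: "perturbed_solution M F W A G f h \<xi>0 v"
    and A: "continuous_on {0..} A" and G: "continuous_on {0..} G"
    and f: "L2_continuous_coeff M f" "power_lipschitz M c q f" and h: "L2_continuous_coeff M h" "power_lipschitz M c q h"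
    and c: "0 < c" "0 < q" and R: "0 < R"
    and bu: "\<And>t. 0 \<le> t \<Longrightarrow> L2_norm M (u t) \<le> R" and bv: "\<And>t. 0 \<le> t \<Longrightarrow> L2_norm M (v t) \<le> R"
    and t: "0 \<le> t"
  shows "AE w in M. u t w = v t w"
proof -
  note U = perturbed_solution_ito_process[OF u A G f(1) h(1)] and V = perturbed_solution_ito_process[OF v A G f(1) h(1)]
  note UL = ito_processD(3)[OF U(1)] and VL = ito_processD(3)[OF V(1)]
  have lip: "\<exists>B\<ge>0. \<forall>r\<in>{0..t}. L2_norm M (\<lambda>w. H r *v u r w + k r (u r) w - (H r *v v r w + k r (v r) w)) \<le> B * L2_norm M (\<lambda>w. u r w - v r w)"
    if H: "continuous_on {0..} H" and k: "L2_continuous_coeff M k" "power_lipschitz M c q k" for H :: "real \<Rightarrow> real^'n^'n" and k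
  proof -
    obtain B where B: "0 \<le> B" "\<And>r. r \<in> {0..t} \<Longrightarrow> matrix_norm (H r) \<le> B"
      using matrix_norm_bounded[OF H, of t] by blast
    define L where "L = sqrt (c * (2 * R\<^sup>2) powr q)"
    have "L2_norm M (\<lambda>w. H r *v u r w + k r (u r) w - (H r *v v r w + k r (v r) w)) \<le> (B + L) * L2_norm M (\<lambda>w. u r w - v r w)"
      if r: "r \<in> {0..t}" for r
    proof -
      have r0: "0 \<le> r" using r by simp
      have d: "(\<lambda>w. u r w - v r w) \<in> L2 M" by (intro L2_diff UL VL r0)
      have kL: "k r (u r) \<in> L2 M" "k r (v r) \<in> L2 M" using k(1) UL[OF r0] VL[OF r0] r0 by (auto simp: L2_continuous_coeff_def)
      have "L2_norm M (\<lambda>w. H r *v u r w + k r (u r) w - (H r *v v r w + k r (v r) w))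
        = L2_norm M (\<lambda>w. H r *v (u r w - v r w) + (k r (u r) w - k r (v r) w))"
        by (simp add: matrix_vector_mult_diff_distrib algebra_simps)
      also have "\<dots> \<le> L2_norm M (\<lambda>w. H r *v (u r w - v r w)) + L2_dist M (k r (u r)) (k r (v r))"
        unfolding L2_dist_norm by (intro L2_norm_triangle L2_diff kL L2_linear[OF matrix_vector_mul_bounded_linear d])
      also have "L2_norm M (\<lambda>w. H r *v (u r w - v r w)) \<le> B * L2_norm M (\<lambda>w. u r w - v r w)"
        by (rule order_trans[OF L2_norm_matrix_vector[OF d] mult_right_mono[OF B(2)[OF r] L2_norm_nonneg]])
      also have "L2_dist M (k r (u r)) (k r (v r)) \<le> L * L2_dist M (u r) (v r)"
        unfolding L_def by (rule power_lipschitz_ball[OF k(2) c R r0 UL[OF r0] bu[OF r0] VL[OF r0] bv[OF r0]])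
      finally show ?thesis by (simp add: L2_dist_norm distrib_right)
    qed
    moreover have "0 \<le> B + L" using B(1) c by (simp add: L_def)
    ultimately show ?thesis by blast
  qed
  obtain B1 where B1: "0 \<le> B1" "\<And>r. r \<in> {0..t} \<Longrightarrow> L2_norm M (\<lambda>w. A r *v u r w + f r (u r) w - (A r *v v r w + f r (v r) w)) \<le> B1 * L2_norm M (\<lambda>w. u r w - v r w)"
    using lip[OF A f] by blast
  obtain B2 where B2: "0 \<le> B2" "\<And>r. r \<in> {0..t} \<Longrightarrow> L2_norm M (\<lambda>w. G r *v u r w + h r (u r) w - (G r *v v r w + h r (v r) w)) \<le> B2 * L2_norm M (\<lambda>w. u r w - v r w)"
    using lip[OF G h] by blast
  show ?thesis
  proof (rule ito_process_unique[OF U(1) V(1) _ t, of "B1 + B2"])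
    show "AE w in M. u 0 w = v 0 w" using U(2) V(2) by eventually_elim simp
    show "0 \<le> B1 + B2" using B1(1) B2(1) by simp
    show "L2_norm M (\<lambda>w. A r *v u r w + f r (u r) w - (A r *v v r w + f r (v r) w)) \<le> (B1 + B2) * L2_norm M (\<lambda>w. u r w - v r w)"
      if "r \<in> {0..t}" for r
      by (rule order_trans[OF B1(2)[OF that]]) (use B2(1) in \<open>simp add: mult_right_mono\<close>)
    show "L2_norm M (\<lambda>w. G r *v u r w + h r (u r) w - (G r *v v r w + h r (v r) w)) \<le> (B1 + B2) * L2_norm M (\<lambda>w. u r w - v r w)"
      if "r \<in> {0..t}" for r
      by (rule order_trans[OF B2(2)[OF that]]) (use B1(1) in \<open>simp add: mult_right_mono\<close>)
  qed
qed

text \<open>The retraction maps into a ball on which the power-type bound is a Lipschitz bound, and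
  it is itself 2-Lipschitz; the composition is globally Lipschitz, uniformly in t.\<close>

lemma admissible_truncated:
  assumes A: "continuous_on {0..} (A :: real \<Rightarrow> real^'n^'n)"
    and f: "L2_continuous_coeff M f" "power_lipschitz M c q f" "nonanticipating M F f"
    and c: "0 < c" "0 < q" and R: "0 < R"
  shows "admissible_coeff 0 (\<lambda>t U w. A t *v U w + f t (L2_truncate M R U) w)"
  unfolding admissible_coeff_def
proof (intro conjI allI impI ballI)
  note adm = admissible_matrix[OF A order_refl, unfolded admissible_coeff_def]
  show "(\<lambda>w. A t *v U w + f t (L2_truncate M R U) w) \<in> L2_adapted M F t" if "0 \<le> t" "U \<in> L2_adapted M F t" for t U
  proof (rule adapted_add)
    show "(\<lambda>w. A t *v U w) \<in> L2_adapted M F t" using adm that by blast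
    show "f t (L2_truncate M R U) \<in> L2_adapted M F t"
      using f(3) L2_truncate_adapted[OF that(2)] that(1) unfolding nonanticipating_def by blast
  qed
  show "L2_continuous_on M {0..} (\<lambda>t w. A t *v X t w + f t (L2_truncate M R (X t)) w)" if "L2_continuous_on M {0..} X" for X
    by (rule L2_continuous_on_add[OF L2_continuous_on_bilinear[OF bounded_bilinear_matrix_vector A that]
        L2_continuous_coeff_compose[OF f(1) L2_truncate_continuous[OF R that]]])
  fix T
  obtain La where La: "L2_lipschitz_on 0 T (\<lambda>t U w. A t *v U w) La" using adm by blast
  define L where "L = sqrt (c * (2 * R\<^sup>2) powr q)"
  have L0: "0 \<le> L" using c by (simp add: L_def)
  have "L2_dist M (\<lambda>w. A t *v U w + f t (L2_truncate M R U) w) (\<lambda>w. A t *v V w + f t (L2_truncate M R V) w)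
      \<le> (La + L * 2) * L2_dist M U V" if t: "t \<in> {0..T}" and U: "U \<in> L2 M" and V: "V \<in> L2 M" for t U V
  proof -
    have t0: "0 \<le> t" using t by simp
    note tL = L2_truncate_L2[OF U, of R] L2_truncate_L2[OF V, of R]
    have fL: "f t (L2_truncate M R U) \<in> L2 M" "f t (L2_truncate M R V) \<in> L2 M"
      using f(1) tL t0 by (auto simp: L2_continuous_coeff_def)
    have AL: "(\<lambda>w. A t *v U w) \<in> L2 M" "(\<lambda>w. A t *v V w) \<in> L2 M"
      by (auto intro!: L2_linear[OF matrix_vector_mul_bounded_linear] U V)
    have "L2_dist M (\<lambda>w. A t *v U w + f t (L2_truncate M R U) w) (\<lambda>w. A t *v V w + f t (L2_truncate M R V) w)
      = L2_norm M (\<lambda>w. (A t *v U w - A t *v V w) + (f t (L2_truncate M R U) w - f t (L2_truncate M R V) w))"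
      by (simp add: L2_dist_norm algebra_simps)
    also have "\<dots> \<le> L2_dist M (\<lambda>w. A t *v U w) (\<lambda>w. A t *v V w) + L2_dist M (f t (L2_truncate M R U)) (f t (L2_truncate M R V))"
      unfolding L2_dist_norm by (intro L2_norm_triangle L2_diff AL fL)
    also have "L2_dist M (\<lambda>w. A t *v U w) (\<lambda>w. A t *v V w) \<le> La * L2_dist M U V"
      using La t U V by (auto simp: L2_lipschitz_on_def)
    also have "L2_dist M (f t (L2_truncate M R U)) (f t (L2_truncate M R V)) \<le> L * L2_dist M (L2_truncate M R U) (L2_truncate M R V)"
      unfolding L_def
      by (rule power_lipschitz_ball[OF f(2) c R t0 tL(1) L2_truncate_norm(1)[OF R] tL(2) L2_truncate_norm(1)[OF R]])
    also have "\<dots> \<le> L * (2 * L2_dist M U V)" by (rule mult_left_mono[OF L2_truncate_lipschitz[OF R U V] L0])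
    finally show ?thesis by (simp add: algebra_simps)
  qed
  moreover have "0 \<le> La + L * 2" using La L0 by (simp add: L2_lipschitz_on_def)
  ultimately show "\<exists>L. L2_lipschitz_on 0 T (\<lambda>t U w. A t *v U w + f t (L2_truncate M R U) w) L"
    unfolding L2_lipschitz_on_def by blast
qed

end

text \<open>The phrase "the solution" is resolved into decay of every solution, uniqueness, and
  existence. Existence is asserted for nonanticipating coefficients, since the Ito integral of
  \<open>h t (u t)\<close> is built from values known at time t. The constants do not depend on the
  initial value.\<close>

theorem theorem1p3:
  fixes M :: "'w measure"
    and I :: "real set"
    and F :: "real \<Rightarrow> 'w measure"
    and W :: "real \<Rightarrow> 'w \<Rightarrow> real"
    and A G :: "real \<Rightarrow> real^'n^'n"
    and \<Phi> :: "real \<Rightarrow> 'w \<Rightarrow> real^'n^'n"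
    and f h :: "real \<Rightarrow> ('w \<Rightarrow> real^'n) \<Rightarrow> ('w \<Rightarrow> real^'n)"
    and K \<alpha> \<beta> c q :: real
  assumes "prob_space M"
    and "I = {0..} \<or> I = UNIV"
    and "filtration_on M I F"
    and "brownian_motion_on M I F W"
    and "continuous_on I A" and "continuous_on I G"
    and "Limsup at_top (\<lambda>t. ereal (log_plus (matrix_norm (A t)) / t)) = 0"
    and "Limsup at_top (\<lambda>t. ereal (log_plus (matrix_norm (G t)) / t)) = 0"
    and "fundamental_matrix M I F W A G \<Phi>"
    and "nonuniform_ms_exp_contraction M I \<Phi> K \<alpha> \<beta>"
    and "L2_continuous_coeff M f" and "L2_continuous_coeff M h"
    and "\<And>t. t \<ge> 0 \<Longrightarrow> AE w in M. f t (\<lambda>_. 0) w = 0"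
    and "\<And>t. t \<ge> 0 \<Longrightarrow> AE w in M. h t (\<lambda>_. 0) w = 0"
    and "c > 0" and "q > 1"
    and "\<And>t u v. t \<ge> 0 \<Longrightarrow> u \<in> L2 M \<Longrightarrow> v \<in> L2 M \<Longrightarrow>
           max (\<integral>w. (norm (f t u w - f t v w))\<^sup>2 \<partial>M) (\<integral>w. (norm (h t u w - h t v w))\<^sup>2 \<partial>M)
             \<le> c * (\<integral>w. (norm (u w - v w))\<^sup>2 \<partial>M) *
                 ((\<integral>w. (norm (u w))\<^sup>2 \<partial>M) + (\<integral>w. (norm (v w))\<^sup>2 \<partial>M)) powr q"
    and "- q * \<alpha> + \<beta> < 0"
  shows "\<exists>\<delta>>0. \<exists>K'>0. \<forall>\<xi>0. norm \<xi>0 \<le> \<delta> \<longrightarrow>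
           (\<forall>u. perturbed_solution M F W A G f h \<xi>0 u \<longrightarrow>
              (\<forall>t\<ge>0. (\<integral>w. (norm (u t w))\<^sup>2 \<partial>M) \<le> K' * exp (- \<alpha> * t))) \<and>
           (\<forall>u v. perturbed_solution M F W A G f h \<xi>0 u \<and> perturbed_solution M F W A G f h \<xi>0 v \<longrightarrow>
              (\<forall>t\<ge>0. AE w in M. u t w = v t w)) \<and>
           (nonanticipating M F f \<and> nonanticipating M F h \<longrightarrow>
              (\<exists>u. perturbed_solution M F W A G f h \<xi>0 u))"
proof -
  have I: "{0..} \<subseteq> I" using assms(2) by auto
  interpret brownian_basis M F W by (rule brownian_basisI[OF assms(1,3,4) I])
  have A: "continuous_on {0..} A" and G: "continuous_on {0..} G"
    using assms(5,6) I by (auto intro: continuous_on_subset)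
  have K: "0 < K" "0 < \<alpha>" "0 \<le> \<beta>"
    using assms(10) by (auto simp: nonuniform_ms_exp_contraction_def)
  have q: "0 < q" "0 < q * \<alpha> - \<beta>" using assms(16,18) by auto
  have f: "power_lipschitz M c q f" and h: "power_lipschitz M c q h"
    using assms(17) unfolding power_lipschitz_def L2_dist_norm L2_norm_square_integral by auto
  note fc = assms(11) and hc = assms(12)
  have coeffL: "f t U \<in> L2 M" "h t U \<in> L2 M" if "0 \<le> t" "U \<in> L2 M" for t U
    using fc hc that by (auto simp: L2_continuous_coeff_def)
  note grow = power_lipschitz_growth[OF f fc assms(13)] power_lipschitz_growth[OF h hc assms(14)]
  obtain \<delta> N where \<delta>: "0 < \<delta>" and N: "0 < N"
    and bound: "\<And>u \<phi> \<psi> t. ito_process 0 u (\<lambda>t w. A t *v u t w + \<phi> t w) (\<lambda>t w. G t *v u t w + \<psi> t w) \<Longrightarrow>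
      L2_norm M (u 0) \<le> \<delta> \<Longrightarrow>
      power_bounded c q u \<phi> \<Longrightarrow> power_bounded c q u \<psi> \<Longrightarrow>
      0 \<le> t \<Longrightarrow> L2_norm M (u t) \<le> N * exp (- \<alpha> * t / 2)"
    using a_priori_bound[OF A G linear_process_contraction[OF assms(9) I A G assms(10)] K assms(15) q assms(7,8)]
    by blast
  have le_N: "N * exp (- \<alpha> * t / 2) \<le> N" if "0 \<le> t" for t
    using N K(2) that by (simp add: mult_le_cancel_left2)
  have init: "L2_norm M V \<le> \<delta>" if "AE w in M. V w = \<xi>0" "norm \<xi>0 \<le> \<delta>" "V \<in> L2 M"
    for V :: "'w \<Rightarrow> real^'n" and \<xi>0
    using L2_norm_cong_AE[OF that(1,3) L2_const] that(2) by simp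
  have decay: "L2_norm M (u t) \<le> N * exp (- \<alpha> * t / 2)"
    if u: "perturbed_solution M F W A G f h \<xi>0 u" and \<xi>: "norm \<xi>0 \<le> \<delta>" and t: "0 \<le> t" for \<xi>0 u t
  proof -
    note P = perturbed_solution_ito_process[OF u A G fc hc]
    note L = ito_processD(3)[OF P(1)]
    show ?thesis
      by (rule bound[OF P(1) init[OF P(2) \<xi> L[OF order_refl]] _ _ t])
        (simp_all add: power_bounded_def grow coeffL L)
  qed
  have ms: "(\<integral>w. (norm (u t w))\<^sup>2 \<partial>M) \<le> N\<^sup>2 * exp (- \<alpha> * t)"
    if "perturbed_solution M F W A G f h \<xi>0 u" "norm \<xi>0 \<le> \<delta>" "0 \<le> t" for \<xi>0 u t
  proof -
    have "(L2_norm M (u t))\<^sup>2 \<le> (N * exp (- \<alpha> * t / 2))\<^sup>2"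
      using decay[OF that] by (rule power_mono) simp
    also have "\<dots> = N\<^sup>2 * exp (- \<alpha> * t)" by (simp add: power_mult_distrib power2_eq_square flip: exp_add)
    finally show ?thesis by (simp add: L2_norm_square_integral)
  qed
  have uniq: "AE w in M. u t w = v t w"
    if u: "perturbed_solution M F W A G f h \<xi>0 u" and v: "perturbed_solution M F W A G f h \<xi>0 v"
      and \<xi>: "norm \<xi>0 \<le> \<delta>" and t: "0 \<le> t" for \<xi>0 u v t
    by (rule perturbed_solution_unique[OF u v A G fc f hc h assms(15) q(1) N _ _ t])
      (use order_trans[OF decay[OF u \<xi>] le_N] order_trans[OF decay[OF v \<xi>] le_N] in blast)+
  have ex: "\<exists>u. perturbed_solution M F W A G f h \<xi>0 u"
    if na: "nonanticipating M F f" "nonanticipating M F h" and \<xi>: "norm \<xi>0 \<le> \<delta>" for \<xi>0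
  proof -
    \<comment> \<open>The truncation radius is the a priori bound \<open>N\<close> itself: the bound
      holds for the truncated equation too, and so switches the truncation off along its
      solution.\<close>
    define B where "B = (\<lambda>t U w. A t *v U w + f t (L2_truncate M N U) w)"
    define S where "S = (\<lambda>t U w. G t *v U w + h t (L2_truncate M N U) w)"
    have adm: "admissible_coeff 0 B" "admissible_coeff 0 S"
      unfolding B_def S_def
      by (rule admissible_truncated[OF A fc f na(1) assms(15) q(1) N] admissible_truncated[OF G hc h na(2) assms(15) q(1) N])+
    obtain u where u: "solves B S 0 (\<lambda>w. \<xi>0) u u"
      using picard_existence[OF order_refl adapted_const adm] by blast
    have uc: "L2_continuous_on M {0..} u" using u by (simp add: solves_def)
    note P = solves_ito_process[OF u order_refl adm uc]
    note L = ito_processD(3)[OF P(1)]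
    have small: "L2_norm M (u t) \<le> N" if t: "0 \<le> t" for t
    proof -
      have "L2_norm M (u t) \<le> N * exp (- \<alpha> * t / 2)"
      proof (rule bound[OF P(1)[unfolded B_def S_def] init[OF P(2) \<xi> L[OF order_refl]] _ _ t])
        \<comment> \<open>The retraction does not increase norms, so the truncated perturbation
          obeys the same power bound in terms of the untruncated \<open>u r\<close>.\<close>
        have x: "(L2_norm M (L2_truncate M N (u r)))\<^sup>2 \<le> (L2_norm M (u r))\<^sup>2" for r
          by (intro power_mono L2_truncate_norm N) simp
        have m: "c * (L2_norm M (L2_truncate M N (u r)))\<^sup>2 * ((L2_norm M (L2_truncate M N (u r)))\<^sup>2) powr q
            \<le> c * (L2_norm M (u r))\<^sup>2 * ((L2_norm M (u r))\<^sup>2) powr q" for r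
          using x[of r] assms(15) q(1) by (intro mult_mono powr_mono2) auto
        note T = L2_truncate_L2[OF L, of _ N]
        show "power_bounded c q u (\<lambda>t. f t (L2_truncate M N (u t)))" "power_bounded c q u (\<lambda>t. h t (L2_truncate M N (u t)))"
          unfolding power_bounded_def using order_trans[OF grow(1) m] order_trans[OF grow(2) m] coeffL T by blast+
      qed
      then show ?thesis using le_N[OF t] by simp
    qed
    have tr: "L2_truncate M N (u t) = u t" if "0 \<le> t" for t
      by (rule L2_truncate_id[OF N small[OF that]])
    have eq: "B t (u t) = (\<lambda>w. A t *v u t w + f t (u t) w)" "S t (u t) = (\<lambda>w. G t *v u t w + h t (u t) w)" if "0 \<le> t" for t
      unfolding B_def S_def tr[OF that] by auto
    have "perturbed_solution M F W A G f h \<xi>0 u"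
      unfolding perturbed_solution_def sde_solution_def
    proof (intro conjI allI impI)
      show "u t \<in> L2_adapted M F t" if "0 \<le> t" for t using u that by (simp add: solves_def)
      show "((\<lambda>s. L2_dist M (u s) (u t)) \<longlongrightarrow> 0) (at t within {0..})" if "0 \<le> t" for t
        using uc that by (simp add: L2_continuous_on_def)
      fix t :: real assume t: "0 \<le> t"
      obtain Y Z where YZ: "has_L2_integral M (\<lambda>r. B r (u r)) 0 t Y" "has_ito_integral M F W (\<lambda>r. S r (u r)) 0 t Z"
        "AE w in M. u t w = \<xi>0 + Y w + Z w" using u t unfolding solves_def by blast
      have "has_L2_integral M (\<lambda>r w. A r *v u r w + f r (u r) w) 0 t Y"
        by (rule has_L2_integral_cong[OF YZ(1)]) (simp add: eq)
      moreover have "has_ito_integral M F W (\<lambda>r w. G r *v u r w + h r (u r) w) 0 t Z"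
        by (rule has_ito_integral_cong[OF YZ(2)]) (simp add: eq)
      ultimately show "\<exists>Y Z. has_L2_integral M (\<lambda>s w. A s *v u s w + f s (u s) w) 0 t Y \<and>
          has_ito_integral M F W (\<lambda>s w. G s *v u s w + h s (u s) w) 0 t Z \<and> (AE w in M. u t w = \<xi>0 + Y w + Z w)"
        using YZ(3) by blast
    qed
    then show ?thesis by blast
  qed
  show ?thesis
    by (rule exI[of _ \<delta>], rule conjI[OF \<delta>], rule exI[of _ "N\<^sup>2"]) (use N ms uniq ex in auto)
qed

end
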